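(* Let $\theta>0$, let $\sigma:\mathbb{R}\to\mathbb{R}$ be globally Lipschitz continuous with $\sigma\ge0$ on $\mathbb{R}$ and $\sigma(0)=0$, and let $\xi$ be a space-time white noise on $\mathbb{R}_+\times\mathbb{R}$. Let $u$ solve $$\frac{\partial}{\partial t}u_t(x)=\frac{\theta}{2}\frac{\partial^2}{\partial x^2}u_t(x)+\sigma(u_t(x))\,\xi(t,x)\qquad(t>0,\ x\in\mathbb{R}),$$ starting with a nonrandom and nonnegative initial function $u_0\in L^\infty(\mathbb{R})$. Then $u_0\in L^1(\mathbb{R})$ if and only if the system is finite, that is, if and only if $\|u_t\|_{L^1(\mathbb{R})}<\infty$ a.s. for all $t\ge0$.
   Context: Space-time white noise $\xi$ is the generalized centered Gaussian random field with $\mathrm{Cov}[\xi(t,x),\xi(s,y)]=\delta_0(s-t)\delta_0(x-y)$ for $s,t\ge0$, $x,y\in\mathbb{R}$. Solution: for bounded measurable nonrandom $u_0$ and Lipschitz $\sigma$, the solution of $\partial_t u=\frac{\theta}{2}\partial_x^2u+\sigma(u)\xi$ started at $u_0$ is the mild (Walsh) solution, i.e. the unique (up to modification) predictable random field $u$, with respect to the filtration generated by $\xi$, such that $\sup_{t\in[0,T]}\sup_{x\in\mathbb{R}}\mathrm{E}(|u_t(x)|^2)<\infty$ for all $T<\infty$ and, almost surely, for all $t>0$ and $x\in\mathbb{R}$, $$u_t(x)=(p_t*u_0)(x)+\int_{(0,t)\times\mathbb{R}}p_{t-s}(x-y)\,\sigma(u_s(y))\,\xi(\mathrm{d}s\,\mathrm{d}y),$$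 where the integral is a Walsh stochastic integral and $p_r(a)=(2\pi\theta r)^{-1/2}\exp(-a^2/(2\theta r))$ for $r>0$, $a\in\mathbb{R}$. The version of $u$ that is continuous on $(0,\infty)\times\mathbb{R}$ is used. The system is called finite if $\|u_t\|_{L^1(\mathbb{R})}<\infty$ a.s. for all $t\ge0$. *)

theory Defs
  imports "HOL-Probability.Probability"
begin

section \<open>Space-time white noise\<close>

definition L2_half :: "(real \<times> real \<Rightarrow> real) set" where
  "L2_half = {h. h \<in> borel_measurable borel \<and>
                 set_integrable lborel ({0..} \<times> UNIV) (\<lambda>z. (h z)\<^sup>2)}"

text \<open>Real Gaussian random variables; the degenerate (constant) ones are included.\<close>

definition gaussian_rv :: "'a measure \<Rightarrow> ('a \<Rightarrow> real) \<Rightarrow> bool" where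
  "gaussian_rv M X \<longleftrightarrow> X \<in> borel_measurable M \<and>
     ((\<exists>\<mu>. AE \<omega> in M. X \<omega> = \<mu>) \<or>
      (\<exists>\<mu> s. s > 0 \<and> distributed M lborel X (\<lambda>x. ennreal (normal_density \<mu> s x))))"

text \<open>The generalized field is indexed by all square-integrable test functions \<open>h\<close> on
  \<open>[0,\<infinity>) \<times> \<real>\<close>, with \<open>\<xi> h\<close> standing for the integral of \<open>h\<close> against \<open>\<xi>\<close>; the formal covariance
  \<open>\<delta>\<^sub>0(s - t) \<delta>\<^sub>0(x - y)\<close> becomes the inner product of the test functions. Values of \<open>h\<close> at
  negative times are irrelevant up to null sets. Linearity of \<open>\<xi>\<close>, up to null sets, follows from
  the covariance.\<close>

definition white_noise :: "'a measure \<Rightarrow> ((real \<times> real \<Rightarrow> real) \<Rightarrow> 'a \<Rightarrow> real) \<Rightarrow> bool" where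
  "white_noise M \<xi> \<longleftrightarrow>
     (\<forall>H c. finite H \<and> H \<subseteq> L2_half \<longrightarrow> gaussian_rv M (\<lambda>\<omega>. \<Sum>h\<in>H. c h * \<xi> h \<omega>)) \<and>
     (\<forall>h\<in>L2_half. (LINT \<omega>|M. \<xi> h \<omega>) = 0) \<and>
     (\<forall>h\<in>L2_half. \<forall>g\<in>L2_half.
        (LINT \<omega>|M. \<xi> h \<omega> * \<xi> g \<omega>) = (LINT z:{0..} \<times> UNIV|lborel. h z * g z))"

text \<open>The filtration generated by \<open>\<xi>\<close>, augmented by the null sets of \<open>M\<close>, so that modifications of
  adapted fields are adapted. Passing to the right-continuous version would not change the
  predictable \<open>\<sigma>\<close>-algebra on \<open>(0,\<infinity>)\<close>.\<close>

definition noise_filtration ::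
    "'a measure \<Rightarrow> ((real \<times> real \<Rightarrow> real) \<Rightarrow> 'a \<Rightarrow> real) \<Rightarrow> real \<Rightarrow> 'a measure" where
  "noise_filtration M \<xi> t = sigma (space M)
     ({\<xi> h -` B \<inter> space M | h B.
         h \<in> L2_half \<and> (\<forall>z. fst z \<notin> {0..t} \<longrightarrow> h z = 0) \<and> B \<in> sets borel} \<union> null_sets M)"

section \<open>Predictable fields and the Walsh integral\<close>

text \<open>Random fields on \<open>[0,\<infinity>) \<times> \<real>\<close> are functions \<open>real \<Rightarrow> real \<Rightarrow> 'a \<Rightarrow> real\<close> of time, space and
  outcome; values at negative times are never used.\<close>

definition predictable_sigma ::
    "'a measure \<Rightarrow> ((real \<times> real \<Rightarrow> real) \<Rightarrow> 'a \<Rightarrow> real) \<Rightarrow> (real \<times> real \<times> 'a) measure" where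
  "predictable_sigma M \<xi> = sigma ({0..} \<times> UNIV \<times> space M)
     ({{0} \<times> A \<times> F | A F. A \<in> sets borel \<and> F \<in> sets (noise_filtration M \<xi> 0)} \<union>
      {{a<..b} \<times> A \<times> F | a b A F.
         0 \<le> a \<and> a < b \<and> A \<in> sets borel \<and> F \<in> sets (noise_filtration M \<xi> a)})"

definition predictable_field ::
    "'a measure \<Rightarrow> ((real \<times> real \<Rightarrow> real) \<Rightarrow> 'a \<Rightarrow> real) \<Rightarrow> (real \<Rightarrow> real \<Rightarrow> 'a \<Rightarrow> real) \<Rightarrow> bool" where
  "predictable_field M \<xi> \<Phi> \<longleftrightarrow>
     (\<lambda>(t, x, \<omega>). \<Phi> t x \<omega>) \<in> borel_measurable (predictable_sigma M \<xi>)"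

text \<open>The tuple \<open>(a, b, A, X)\<close> encodes the elementary field \<open>X(\<omega>) 1\<^bsub>(a,b]\<^esub>(t) 1\<^bsub>A\<^esub>(x)\<close>; a list of such
  tuples encodes the simple field that is the sum of its entries.\<close>

type_synonym 'a elementary = "real \<times> real \<times> real set \<times> ('a \<Rightarrow> real)"

definition elementary :: "'a measure \<Rightarrow> ((real \<times> real \<Rightarrow> real) \<Rightarrow> 'a \<Rightarrow> real) \<Rightarrow> 'a elementary set" where
  "elementary M \<xi> = {(a, b, A, X). 0 \<le> a \<and> a < b \<and> A \<in> sets borel \<and> emeasure lborel A < \<infinity> \<and>
     X \<in> borel_measurable (noise_filtration M \<xi> a) \<and> bounded (X ` space M)}"

definition simple_field :: "'a elementary list \<Rightarrow> real \<Rightarrow> real \<Rightarrow> 'a \<Rightarrow> real" where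
  "simple_field S t x \<omega> =
     (\<Sum>(a, b, A, X)\<leftarrow>S. X \<omega> * indicator {a<..b} t * indicator A x)"

definition simple_integral ::
    "((real \<times> real \<Rightarrow> real) \<Rightarrow> 'a \<Rightarrow> real) \<Rightarrow> 'a elementary list \<Rightarrow> 'a \<Rightarrow> real" where
  "simple_integral \<xi> S \<omega> = (\<Sum>(a, b, A, X)\<leftarrow>S. X \<omega> * \<xi> (indicator ({a<..b} \<times> A)) \<omega>)"

definition walsh_norm2 :: "'a measure \<Rightarrow> (real \<Rightarrow> real \<Rightarrow> 'a \<Rightarrow> real) \<Rightarrow> ennreal" where
  "walsh_norm2 M \<Phi> =
     (\<integral>\<^sup>+\<omega>. (\<integral>\<^sup>+t\<in>{0..}. (\<integral>\<^sup>+x. ennreal ((\<Phi> t x \<omega>)\<^sup>2) \<partial>lborel) \<partial>lborel) \<partial>M)"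

text \<open>\<open>I\<close> is a version of the Walsh integral of \<open>\<Phi>\<close> over \<open>(0,\<infinity>) \<times> \<real>\<close>, i.e. the \<open>L\<^sup>2\<close>-limit of the
  integrals of simple fields that approximate \<open>\<Phi>\<close>. The integral is determined up to null sets
  only, hence a predicate.\<close>

definition is_walsh_integral ::
    "'a measure \<Rightarrow> ((real \<times> real \<Rightarrow> real) \<Rightarrow> 'a \<Rightarrow> real) \<Rightarrow> (real \<Rightarrow> real \<Rightarrow> 'a \<Rightarrow> real) \<Rightarrow>
     ('a \<Rightarrow> real) \<Rightarrow> bool" where
  "is_walsh_integral M \<xi> \<Phi> I \<longleftrightarrow>
     predictable_field M \<xi> \<Phi> \<and> walsh_norm2 M \<Phi> < \<infinity> \<and> I \<in> borel_measurable M \<and>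
     (\<exists>S :: nat \<Rightarrow> 'a elementary list.
        (\<forall>n. set (S n) \<subseteq> elementary M \<xi>) \<and>
        (\<lambda>n. walsh_norm2 M (\<lambda>t x \<omega>. \<Phi> t x \<omega> - simple_field (S n) t x \<omega>)) \<longlonglongrightarrow> 0 \<and>
        (\<lambda>n. \<integral>\<^sup>+\<omega>. ennreal ((I \<omega> - simple_integral \<xi> (S n) \<omega>)\<^sup>2) \<partial>M) \<longlonglongrightarrow> 0)"

section \<open>The stochastic heat equation\<close>

definition heat_kernel :: "real \<Rightarrow> real \<Rightarrow> real \<Rightarrow> real" where
  "heat_kernel \<theta> r a = (2 * pi * \<theta> * r) powr (-1/2) * exp (- (a\<^sup>2) / (2 * \<theta> * r))"

text \<open>In the mild equation, \<open>Z t x\<close> is a version of the stochastic integral over \<open>(0,t) \<times> \<real>\<close>; versions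
  are chosen for all \<open>(t, x)\<close> so that the equation holds simultaneously almost surely.\<close>

definition mild_solution ::
    "'a measure \<Rightarrow> ((real \<times> real \<Rightarrow> real) \<Rightarrow> 'a \<Rightarrow> real) \<Rightarrow> real \<Rightarrow> (real \<Rightarrow> real) \<Rightarrow> (real \<Rightarrow> real) \<Rightarrow>
     (real \<Rightarrow> real \<Rightarrow> 'a \<Rightarrow> real) \<Rightarrow> bool" where
  "mild_solution M \<xi> \<theta> \<sigma> u0 u \<longleftrightarrow>
     predictable_field M \<xi> u \<and>
     (\<forall>T. (SUP t\<in>{0..T}. SUP x. \<integral>\<^sup>+\<omega>. ennreal (\<bar>u t x \<omega>\<bar>\<^sup>2) \<partial>M) < \<infinity>) \<and>
     (AE \<omega> in M. \<forall>x. u 0 x \<omega> = u0 x) \<and>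
     (\<exists>Z. (\<forall>t>0. \<forall>x. is_walsh_integral M \<xi>
              (\<lambda>s y \<omega>. if 0 < s \<and> s < t then heat_kernel \<theta> (t - s) (x - y) * \<sigma> (u s y \<omega>) else 0)
              (Z t x)) \<and>
          (AE \<omega> in M. \<forall>t>0. \<forall>x.
              u t x \<omega> = (LINT y|lborel. heat_kernel \<theta> t (x - y) * u0 y) + Z t x \<omega>))"

definition continuous_version :: "'a measure \<Rightarrow> (real \<Rightarrow> real \<Rightarrow> 'a \<Rightarrow> real) \<Rightarrow> bool" where
  "continuous_version M u \<longleftrightarrow>
     (AE \<omega> in M. continuous_on ({0<..} \<times> UNIV) (\<lambda>(t, x). u t x \<omega>))"

definition L1_norm :: "(real \<Rightarrow> real) \<Rightarrow> ennreal" where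
  "L1_norm f = (\<integral>\<^sup>+x. ennreal \<bar>f x\<bar> \<partial>lborel)"

definition finite_system :: "'a measure \<Rightarrow> (real \<Rightarrow> real \<Rightarrow> 'a \<Rightarrow> real) \<Rightarrow> bool" where
  "finite_system M u \<longleftrightarrow> (\<forall>t\<ge>0. AE \<omega> in M. L1_norm (\<lambda>x. u t x \<omega>) < \<infinity>)"

end

theory Submission
  imports Defs
begin

text \<open>Evaluating finiteness at time \<open>0\<close> gives one direction. For the other, no comparison principle is
  needed: second moments suffice if they are weighted suitably. Let \<open>v\<close> be the convolution of
  \<open>u\<^sub>0\<close> with \<open>exp (- \<bar>x\<bar>)\<close>, plus \<open>exp (- \<bar>x\<bar>)\<close>. It is integrable and varies at most by the factor
  \<open>exp \<bar>x - y\<bar>\<close> between \<open>x\<close> and \<open>y\<close>, so the squared heat kernel acts boundedly on the weight \<open>1 / v\<close>,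
  with norm of order \<open>1 / sqrt t\<close>. By the Walsh isometry, the integral \<open>F t\<close> of \<open>E (u\<^sub>t x)\<^sup>2 / v x\<close> over
  \<open>x\<close> therefore satisfies an Abel-type Gronwall inequality and is finite, and
  \<open>\<bar>u\<bar> \<le> u\<^sup>2 / v + v\<close> shows that \<open>u\<^sub>t\<close> is almost surely integrable.\<close>

section \<open>Independence of the noise on disjoint time intervals\<close>

text \<open>Two obstacles shape the proof. The noise is known only through Gaussian linear
  combinations and their covariances, and the filtration is generated by uncountably many variables
  \<open>\<xi> h\<close>. The independence behind the isometry therefore has to be extracted from
  characteristic functions, integrated against weights of either sign that carry the information on
  past events. Secondly, a Gronwall argument only bounds what is already known to be finite, and a
  uniform bound on second moments says nothing about integrals against the unbounded weight 1 / v.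
  The weight is therefore cut off at n exp (- |x|), a function with the same comparison property;
  the resulting bound is uniform in n, and monotone convergence removes the cutoff. A smoothed
  initial function is used because \<open>u0\<close> itself may vanish or oscillate; the added exp
  (- |x|) keeps v positive. The same convolution appears as one factor when Cauchy-Schwarz is
  applied to the heat flow of \<open>u0\<close>. That estimate is only of order 1 / sqrt t, so the
  forcing term of the Gronwall inequality is singular at 0 as well, but integrable.\<close>

lemma (in prob_space) weighted_law_unique:
  fixes E1 E2 Y :: "'a \<Rightarrow> real"
  assumes int1: "integrable M E1" and int2: "integrable M E2"
    and nonneg: "\<And>\<omega>. 0 \<le> E1 \<omega>" "\<And>\<omega>. 0 \<le> E2 \<omega>"
    and Y [measurable]: "Y \<in> borel_measurable M"
    and cos_eq: "\<And>c. (LINT \<omega>|M. E1 \<omega> * cos (c * Y \<omega>)) = (LINT \<omega>|M. E2 \<omega> * cos (c * Y \<omega>))"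
    and sin_eq: "\<And>c. (LINT \<omega>|M. E1 \<omega> * sin (c * Y \<omega>)) = (LINT \<omega>|M. E2 \<omega> * sin (c * Y \<omega>))"
    and B [measurable]: "B \<in> sets borel"
  shows "(LINT \<omega>|M. E1 \<omega> * indicator B (Y \<omega>)) = (LINT \<omega>|M. E2 \<omega> * indicator B (Y \<omega>))"
proof -
  define m where "m = (LINT \<omega>|M. E1 \<omega>)"
  \<comment> \<open>At frequency \<open>0\<close> the cosine is \<open>1\<close>: both weights have
    the same total mass.\<close>
  have m2: "(LINT \<omega>|M. E2 \<omega>) = m"
    using cos_eq[of 0] by (simp add: m_def)
  have "m \<ge> 0" unfolding m_def by (simp add: nonneg)
  have [measurable]: "E1 \<in> borel_measurable M" "E2 \<in> borel_measurable M"
    using int1 int2 by auto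
  show ?thesis
  proof (cases "m = 0")
    case True
    have "AE \<omega> in M. E1 \<omega> = 0" "AE \<omega> in M. E2 \<omega> = 0"
      using integral_nonneg_eq_0_iff_AE[OF int1] integral_nonneg_eq_0_iff_AE[OF int2] True m2 m_def nonneg
      by auto
    then have "(LINT \<omega>|M. E1 \<omega> * indicator B (Y \<omega>)) = (LINT \<omega>|M. 0)"
      "(LINT \<omega>|M. E2 \<omega> * indicator B (Y \<omega>)) = (LINT \<omega>|M. 0)"
      by (intro integral_cong_AE; force)+
    then show ?thesis by simp
  next
    case False
    with \<open>m \<ge> 0\<close> have "m > 0" by simp
    \<comment> \<open>Divided by its mass, a weight is a probability density. The cosine and sine
      integrals are then the real and imaginary parts of the characteristic function of
      \<open>Y\<close> under this density, and Levy's uniqueness theorem compares the two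
      laws.\<close>
    define law where "law E = distr (density M (\<lambda>\<omega>. ennreal (E \<omega> / m))) borel Y" for E :: "'a \<Rightarrow> real"
    have law: "real_distribution (law E)"
      and law_char: "char (law E) t = (LINT \<omega>|M. E \<omega> * cos (t * Y \<omega>)) / m + \<i> * (LINT \<omega>|M. E \<omega> * sin (t * Y \<omega>)) / m"
      and law_ind: "(LINT x|law E. indicator B x) = (LINT \<omega>|M. E \<omega> * indicator B (Y \<omega>)) / m"
      if E: "integrable M E" "\<And>\<omega>. 0 \<le> E \<omega>" "(LINT \<omega>|M. E \<omega>) = m" for E t
    proof -
      have [measurable]: "E \<in> borel_measurable M" using E by auto
      have "emeasure (density M (\<lambda>\<omega>. ennreal (E \<omega> / m))) (space M) = (\<integral>\<^sup>+\<omega>. ennreal (E \<omega> / m) \<partial>M)"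
        by (subst emeasure_density) (auto intro!: nn_integral_cong)
      also have "\<dots> = ennreal (LINT \<omega>|M. E \<omega> / m)"
        using E \<open>m > 0\<close> by (intro nn_integral_eq_integral) auto
      also have "\<dots> = 1" using E \<open>m > 0\<close> by simp
      finally have "prob_space (density M (\<lambda>\<omega>. ennreal (E \<omega> / m)))"
        by (intro prob_spaceI) simp
      then show "real_distribution (law E)"
        unfolding law_def by (intro prob_space.real_distribution_distr) auto
      have ci: "integrable M (\<lambda>\<omega>. E \<omega> * cos (t * Y \<omega>))" "integrable M (\<lambda>\<omega>. E \<omega> * sin (t * Y \<omega>))"
        by (rule Bochner_Integration.integrable_bound[OF E(1)]; auto simp: abs_mult mult_left_le)+
      have "char (law E) t = (CLINT \<omega>|M. (E \<omega> / m) *\<^sub>R iexp (t * Y \<omega>))"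
        unfolding char_def law_def using \<open>m > 0\<close> E by (simp add: integral_distr integral_density)
      also have "\<dots> = (CLINT \<omega>|M. of_real (E \<omega> * cos (t * Y \<omega>)) / of_real m + \<i> * of_real (E \<omega> * sin (t * Y \<omega>)) / of_real m)"
        by (intro Bochner_Integration.integral_cong refl)
           (auto simp: complex_eq_iff Re_exp Im_exp)
      also have "\<dots> = (CLINT \<omega>|M. of_real (E \<omega> * cos (t * Y \<omega>)) / of_real m) + (CLINT \<omega>|M. \<i> * of_real (E \<omega> * sin (t * Y \<omega>)) / of_real m)"
        using ci by (intro Bochner_Integration.integral_add integrable_divide_zero integrable_mult_right impI)
          (simp_all only: complex_of_real_integrable_eq)
      also have "\<dots> = (LINT \<omega>|M. E \<omega> * cos (t * Y \<omega>)) / m + \<i> * (LINT \<omega>|M. E \<omega> * sin (t * Y \<omega>)) / m"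
        by (simp only: integral_divide_zero integral_mult_right_zero integral_complex_of_real times_divide_eq_right[symmetric] of_real_divide)
      finally show "char (law E) t = (LINT \<omega>|M. E \<omega> * cos (t * Y \<omega>)) / m + \<i> * (LINT \<omega>|M. E \<omega> * sin (t * Y \<omega>)) / m" .
      have "(LINT x|law E. indicator B x) = (LINT \<omega>|M. (E \<omega> / m) *\<^sub>R (indicator B (Y \<omega>) :: real))"
        unfolding law_def using \<open>m > 0\<close> E
        by (subst integral_distr) (auto simp: integral_density)
      then show "(LINT x|law E. indicator B x) = (LINT \<omega>|M. E \<omega> * indicator B (Y \<omega>)) / m"
        by simp
    qed
    have "char (law E1) = char (law E2)"
      using cos_eq sin_eq m2 by (auto simp: law_char[OF int1] law_char[OF int2] nonneg m_def)
    then have "law E1 = law E2"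
      using law[OF int1 nonneg(1)] law[OF int2 nonneg(2)] m2 m_def
      by (intro Levy_uniqueness) auto
    then show ?thesis
      using law_ind[OF int1 nonneg(1)] law_ind[OF int2 nonneg(2)] m2 m_def \<open>m > 0\<close> by simp
  qed
qed

text \<open>The positive and negative parts of \<open>D\<close> are two unnormalized densities, and
  the hypotheses say that \<open>Y\<close> has the same characteristic function under both. This is
  the device that replaces exponentials of a noise variable by indicators of its events.\<close>

lemma (in prob_space) integral_indicator_eq_0_if_trig:
  fixes D Y :: "'a \<Rightarrow> real"
  assumes D: "integrable M D"
    and Y [measurable]: "Y \<in> borel_measurable M"
    and cos_0: "\<And>c. (LINT \<omega>|M. D \<omega> * cos (c * Y \<omega>)) = 0"
    and sin_0: "\<And>c. (LINT \<omega>|M. D \<omega> * sin (c * Y \<omega>)) = 0"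
    and B [measurable]: "B \<in> sets borel"
  shows "(LINT \<omega>|M. D \<omega> * indicator B (Y \<omega>)) = 0"
proof -
  define Dp Dn where "Dp = (\<lambda>\<omega>. max 0 (D \<omega>))" and "Dn = (\<lambda>\<omega>. max 0 (- D \<omega>))"
  have eq: "D \<omega> = Dp \<omega> - Dn \<omega>" for \<omega> by (auto simp: Dp_def Dn_def)
  have int: "integrable M Dp" "integrable M Dn"
    unfolding Dp_def Dn_def using D by auto
  then have [measurable]: "Dp \<in> borel_measurable M" "Dn \<in> borel_measurable M" by auto
  have ib: "integrable M (\<lambda>\<omega>. E \<omega> * f (Y \<omega>))"
    if "integrable M E" "f \<in> borel_measurable borel" "\<And>y. \<bar>f y\<bar> \<le> 1" for E :: "'a \<Rightarrow> real" and f :: "real \<Rightarrow> real"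
  proof -
    have [measurable]: "f \<in> borel_measurable borel" "E \<in> borel_measurable M" using that by auto
    show ?thesis
      using that by (intro Bochner_Integration.integrable_bound[OF that(1)]) (auto simp: abs_mult mult_left_le)
  qed
  have sub: "(LINT \<omega>|M. D \<omega> * f (Y \<omega>)) = (LINT \<omega>|M. Dp \<omega> * f (Y \<omega>)) - (LINT \<omega>|M. Dn \<omega> * f (Y \<omega>))"
    if "f \<in> borel_measurable borel" "\<And>y. \<bar>f y\<bar> \<le> 1" for f :: "real \<Rightarrow> real"
    unfolding eq left_diff_distrib
    using that int by (intro Bochner_Integration.integral_diff ib) auto
  have "(LINT \<omega>|M. Dp \<omega> * indicator B (Y \<omega>)) = (LINT \<omega>|M. Dn \<omega> * indicator B (Y \<omega>))"
  proof (rule weighted_law_unique[OF int])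
    show "(LINT \<omega>|M. Dp \<omega> * cos (c * Y \<omega>)) = (LINT \<omega>|M. Dn \<omega> * cos (c * Y \<omega>))" for c
      using sub[of "\<lambda>y. cos (c * y)"] cos_0[of c] by simp
    show "(LINT \<omega>|M. Dp \<omega> * sin (c * Y \<omega>)) = (LINT \<omega>|M. Dn \<omega> * sin (c * Y \<omega>))" for c
      using sub[of "\<lambda>y. sin (c * y)"] sin_0[of c] by simp
  qed (auto simp: Dp_def Dn_def)
  then show ?thesis
    using sub[of "indicator B"] by (simp add: indicator_def)
qed

section \<open>Gaussian variables and the linear span of the noise\<close>

lemma (in prob_space) gaussian_rv_integrable:
  assumes "gaussian_rv M X"
  shows "integrable M X" "integrable M (\<lambda>\<omega>. (X \<omega>)\<^sup>2)"
proof -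
  have [measurable]: "X \<in> borel_measurable M" using assms by (simp add: gaussian_rv_def)
  consider \<mu> where "AE \<omega> in M. X \<omega> = \<mu>"
    | \<mu> s where "s > 0" "distributed M lborel X (\<lambda>x. ennreal (normal_density \<mu> s x))"
    using assms by (auto simp: gaussian_rv_def)
  then have "integrable M X \<and> integrable M (\<lambda>\<omega>. (X \<omega>)\<^sup>2)"
  proof cases
    case 1
    have "integrable M X \<longleftrightarrow> integrable M (\<lambda>_. \<mu>)"
      "integrable M (\<lambda>\<omega>. (X \<omega>)\<^sup>2) \<longleftrightarrow> integrable M (\<lambda>_. \<mu>\<^sup>2)"
      using 1 by (intro integrable_cong_AE; force)+
    then show ?thesis by simp
  next
    case 2
    have i1: "integrable M (\<lambda>\<omega>. X \<omega> - \<mu>)"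
      using integrable_normal_moment[of s \<mu> 1] 2
      by (subst distributed_integrable[OF 2(2), of "\<lambda>x. x - \<mu>", symmetric]) auto
    have i2: "integrable M (\<lambda>\<omega>. (X \<omega> - \<mu>)\<^sup>2)"
      using integrable_normal_moment[of s \<mu> 2] 2
      by (subst distributed_integrable[OF 2(2), of "\<lambda>x. (x - \<mu>)\<^sup>2", symmetric]) auto
    have "integrable M (\<lambda>\<omega>. (X \<omega> - \<mu>) + \<mu>)"
      by (intro Bochner_Integration.integrable_add i1) simp
    then have "integrable M X" by simp
    moreover have "integrable M (\<lambda>\<omega>. (X \<omega> - \<mu>)\<^sup>2 + 2 * \<mu> * (X \<omega> - \<mu>) + \<mu>\<^sup>2)"
      using i1 i2 by (intro Bochner_Integration.integrable_add integrable_mult_right_iff[THEN iffD2] impI disjI2) auto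
    then have "integrable M (\<lambda>\<omega>. (X \<omega>)\<^sup>2)" by (simp add: power2_eq_square algebra_simps)
    ultimately show ?thesis by simp
  qed
  then show "integrable M X" "integrable M (\<lambda>\<omega>. (X \<omega>)\<^sup>2)" by auto
qed

text \<open>The characteristic function at frequency 1; other frequencies are reached by scaling
  \<open>X\<close>. A degenerate variable of mean zero is almost surely 0, which the formula covers
  with variance 0.\<close>

lemma (in prob_space) gaussian_rv_characteristic:
  assumes "gaussian_rv M X" and "expectation X = 0"
  shows "expectation (\<lambda>\<omega>. cos (X \<omega>)) = exp (- expectation (\<lambda>\<omega>. (X \<omega>)\<^sup>2) / 2)"
    and "expectation (\<lambda>\<omega>. sin (X \<omega>)) = 0"
proof -
  have [measurable]: "X \<in> borel_measurable M" using assms by (simp add: gaussian_rv_def)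
  consider \<mu> where "AE \<omega> in M. X \<omega> = \<mu>"
    | \<mu> s where "s > 0" "distributed M lborel X (\<lambda>x. ennreal (normal_density \<mu> s x))"
    using assms by (auto simp: gaussian_rv_def)
  then have "expectation (\<lambda>\<omega>. cos (X \<omega>)) = exp (- expectation (\<lambda>\<omega>. (X \<omega>)\<^sup>2) / 2) \<and>
      expectation (\<lambda>\<omega>. sin (X \<omega>)) = 0"
  proof cases
    case 1
    have eq: "expectation (\<lambda>\<omega>. f (X \<omega>)) = f \<mu>" if "f \<in> borel_measurable borel" for f :: "real \<Rightarrow> real"
    proof -
      have [measurable]: "f \<in> borel_measurable borel" by fact
      have "expectation (\<lambda>\<omega>. f (X \<omega>)) = expectation (\<lambda>\<omega>. f \<mu>)"
        using 1 by (intro integral_cong_AE) auto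
      then show ?thesis by (simp add: prob_space)
    qed
    have "\<mu> = 0" using eq[of "\<lambda>x. x"] assms by simp
    then show ?thesis
      using eq[of cos] eq[of sin] eq[of "\<lambda>x. x\<^sup>2"] by simp
  next
    case 2
    have "\<mu> = 0" using normal_distributed_expectation[OF 2] assms by simp
    have var: "expectation (\<lambda>\<omega>. (X \<omega>)\<^sup>2) = s\<^sup>2"
      using normal_distributed_variance[OF 2] assms \<open>\<mu> = 0\<close> by simp
    define W where "W = (\<lambda>\<omega>. X \<omega> / s)"
    have W: "distributed M lborel W (\<lambda>x. ennreal (std_normal_density x))"
      using normal_standard_normal_convert[OF 2(1), of X \<mu>] 2(2) \<open>\<mu> = 0\<close> by (simp add: W_def)
    have XW: "X \<omega> = s * W \<omega>" for \<omega> using 2(1) by (simp add: W_def)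
    have "char std_normal_distribution s = (CLINT x|lborel. std_normal_density x *\<^sub>R iexp (s * x))"
      unfolding char_def by (subst integral_density) auto
    then have ch: "(CLINT x|lborel. std_normal_density x *\<^sub>R iexp (s * x)) = complex_of_real (exp (- s\<^sup>2 / 2))"
      by (simp add: char_std_normal_distribution)
    have int: "integrable lborel (\<lambda>x. std_normal_density x *\<^sub>R iexp (s * x))"
      by (rule Bochner_Integration.integrable_bound[OF integrable_normal_density[of 1 0]]) auto
    have "(LINT x|lborel. std_normal_density x * cos (s * x)) = exp (- s\<^sup>2 / 2)"
      "(LINT x|lborel. std_normal_density x * sin (s * x)) = 0"
      using arg_cong[OF ch, of Re] arg_cong[OF ch, of Im]
        integral_Re[OF int] integral_Im[OF int] by (simp_all add: Re_exp Im_exp)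
    then have "expectation (\<lambda>\<omega>. cos (s * W \<omega>)) = exp (- s\<^sup>2 / 2)"
      "expectation (\<lambda>\<omega>. sin (s * W \<omega>)) = 0"
      using distributed_integral[OF W, of "\<lambda>x. cos (s * x)"] distributed_integral[OF W, of "\<lambda>x. sin (s * x)"]
      by simp_all
    then show ?thesis by (simp add: XW[symmetric] var)
  qed
  then show "expectation (\<lambda>\<omega>. cos (X \<omega>)) = exp (- expectation (\<lambda>\<omega>. (X \<omega>)\<^sup>2) / 2)"
    and "expectation (\<lambda>\<omega>. sin (X \<omega>)) = 0" by auto
qed

lemma integrable_mult_if_squares:
  fixes f g :: "'a \<Rightarrow> real"
  assumes [measurable]: "f \<in> borel_measurable M" "g \<in> borel_measurable M"
    and "integrable M (\<lambda>x. (f x)\<^sup>2)" "integrable M (\<lambda>x. (g x)\<^sup>2)"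
  shows "integrable M (\<lambda>x. f x * g x)"
proof (rule Bochner_Integration.integrable_bound[of _ "\<lambda>x. (f x)\<^sup>2 + (g x)\<^sup>2"])
  show "AE x in M. norm (f x * g x) \<le> norm ((f x)\<^sup>2 + (g x)\<^sup>2)"
  proof (intro AE_I2)
    fix x
    have "2 * \<bar>f x\<bar> * \<bar>g x\<bar> \<le> (f x)\<^sup>2 + (g x)\<^sup>2"
      using sum_squares_bound[of "\<bar>f x\<bar>" "\<bar>g x\<bar>"] by simp
    moreover have "0 \<le> \<bar>f x\<bar> * \<bar>g x\<bar>" by simp
    ultimately have "\<bar>f x\<bar> * \<bar>g x\<bar> \<le> (f x)\<^sup>2 + (g x)\<^sup>2" by linarith
    then show "norm (f x * g x) \<le> norm ((f x)\<^sup>2 + (g x)\<^sup>2)" by (simp add: abs_mult)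
  qed
qed (use assms in auto)

text \<open>Since \<open>\<xi>\<close> is linear only up to null sets, a sum of noise variables need
  not be of the form \<open>\<xi> g\<close>. Working in the span keeps sums and multiples exact, and
  every element is Gaussian directly by \<open>white_noise\<close>.\<close>

definition noise_span ::
    "((real \<times> real \<Rightarrow> real) \<Rightarrow> 'a \<Rightarrow> real) \<Rightarrow> (real \<times> real \<Rightarrow> real) set \<Rightarrow> ('a \<Rightarrow> real) set" where
  "noise_span \<xi> V = {\<lambda>\<omega>. \<Sum>h\<in>H. c h * \<xi> h \<omega> | H c. finite H \<and> H \<subseteq> V}"

lemma noise_span_base: "h \<in> V \<Longrightarrow> \<xi> h \<in> noise_span \<xi> V"
  unfolding noise_span_def by (auto intro!: exI[of _ "{h}"] exI[of _ "\<lambda>_. 1"])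

lemma noise_span_scale:
  assumes "Y \<in> noise_span \<xi> V"
  shows "(\<lambda>\<omega>. a * Y \<omega>) \<in> noise_span \<xi> V"
proof -
  obtain H c where "finite H" "H \<subseteq> V" "Y = (\<lambda>\<omega>. \<Sum>h\<in>H. c h * \<xi> h \<omega>)"
    using assms by (auto simp: noise_span_def)
  then show ?thesis
    unfolding noise_span_def
    by (auto intro!: exI[of _ H] exI[of _ "\<lambda>h. a * c h"] simp: sum_distrib_left mult.assoc)
qed

lemma noise_span_add:
  assumes "Y \<in> noise_span \<xi> V" "Z \<in> noise_span \<xi> V"
  shows "(\<lambda>\<omega>. Y \<omega> + Z \<omega>) \<in> noise_span \<xi> V"
proof -
  obtain H c where Y: "finite H" "H \<subseteq> V" "Y = (\<lambda>\<omega>. \<Sum>h\<in>H. c h * \<xi> h \<omega>)"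
    using assms by (auto simp: noise_span_def)
  obtain K d where Z: "finite K" "K \<subseteq> V" "Z = (\<lambda>\<omega>. \<Sum>h\<in>K. d h * \<xi> h \<omega>)"
    using assms by (auto simp: noise_span_def)
  have "Y \<omega> + Z \<omega> = (\<Sum>h\<in>H \<union> K. ((if h \<in> H then c h else 0) + (if h \<in> K then d h else 0)) * \<xi> h \<omega>)" for \<omega>
  proof -
    have "Y \<omega> = (\<Sum>h\<in>H \<union> K. (if h \<in> H then c h else 0) * \<xi> h \<omega>)"
      unfolding Y(3) using Y Z by (intro sum.mono_neutral_cong_left) auto
    moreover have "Z \<omega> = (\<Sum>h\<in>H \<union> K. (if h \<in> K then d h else 0) * \<xi> h \<omega>)"
      unfolding Z(3) using Y Z by (intro sum.mono_neutral_cong_left) auto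
    ultimately show ?thesis by (simp add: sum.distrib[symmetric] algebra_simps)
  qed
  then show ?thesis
    unfolding noise_span_def using Y Z
    by (intro CollectI exI[of _ "H \<union> K"]) auto
qed

lemma noise_span_mono: "V \<subseteq> W \<Longrightarrow> noise_span \<xi> V \<subseteq> noise_span \<xi> W"
  unfolding noise_span_def by blast

abbreviation half_inner :: "(real \<times> real \<Rightarrow> real) \<Rightarrow> (real \<times> real \<Rightarrow> real) \<Rightarrow> real" where
  "half_inner h g \<equiv> (LINT z:{0..} \<times> UNIV|lborel. h z * g z)"

locale noise = prob_space M for M :: "'a measure" +
  fixes \<xi> :: "(real \<times> real \<Rightarrow> real) \<Rightarrow> 'a \<Rightarrow> real"
  assumes white: "white_noise M \<xi>"
begin

lemma noise_span_gaussian: "Y \<in> noise_span \<xi> L2_half \<Longrightarrow> gaussian_rv M Y"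
  using white unfolding white_noise_def noise_span_def by auto

lemma noise_span_measurable: "Y \<in> noise_span \<xi> L2_half \<Longrightarrow> Y \<in> borel_measurable M"
  using noise_span_gaussian by (auto simp: gaussian_rv_def)

lemma noise_gaussian: "h \<in> L2_half \<Longrightarrow> gaussian_rv M (\<xi> h)"
  by (intro noise_span_gaussian noise_span_base)

lemma noise_measurable: "h \<in> L2_half \<Longrightarrow> \<xi> h \<in> borel_measurable M"
  by (intro noise_span_measurable noise_span_base)

lemma noise_span_mult_integrable:
  assumes "Y \<in> noise_span \<xi> L2_half" "Z \<in> noise_span \<xi> L2_half"
  shows "integrable M (\<lambda>\<omega>. Y \<omega> * Z \<omega>)"
  using assms by (intro integrable_mult_if_squares noise_span_measurable gaussian_rv_integrable noise_span_gaussian)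

lemma noise_span_expectation:
  assumes "Y \<in> noise_span \<xi> L2_half"
  shows "expectation Y = 0"
proof -
  obtain H c where Y: "finite H" "H \<subseteq> L2_half" "Y = (\<lambda>\<omega>. \<Sum>h\<in>H. c h * \<xi> h \<omega>)"
    using assms by (auto simp: noise_span_def)
  have "expectation Y = (\<Sum>h\<in>H. c h * expectation (\<xi> h))"
    unfolding Y(3) using Y gaussian_rv_integrable(1)[OF noise_gaussian]
    by (subst Bochner_Integration.integral_sum) auto
  also have "\<dots> = 0"
    using Y white by (intro sum.neutral) (auto simp: white_noise_def)
  finally show ?thesis .
qed

lemma noise_covariance:
  "h \<in> L2_half \<Longrightarrow> g \<in> L2_half \<Longrightarrow> expectation (\<lambda>\<omega>. \<xi> h \<omega> * \<xi> g \<omega>) = half_inner h g"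
  using white by (auto simp: white_noise_def)

lemma noise_span_orthogonal:
  assumes V: "V \<subseteq> L2_half" and W: "W \<subseteq> L2_half"
    and orth: "\<And>h g. h \<in> V \<Longrightarrow> g \<in> W \<Longrightarrow> half_inner h g = 0"
    and Y: "Y \<in> noise_span \<xi> V" and Z: "Z \<in> noise_span \<xi> W"
  shows "expectation (\<lambda>\<omega>. Y \<omega> * Z \<omega>) = 0"
proof -
  obtain H c where Y: "finite H" "H \<subseteq> V" "Y = (\<lambda>\<omega>. \<Sum>h\<in>H. c h * \<xi> h \<omega>)"
    using Y by (auto simp: noise_span_def)
  obtain K d where Z: "finite K" "K \<subseteq> W" "Z = (\<lambda>\<omega>. \<Sum>h\<in>K. d h * \<xi> h \<omega>)"
    using Z by (auto simp: noise_span_def)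
  have int: "integrable M (\<lambda>\<omega>. \<xi> h \<omega> * \<xi> g \<omega>)" if "h \<in> H" "g \<in> K" for h g
    using that Y Z V W by (intro noise_span_mult_integrable noise_span_base) auto
  have "expectation (\<lambda>\<omega>. Y \<omega> * Z \<omega>) = expectation (\<lambda>\<omega>. \<Sum>h\<in>H. \<Sum>g\<in>K. (c h * d g) * (\<xi> h \<omega> * \<xi> g \<omega>))"
    by (simp add: Y(3) Z(3) sum_product mult_ac)
  also have "\<dots> = (\<Sum>h\<in>H. \<Sum>g\<in>K. (c h * d g) * expectation (\<lambda>\<omega>. \<xi> h \<omega> * \<xi> g \<omega>))"
    using int by (simp add: Bochner_Integration.integral_sum)
  also have "\<dots> = 0"
    using Y(2) Z(2) V W orth by (intro sum.neutral ballI) (auto simp: noise_covariance subset_eq)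
  finally show ?thesis .
qed

end

text \<open>For the empty list the intersection is \<open>UNIV\<close>; cutting with
  \<open>space M\<close> turns it into an event.\<close>

lemma Inter_list_sets:
  "set As \<subseteq> sets M \<Longrightarrow> \<Inter>(set As) \<inter> space M \<in> sets M"
proof (induction As)
  case (Cons A As)
  have "\<Inter>(set (A # As)) \<inter> space M = A \<inter> (\<Inter>(set As) \<inter> space M)" by auto
  then show ?case using Cons by auto
qed simp

section \<open>Test functions supported before and after a fixed time\<close>

definition early :: "real \<Rightarrow> (real \<times> real \<Rightarrow> real) set" where
  "early t = {h \<in> L2_half. \<forall>z. fst z \<notin> {0..t} \<longrightarrow> h z = 0}"

text \<open>The functions vanish at time \<open>t\<close> itself too, in accordance with the
  half-open intervals of elementary fields: an increment over (a, b] is late for every t \<le> a and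
  early for every t \<ge> b.\<close>

definition late :: "real \<Rightarrow> (real \<times> real \<Rightarrow> real) set" where
  "late t = {h \<in> L2_half. \<forall>z. fst z \<le> t \<longrightarrow> h z = 0}"

lemma early_subset: "early t \<subseteq> L2_half" and late_subset: "late t \<subseteq> L2_half"
  by (auto simp: early_def late_def)

lemma half_inner_early_late: "h \<in> early t \<Longrightarrow> g \<in> late t \<Longrightarrow> half_inner h g = 0"
proof -
  assume "h \<in> early t" "g \<in> late t"
  then have *: "h z * g z = 0" for z
    by (cases z; cases "fst z \<le> t") (auto simp: early_def late_def)
  show ?thesis unfolding set_lebesgue_integral_def * by simp
qed

section \<open>The filtration and its independence of late noise\<close>

context noise
begin

definition filtration_generator :: "real \<Rightarrow> 'a set set" where
  "filtration_generator t = {\<xi> h -` B \<inter> space M | h B. h \<in> early t \<and> B \<in> sets borel} \<union> null_sets M"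

lemma filtration_generator_sets: "filtration_generator t \<subseteq> sets M"
  using early_subset noise_measurable
  by (auto simp: filtration_generator_def subset_eq intro!: measurable_sets)

lemma sets_noise_filtration:
  "sets (noise_filtration M \<xi> t) = sigma_sets (space M) (filtration_generator t)"
proof -
  have "filtration_generator t \<subseteq> Pow (space M)"
    using filtration_generator_sets sets.sets_into_space by blast
  then show ?thesis
    by (simp add: noise_filtration_def filtration_generator_def early_def conj_assoc)
qed

lemma space_noise_filtration [simp]: "space (noise_filtration M \<xi> t) = space M"
  by (simp add: noise_filtration_def space_measure_of_conv)

lemma sets_noise_filtration_subset: "sets (noise_filtration M \<xi> t) \<subseteq> sets M"
  unfolding sets_noise_filtration
  by (intro sets.sigma_sets_subset filtration_generator_sets)

lemma measurable_noise_filtration: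
  "X \<in> borel_measurable (noise_filtration M \<xi> t) \<Longrightarrow> X \<in> borel_measurable M"
  using sets_noise_filtration_subset[of t] by (auto simp: measurable_def)

text \<open>The exponentials of early noise determine \<open>\<F>\<^sub>t\<close>: one factor after the other, an exponential
  of \<open>\<xi> h\<close> is replaced by the indicator of an event \<open>{\<xi> h \<in> B}\<close>.\<close>

lemma trig_orthogonal_prod:
  assumes D [measurable]: "D \<in> borel_measurable M" and bd: "\<And>\<omega>. \<bar>D \<omega>\<bar> \<le> K"
    and cos_0: "\<And>Y. Y \<in> noise_span \<xi> (early t) \<Longrightarrow> expectation (\<lambda>\<omega>. D \<omega> * cos (Y \<omega>)) = 0"
    and sin_0: "\<And>Y. Y \<in> noise_span \<xi> (early t) \<Longrightarrow> expectation (\<lambda>\<omega>. D \<omega> * sin (Y \<omega>)) = 0"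
    and "set As \<subseteq> filtration_generator t"
  shows "Y \<in> noise_span \<xi> (early t) \<Longrightarrow>
      expectation (\<lambda>\<omega>. D \<omega> * indicator (\<Inter>(set As)) \<omega> * cos (Y \<omega>)) = 0 \<and>
      expectation (\<lambda>\<omega>. D \<omega> * indicator (\<Inter>(set As)) \<omega> * sin (Y \<omega>)) = 0"
  using assms(5)
proof (induction As arbitrary: Y)
  case Nil
  then show ?case using cos_0 sin_0 by simp
next
  case (Cons A As)
  have Ym: "Z \<in> borel_measurable M" if "Z \<in> noise_span \<xi> (early t)" for Z
    using that noise_span_mono[OF early_subset] noise_span_measurable by blast
  note [measurable] = Ym[OF Cons.prems(1)]
  have [measurable]: "A' \<in> sets M" if "A' \<in> set (A # As)" for A'
    using that Cons.prems(2) filtration_generator_sets by blast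
  \<comment> \<open>\<open>R\<close> absorbs \<open>D\<close> and the events already treated, so
    that the induction hypothesis states for \<open>R\<close> what was assumed of
    \<open>D\<close>.\<close>
  define R where "R = (\<lambda>\<omega>. D \<omega> * indicator (\<Inter>(set As) \<inter> space M) \<omega>)"
  have Rm [measurable]: "R \<in> borel_measurable M"
  proof -
    have "\<Inter>(set As) \<inter> space M \<in> sets M"
      using Cons.prems(2) filtration_generator_sets by (intro Inter_list_sets) auto
    then show ?thesis unfolding R_def by measurable
  qed
  have Rbd: "\<bar>R \<omega>\<bar> \<le> K" for \<omega>
    using bd[of \<omega>] by (auto simp: R_def indicator_def)
  have int: "integrable M (\<lambda>\<omega>. R \<omega> * f \<omega>)"
    if "f \<in> borel_measurable M" "\<And>\<omega>. \<bar>f \<omega>\<bar> \<le> 1" for f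
  proof (rule integrable_const_bound[of _ K])
    show "AE \<omega> in M. norm (R \<omega> * f \<omega>) \<le> K"
      using mult_mono[OF Rbd that(2)] by (auto simp: abs_mult order_trans[OF _ Rbd])
  qed (use that in measurable)
  have IH: "expectation (\<lambda>\<omega>. R \<omega> * cos (Z \<omega>)) = 0" "expectation (\<lambda>\<omega>. R \<omega> * sin (Z \<omega>)) = 0"
    if "Z \<in> noise_span \<xi> (early t)" for Z
  proof -
    have *: "expectation (\<lambda>\<omega>. R \<omega> * f (Z \<omega>)) = expectation (\<lambda>\<omega>. D \<omega> * indicator (\<Inter>(set As)) \<omega> * f (Z \<omega>))" for f :: "real \<Rightarrow> real"
      by (intro Bochner_Integration.integral_cong) (auto simp: R_def indicator_def)
    show "expectation (\<lambda>\<omega>. R \<omega> * cos (Z \<omega>)) = 0" "expectation (\<lambda>\<omega>. R \<omega> * sin (Z \<omega>)) = 0"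
      using Cons.IH[OF that] Cons.prems unfolding * by auto
  qed
  have split: "expectation (\<lambda>\<omega>. D \<omega> * indicator (\<Inter>(set (A # As))) \<omega> * f \<omega>)
      = expectation (\<lambda>\<omega>. R \<omega> * f \<omega> * indicator A \<omega>)" for f :: "'a \<Rightarrow> real"
    by (intro Bochner_Integration.integral_cong) (auto simp: R_def indicator_def)
  have "A \<in> filtration_generator t" using Cons.prems by simp
  then consider h B where "h \<in> early t" "B \<in> sets borel" "A = \<xi> h -` B \<inter> space M" | "A \<in> null_sets M"
    by (auto simp: filtration_generator_def)
  then show ?case
  proof cases
    case (1 h B)
    have h: "\<xi> h \<in> noise_span \<xi> (early t)" using 1 by (intro noise_span_base)
    note [measurable] = Ym[OF h]
    have ind: "expectation (\<lambda>\<omega>. R \<omega> * f \<omega> * indicator A \<omega>) = expectation (\<lambda>\<omega>. R \<omega> * f \<omega> * indicator B (\<xi> h \<omega>))" for f :: "'a \<Rightarrow> real"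
      by (intro Bochner_Integration.integral_cong) (auto simp: 1 indicator_def)
    have sp: "(\<lambda>\<omega>. Y \<omega> + c * \<xi> h \<omega>) \<in> noise_span \<xi> (early t)" for c
      by (intro noise_span_add noise_span_scale h Cons.prems)
    \<comment> \<open>The induction hypothesis is used at Y + c \<xi> h and Y - c \<xi> h; the
      addition theorems separate the four products. With R cos Y and R sin Y as signed weights, the
      exponentials of \<xi> h can then be exchanged for the indicator of \<open>B\<close>.\<close>
    have trig:
      "expectation (\<lambda>\<omega>. R \<omega> * cos (Y \<omega>) * cos (c * \<xi> h \<omega>)) = 0"
      "expectation (\<lambda>\<omega>. R \<omega> * cos (Y \<omega>) * sin (c * \<xi> h \<omega>)) = 0"
      "expectation (\<lambda>\<omega>. R \<omega> * sin (Y \<omega>) * cos (c * \<xi> h \<omega>)) = 0"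
      "expectation (\<lambda>\<omega>. R \<omega> * sin (Y \<omega>) * sin (c * \<xi> h \<omega>)) = 0" for c
    proof -
      have p: "expectation (\<lambda>\<omega>. R \<omega> * cos (Y \<omega> + c * \<xi> h \<omega>)) = 0"
        "expectation (\<lambda>\<omega>. R \<omega> * sin (Y \<omega> + c * \<xi> h \<omega>)) = 0"
        "expectation (\<lambda>\<omega>. R \<omega> * cos (Y \<omega> + (-c) * \<xi> h \<omega>)) = 0"
        "expectation (\<lambda>\<omega>. R \<omega> * sin (Y \<omega> + (-c) * \<xi> h \<omega>)) = 0"
        using IH[OF sp] by blast+
      note i = int[of "\<lambda>\<omega>. cos (Y \<omega>) * cos (c * \<xi> h \<omega>)"] int[of "\<lambda>\<omega>. cos (Y \<omega>) * sin (c * \<xi> h \<omega>)"]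
        int[of "\<lambda>\<omega>. sin (Y \<omega>) * cos (c * \<xi> h \<omega>)"] int[of "\<lambda>\<omega>. sin (Y \<omega>) * sin (c * \<xi> h \<omega>)"]
      have "\<bar>cos x * cos y\<bar> \<le> 1" "\<bar>cos x * sin y\<bar> \<le> 1" "\<bar>sin x * cos y\<bar> \<le> 1" "\<bar>sin x * sin y\<bar> \<le> 1" for x y :: real
        by (auto simp: abs_mult intro!: mult_le_one)
      with i p show
        "expectation (\<lambda>\<omega>. R \<omega> * cos (Y \<omega>) * cos (c * \<xi> h \<omega>)) = 0"
        "expectation (\<lambda>\<omega>. R \<omega> * cos (Y \<omega>) * sin (c * \<xi> h \<omega>)) = 0"
        "expectation (\<lambda>\<omega>. R \<omega> * sin (Y \<omega>) * cos (c * \<xi> h \<omega>)) = 0"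
        "expectation (\<lambda>\<omega>. R \<omega> * sin (Y \<omega>) * sin (c * \<xi> h \<omega>)) = 0"
        by (simp_all add: cos_add sin_add cos_diff sin_diff distrib_left right_diff_distrib mult.assoc)
    qed
    have "integrable M (\<lambda>\<omega>. R \<omega> * cos (Y \<omega>))" "integrable M (\<lambda>\<omega>. R \<omega> * sin (Y \<omega>))"
      by (intro int; simp)+
    then show ?thesis
      unfolding split ind using trig 1
      by (intro conjI integral_indicator_eq_0_if_trig) auto
  next
    case 2
    then have "AE \<omega> in M. \<omega> \<notin> A" by (rule AE_not_in)
    then have "expectation (\<lambda>\<omega>. R \<omega> * f \<omega> * indicator A \<omega>) = expectation (\<lambda>\<omega>. 0)"
      if [measurable]: "f \<in> borel_measurable M" for f :: "'a \<Rightarrow> real"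
      using 2 by (intro integral_cong_AE) (auto intro: null_setsD2)
    then show ?thesis unfolding split by auto
  qed
qed

text \<open>Finite intersections of generating events form an intersection-stable system, on which
  the claim is the product identity at \<open>Y = 0\<close>. Dynkin's argument carries it to the
  whole sigma-algebra.\<close>

lemma trig_orthogonal_filtration:
  assumes D [measurable]: "D \<in> borel_measurable M" and bd: "\<And>\<omega>. \<bar>D \<omega>\<bar> \<le> K"
    and cos_0: "\<And>Y. Y \<in> noise_span \<xi> (early t) \<Longrightarrow> expectation (\<lambda>\<omega>. D \<omega> * cos (Y \<omega>)) = 0"
    and sin_0: "\<And>Y. Y \<in> noise_span \<xi> (early t) \<Longrightarrow> expectation (\<lambda>\<omega>. D \<omega> * sin (Y \<omega>)) = 0"
    and F: "F \<in> sets (noise_filtration M \<xi> t)"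
  shows "(LINT \<omega>:F|M. D \<omega>) = 0"
proof -
  define P where "P = {\<Inter>(set As) \<inter> space M | As. set As \<subseteq> filtration_generator t}"
  have "P \<subseteq> Pow (space M)" by (auto simp: P_def)
  have base: "(LINT \<omega>:A|M. D \<omega>) = 0" if AP: "A \<in> P" for A
  proof -
    obtain As where As: "set As \<subseteq> filtration_generator t" "A = \<Inter>(set As) \<inter> space M"
      using AP unfolding P_def by blast
    have "(\<lambda>\<omega>. 0) \<in> noise_span \<xi> (early t)"
      unfolding noise_span_def by (auto intro!: exI[of _ "{}"])
    then have "expectation (\<lambda>\<omega>. D \<omega> * indicator (\<Inter>(set As)) \<omega>) = 0"
      using trig_orthogonal_prod[OF D bd cos_0 sin_0 As(1), of "\<lambda>\<omega>. 0"] by simp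
    also have "expectation (\<lambda>\<omega>. D \<omega> * indicator (\<Inter>(set As)) \<omega>) = (LINT \<omega>:A|M. D \<omega>)"
      unfolding set_lebesgue_integral_def
      by (intro Bochner_Integration.integral_cong) (auto simp: As indicator_def)
    finally show ?thesis .
  qed
  have "Int_stable P"
  proof (rule Int_stableI)
    fix a b assume "a \<in> P" "b \<in> P"
    then obtain As Bs where "set As \<subseteq> filtration_generator t" "a = \<Inter>(set As) \<inter> space M"
      "set Bs \<subseteq> filtration_generator t" "b = \<Inter>(set Bs) \<inter> space M"
      by (auto simp: P_def)
    then show "a \<inter> b \<in> P"
      unfolding P_def by (auto intro!: exI[of _ "As @ Bs"])
  qed
  have gen: "filtration_generator t \<subseteq> P"
  proof
    fix A assume A: "A \<in> filtration_generator t"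
    then have "A \<subseteq> space M" using filtration_generator_sets sets.sets_into_space by blast
    with A show "A \<in> P" unfolding P_def by (auto intro!: exI[of _ "[A]"])
  qed
  have PM: "A \<in> sets M" if "A \<in> sigma_sets (space M) P" for A
  proof -
    have "P \<subseteq> sets M"
      unfolding P_def using filtration_generator_sets Inter_list_sets by blast
    then show ?thesis using that sets.sigma_sets_subset by blast
  qed
  have Dint: "integrable M D"
    by (rule integrable_const_bound[of _ K]) (use bd in auto)
  have Dset: "set_integrable M A D" if "A \<in> sets M" for A
    unfolding set_integrable_def using that Dint
    by (intro integrable_mult_indicator)
  have "F \<in> sigma_sets (space M) P"
    using F sigma_sets_mono'[OF gen] unfolding sets_noise_filtration by blast
  from \<open>Int_stable P\<close> \<open>P \<subseteq> Pow (space M)\<close> this show ?thesis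
  proof (induction rule: sigma_sets_induct_disjoint)
    case (basic A)
    then show ?case by (rule base)
  next
    case empty
    then show ?case by (simp add: set_lebesgue_integral_def)
  next
    case (compl A)
    \<comment> \<open>The whole space is the empty intersection, so \<open>D\<close> has integral 0;
      complements follow by subtraction.\<close>
    have "space M \<in> P" unfolding P_def by (auto intro!: exI[of _ "[]"])
    note sp = base[OF this]
    have [measurable]: "A \<in> sets M" using compl PM by blast
    have "(LINT \<omega>:space M|M. D \<omega>) = (LINT \<omega>:A \<union> (space M - A)|M. D \<omega>)"
      using sets.sets_into_space[of A M] by (auto intro!: set_lebesgue_integral_cong simp: Un_absorb1)
    also have "\<dots> = (LINT \<omega>:A|M. D \<omega>) + (LINT \<omega>:space M - A|M. D \<omega>)"
      by (intro set_integral_Un Dset) auto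
    finally show ?case using compl sp by simp
  next
    case (union A)
    have A_sets: "A i \<in> sets M" for i using union.hyps PM by blast
    have "(LINT \<omega>:(\<Union>i. A i)|M. D \<omega>) = (\<Sum>i. (LINT \<omega>:A i|M. D \<omega>))"
      using union.hyps A_sets by (intro lebesgue_integral_countable_add Dset) (auto simp: disjoint_family_on_def)
    then show ?case using union by simp
  qed
qed

text \<open>An early \<open>Y\<close> and a late \<open>G\<close> are uncorrelated, so Y + G and Y -
  G are centered Gaussians with the same variance, and the expectation of cos (Y + G) and of cos (Y
  - G) is the product of those of cos Y and cos G. Hence cos G minus its mean and sin G are
  orthogonal to all exponentials of early noise, and thus to every event of the filtration.\<close>

lemma late_noise_trig_orthogonal:
  assumes G: "G \<in> noise_span \<xi> (late t)"
    and F: "F \<in> sets (noise_filtration M \<xi> t)"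
  shows "expectation (\<lambda>\<omega>. (indicator F \<omega> - prob F) * cos (G \<omega>)) = 0"
    and "expectation (\<lambda>\<omega>. (indicator F \<omega> - prob F) * sin (G \<omega>)) = 0"
proof -
  have G': "G \<in> noise_span \<xi> L2_half" using G noise_span_mono[OF late_subset] by blast
  note [measurable] = noise_span_measurable[OF G']
  have [measurable]: "F \<in> sets M" using F sets_noise_filtration_subset by blast
  have char: "expectation (\<lambda>\<omega>. cos (Z \<omega>)) = exp (- expectation (\<lambda>\<omega>. (Z \<omega>)\<^sup>2) / 2)"
    "expectation (\<lambda>\<omega>. sin (Z \<omega>)) = 0" if "Z \<in> noise_span \<xi> L2_half" for Z
    using gaussian_rv_characteristic[OF noise_span_gaussian[OF that] noise_span_expectation[OF that]] by auto
  define e where "e = expectation (\<lambda>\<omega>. cos (G \<omega>))"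
  have trig_int: "integrable M (\<lambda>\<omega>. cos (Z \<omega>))" "integrable M (\<lambda>\<omega>. sin (Z \<omega>))"
    if "Z \<in> noise_span \<xi> L2_half" for Z
    using noise_span_measurable[OF that] by (auto intro!: integrable_const_bound[of _ 1])
  have *: "expectation (\<lambda>\<omega>. (cos (G \<omega>) - e) * cos (Y \<omega>)) = 0 \<and> expectation (\<lambda>\<omega>. (cos (G \<omega>) - e) * sin (Y \<omega>)) = 0 \<and>
      expectation (\<lambda>\<omega>. sin (G \<omega>) * cos (Y \<omega>)) = 0 \<and> expectation (\<lambda>\<omega>. sin (G \<omega>) * sin (Y \<omega>)) = 0"
    if Y: "Y \<in> noise_span \<xi> (early t)" for Y
  proof -
    have Y': "Y \<in> noise_span \<xi> L2_half" using Y noise_span_mono[OF early_subset] by blast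
    note [measurable] = noise_span_measurable[OF Y']
    have orth: "expectation (\<lambda>\<omega>. Y \<omega> * G \<omega>) = 0"
      using noise_span_orthogonal[OF early_subset late_subset half_inner_early_late Y G] .
    have sq: "integrable M (\<lambda>\<omega>. (Y \<omega>)\<^sup>2)" "integrable M (\<lambda>\<omega>. (G \<omega>)\<^sup>2)" "integrable M (\<lambda>\<omega>. Y \<omega> * G \<omega>)"
      using noise_span_mult_integrable[OF Y' Y'] noise_span_mult_integrable[OF G' G'] noise_span_mult_integrable[OF Y' G']
      by (simp_all add: power2_eq_square)
    \<comment> \<open>\<open>c\<close> stands for the two signs 1 and -1.\<close>
    have var: "expectation (\<lambda>\<omega>. (Y \<omega> + c * G \<omega>)\<^sup>2) = expectation (\<lambda>\<omega>. (Y \<omega>)\<^sup>2) + expectation (\<lambda>\<omega>. (G \<omega>)\<^sup>2)"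
      if "c\<^sup>2 = 1" for c
    proof -
      have "(Y \<omega> + c * G \<omega>)\<^sup>2 = (Y \<omega>)\<^sup>2 + c\<^sup>2 * (G \<omega>)\<^sup>2 + 2 * c * (Y \<omega> * G \<omega>)" for \<omega>
        by (simp add: power2_eq_square algebra_simps)
      then show ?thesis using sq orth that by simp
    qed
    have sp: "(\<lambda>\<omega>. Y \<omega> + c * G \<omega>) \<in> noise_span \<xi> L2_half" for c
      by (intro noise_span_add noise_span_scale Y' G')
    have cp: "expectation (\<lambda>\<omega>. cos (Y \<omega> + c * G \<omega>)) = exp (- (expectation (\<lambda>\<omega>. (Y \<omega>)\<^sup>2) + expectation (\<lambda>\<omega>. (G \<omega>)\<^sup>2)) / 2)"
      if "c\<^sup>2 = 1" for c
      using char(1)[OF sp[of c]] by (simp only: var[OF that])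
    have pm: "expectation (\<lambda>\<omega>. cos (Y \<omega> + G \<omega>)) = exp (- (expectation (\<lambda>\<omega>. (Y \<omega>)\<^sup>2) + expectation (\<lambda>\<omega>. (G \<omega>)\<^sup>2)) / 2)"
      "expectation (\<lambda>\<omega>. cos (Y \<omega> - G \<omega>)) = exp (- (expectation (\<lambda>\<omega>. (Y \<omega>)\<^sup>2) + expectation (\<lambda>\<omega>. (G \<omega>)\<^sup>2)) / 2)"
      "expectation (\<lambda>\<omega>. sin (Y \<omega> + G \<omega>)) = 0" "expectation (\<lambda>\<omega>. sin (Y \<omega> - G \<omega>)) = 0"
      using cp[of 1] cp[of "-1"] char(2)[OF sp[of 1]] char(2)[OF sp[of "-1"]] by simp_all
    have prod: "exp (- (expectation (\<lambda>\<omega>. (Y \<omega>)\<^sup>2) + expectation (\<lambda>\<omega>. (G \<omega>)\<^sup>2)) / 2) = e * expectation (\<lambda>\<omega>. cos (Y \<omega>))"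
    proof -
      have "exp (- (a + b) / 2) = exp (- b / 2) * exp (- a / 2)" for a b :: real
        by (simp add: exp_add[symmetric] add_divide_distrib)
      then show ?thesis unfolding e_def char(1)[OF Y'] char(1)[OF G'] .
    qed
    have int: "integrable M (\<lambda>\<omega>. cos (Y \<omega> + G \<omega>))" "integrable M (\<lambda>\<omega>. sin (Y \<omega> + G \<omega>))"
      "integrable M (\<lambda>\<omega>. cos (Y \<omega> - G \<omega>))" "integrable M (\<lambda>\<omega>. sin (Y \<omega> - G \<omega>))"
      using trig_int[OF sp[of 1]] trig_int[OF sp[of "-1"]] by simp_all
    have trig_id: "cos (G \<omega>) * cos (Y \<omega>) = (cos (Y \<omega> + G \<omega>) + cos (Y \<omega> - G \<omega>)) / 2"
      "cos (G \<omega>) * sin (Y \<omega>) = (sin (Y \<omega> + G \<omega>) + sin (Y \<omega> - G \<omega>)) / 2"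
      "sin (G \<omega>) * cos (Y \<omega>) = (sin (Y \<omega> + G \<omega>) - sin (Y \<omega> - G \<omega>)) / 2"
      "sin (G \<omega>) * sin (Y \<omega>) = (cos (Y \<omega> - G \<omega>) - cos (Y \<omega> + G \<omega>)) / 2" for \<omega>
      by (simp_all add: cos_add cos_diff sin_add sin_diff)
    show ?thesis
      using pm prod int trig_int[OF Y'] char(2)[OF Y']
      by (simp add: left_diff_distrib trig_id)
  qed
  have "\<bar>e\<bar> \<le> 1" unfolding e_def char(1)[OF G'] by (simp add: Bochner_Integration.integral_nonneg)
  then have bd: "\<bar>cos x - e\<bar> \<le> 2" for x
    using abs_cos_le_one[of x] by linarith
  have "(LINT \<omega>:F|M. cos (G \<omega>) - e) = 0"
    using * by (intro trig_orthogonal_filtration[OF _ bd _ _ F]) auto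
  then have c: "expectation (\<lambda>\<omega>. indicator F \<omega> * cos (G \<omega>) - e * indicator F \<omega>) = 0"
    unfolding set_lebesgue_integral_def by (simp add: right_diff_distrib mult.commute)
  have "(LINT \<omega>:F|M. sin (G \<omega>)) = 0"
    using * by (intro trig_orthogonal_filtration[of _ 1, OF _ _ _ _ F]) auto
  then have s: "expectation (\<lambda>\<omega>. indicator F \<omega> * sin (G \<omega>)) = 0"
    unfolding set_lebesgue_integral_def by simp
  have i: "integrable M (\<lambda>\<omega>. indicator F \<omega> * cos (G \<omega>))" "integrable M (\<lambda>\<omega>. indicator F \<omega> * sin (G \<omega>))"
    "integrable M (\<lambda>\<omega>. indicator F \<omega> :: real)"
    by (rule integrable_const_bound[of _ 1]; auto simp: indicator_def)+
  show "expectation (\<lambda>\<omega>. (indicator F \<omega> - prob F) * cos (G \<omega>)) = 0"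
    using c i trig_int[OF G'] by (simp add: left_diff_distrib e_def)
  show "expectation (\<lambda>\<omega>. (indicator F \<omega> - prob F) * sin (G \<omega>)) = 0"
    using s i trig_int[OF G'] char(2)[OF G'] by (simp add: left_diff_distrib)
qed

text \<open>The signed weight is \<open>indicator F\<close> minus its mean. Multiples of
  \<open>G\<close> are late noise again, so orthogonality is available at every frequency and passes
  to the indicator of \<open>B\<close>.\<close>

lemma late_noise_indep_event:
  assumes G: "G \<in> noise_span \<xi> (late t)"
    and F: "F \<in> sets (noise_filtration M \<xi> t)" and B [measurable]: "B \<in> sets borel"
  shows "prob (F \<inter> (G -` B \<inter> space M)) = prob F * prob (G -` B \<inter> space M)"
proof -
  have G': "G \<in> noise_span \<xi> L2_half" using G noise_span_mono[OF late_subset] by blast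
  note [measurable] = noise_span_measurable[OF G']
  have [measurable]: "F \<in> sets M" using F sets_noise_filtration_subset by blast
  have "expectation (\<lambda>\<omega>. (indicator F \<omega> - prob F) * indicator B (G \<omega>)) = 0"
    using late_noise_trig_orthogonal[OF noise_span_scale[OF G] F]
    by (intro integral_indicator_eq_0_if_trig Bochner_Integration.integrable_diff integrable_const)
       (auto simp: emeasure_eq_measure)
  also have "expectation (\<lambda>\<omega>. (indicator F \<omega> - prob F) * indicator B (G \<omega>))
      = expectation (\<lambda>\<omega>. indicator (F \<inter> (G -` B \<inter> space M)) \<omega> - prob F * indicator (G -` B \<inter> space M) \<omega>)"
    by (intro Bochner_Integration.integral_cong) (auto simp: indicator_def)
  also have "\<dots> = prob (F \<inter> (G -` B \<inter> space M)) - prob F * prob (G -` B \<inter> space M)"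
    by (subst Bochner_Integration.integral_diff) (auto simp: emeasure_eq_measure)
  finally show ?thesis by simp
qed

lemma late_noise_indep:
  assumes G: "G \<in> noise_span \<xi> (late t)"
    and X: "X \<in> borel_measurable (noise_filtration M \<xi> t)"
  shows "indep_var borel X borel G"
proof -
  have G': "G \<in> noise_span \<xi> L2_half" using G noise_span_mono[OF late_subset] by blast
  have Xv: "sigma_sets (space M) {X -` A \<inter> space M | A. A \<in> sets borel} \<subseteq> sets (noise_filtration M \<xi> t)"
    using measurable_sets[OF X] by (intro sets.sigma_sets_subset[where M = "noise_filtration M \<xi> t", simplified]) auto
  have Gv: "sigma_sets (space M) {G -` A \<inter> space M | A. A \<in> sets borel} = {G -` A \<inter> space M | A. A \<in> sets borel}"
    using sigma_sets_vimage_commute[of G "space M" "space borel" "sets borel"] sets.sigma_sets_eq[of "borel :: real measure"]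
    by (simp)
  show ?thesis
    unfolding indep_var_eq
  proof (intro conjI indep_setI)
    show "X \<in> borel_measurable M" "G \<in> borel_measurable M"
      using measurable_noise_filtration[OF X] noise_span_measurable[OF G'] by auto
    show "sigma_sets (space M) {X -` A \<inter> space M | A. A \<in> sets borel} \<subseteq> sets M"
      using Xv sets_noise_filtration_subset by blast
    show "sigma_sets (space M) {G -` A \<inter> space M | A. A \<in> sets borel} \<subseteq> sets M"
      unfolding Gv using noise_span_measurable[OF G'] by auto
  qed (use Xv Gv late_noise_indep_event[OF G] in auto)
qed

end

section \<open>The Walsh isometry\<close>

lemma (in prob_space) integrable_bounded_mult:
  fixes W f :: "'a \<Rightarrow> real"
  assumes [measurable]: "W \<in> borel_measurable M" and bd: "\<And>\<omega>. \<omega> \<in> space M \<Longrightarrow> \<bar>W \<omega>\<bar> \<le> K"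
    and f: "integrable M f"
  shows "integrable M (\<lambda>\<omega>. W \<omega> * f \<omega>)"
proof (rule Bochner_Integration.integrable_bound)
  show "integrable M (\<lambda>\<omega>. K * f \<omega>)" using f by simp
  show "AE \<omega> in M. norm (W \<omega> * f \<omega>) \<le> norm (K * f \<omega>)"
    by (intro AE_I2) (auto simp: abs_mult intro!: mult_right_mono[OF order_trans[OF bd abs_ge_self] abs_ge_zero])
qed (use f in measurable)

lemma integral_double_sum:
  fixes f :: "'i \<Rightarrow> 'j \<Rightarrow> 'a \<Rightarrow> real"
  assumes "\<And>i j. i \<in> I \<Longrightarrow> j \<in> J \<Longrightarrow> integrable M (f i j)"
  shows "(LINT \<omega>|M. (\<Sum>i\<in>I. \<Sum>j\<in>J. f i j \<omega>)) = (\<Sum>i\<in>I. \<Sum>j\<in>J. LINT \<omega>|M. f i j \<omega>)"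
proof -
  have "(LINT \<omega>|M. (\<Sum>i\<in>I. \<Sum>j\<in>J. f i j \<omega>)) = (\<Sum>i\<in>I. LINT \<omega>|M. (\<Sum>j\<in>J. f i j \<omega>))"
    using assms by (intro Bochner_Integration.integral_sum Bochner_Integration.integrable_sum)
  also have "\<dots> = (\<Sum>i\<in>I. \<Sum>j\<in>J. LINT \<omega>|M. f i j \<omega>)"
    using assms by (intro sum.cong refl Bochner_Integration.integral_sum)
  finally show ?thesis .
qed

section \<open>Square-integrable test functions and indicators of rectangles\<close>

lemma L2_half_mult_integrable:
  assumes "h \<in> L2_half" "g \<in> L2_half"
  shows "set_integrable lborel ({0..} \<times> UNIV) (\<lambda>z. h z * g z)"
proof -
  let ?I = "indicator ({0..} \<times> UNIV) :: real \<times> real \<Rightarrow> real"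
  have [measurable]: "h \<in> borel_measurable borel" "g \<in> borel_measurable borel"
    using assms by (auto simp: L2_half_def)
  have [measurable]: "{0..} \<times> UNIV \<in> sets (borel :: (real \<times> real) measure)"
    by (intro borel_closed closed_Times) auto
  have sq: "(?I z * k z)\<^sup>2 = ?I z * (k z)\<^sup>2" for k z by (auto simp: indicator_def)
  have "integrable lborel (\<lambda>z. (?I z * h z) * (?I z * g z))"
    using assms by (intro integrable_mult_if_squares) (auto simp: sq L2_half_def set_integrable_def)
  also have "(\<lambda>z. (?I z * h z) * (?I z * g z)) = (\<lambda>z. ?I z *\<^sub>R (h z * g z))"
    by (auto simp: indicator_def)
  finally show ?thesis unfolding set_integrable_def .
qed

definition rect :: "real \<Rightarrow> real \<Rightarrow> real set \<Rightarrow> real \<times> real \<Rightarrow> real" where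
  "rect a b A = indicator ({a<..b} \<times> A)"

lemma rect_measurable [measurable]: "A \<in> sets borel \<Longrightarrow> rect a b A \<in> borel_measurable borel"
  unfolding rect_def by (intro borel_measurable_indicator) (simp add: borel_prod[symmetric] pair_measureI)

lemma rect_L2_half:
  assumes A: "A \<in> sets borel" "emeasure lborel A < \<infinity>"
  shows "rect a b A \<in> L2_half"
proof -
  have [measurable]: "A \<in> sets borel" by fact
  have [measurable]: "{0..} \<times> UNIV \<in> sets (borel :: (real \<times> real) measure)"
    by (intro borel_closed closed_Times) auto
  have S [measurable]: "{a<..b} \<times> A \<in> sets borel"
    unfolding borel_prod[symmetric] by measurable
  have "emeasure lborel ({a<..b} \<times> A) = emeasure (lborel \<Otimes>\<^sub>M lborel) ({a<..b} \<times> A)"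
    by (simp add: lborel_prod)
  also have "\<dots> = emeasure lborel {a<..b} * emeasure lborel A"
    by (subst lborel.emeasure_pair_measure_Times) auto
  also have "\<dots> < \<infinity>" using A by (cases "a \<le> b") (auto simp: ennreal_mult_less_top)
  finally have fin: "emeasure lborel ({a<..b} \<times> A) < \<infinity>" .
  have "integrable lborel (indicator ({a<..b} \<times> A) :: real \<times> real \<Rightarrow> real)"
    using fin S by simp
  then have "set_integrable lborel ({0..} \<times> UNIV) (indicator ({a<..b} \<times> A) :: real \<times> real \<Rightarrow> real)"
    unfolding set_integrable_def by (intro integrable_mult_indicator) auto
  moreover have "(\<lambda>z. (rect a b A z)\<^sup>2) = indicator ({a<..b} \<times> A)"
    by (auto simp: rect_def indicator_def)
  ultimately show ?thesis using A by (simp add: L2_half_def)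
qed

lemma rect_early: "A \<in> sets borel \<Longrightarrow> emeasure lborel A < \<infinity> \<Longrightarrow> 0 \<le> a \<Longrightarrow> b \<le> t \<Longrightarrow> rect a b A \<in> early t"
  using rect_L2_half by (auto simp: early_def rect_def indicator_def)

lemma rect_late: "A \<in> sets borel \<Longrightarrow> emeasure lborel A < \<infinity> \<Longrightarrow> t \<le> a \<Longrightarrow> rect a b A \<in> late t"
  using rect_L2_half by (auto simp: late_def rect_def indicator_def)

section \<open>Elementary integrals and the isometry for simple fields\<close>

context noise
begin

text \<open>The defect \<open>D\<close> is uncorrelated with every \<open>\<xi> g\<close>, because
  inner products are additive. It is itself a combination of such variables, so its second moment is
  0.\<close>

lemma noise_additive:
  assumes h: "h1 \<in> L2_half" "h2 \<in> L2_half" and s: "(\<lambda>z. h1 z + h2 z) \<in> L2_half"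
  shows "AE \<omega> in M. \<xi> (\<lambda>z. h1 z + h2 z) \<omega> = \<xi> h1 \<omega> + \<xi> h2 \<omega>"
proof -
  define h where "h = (\<lambda>z. h1 z + h2 z)"
  have hL: "h \<in> L2_half" using s by (simp add: h_def)
  define D where "D = (\<lambda>\<omega>. \<xi> h \<omega> - \<xi> h1 \<omega> - \<xi> h2 \<omega>)"
  have int: "integrable M (\<lambda>\<omega>. \<xi> f \<omega> * \<xi> g \<omega>)" if "f \<in> L2_half" "g \<in> L2_half" for f g
    using that by (intro noise_span_mult_integrable noise_span_base)
  note [measurable] = noise_measurable[OF hL] noise_measurable[OF h(1)] noise_measurable[OF h(2)]
  have Dm [measurable]: "D \<in> borel_measurable M" unfolding D_def by measurable
  have D0: "expectation (\<lambda>\<omega>. D \<omega> * \<xi> g \<omega>) = 0" and Di: "integrable M (\<lambda>\<omega>. D \<omega> * \<xi> g \<omega>)"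
    if g: "g \<in> L2_half" for g
  proof -
    have "half_inner h g = half_inner h1 g + half_inner h2 g"
      unfolding h_def distrib_right
      using h g by (intro set_integral_add L2_half_mult_integrable)
    then show "expectation (\<lambda>\<omega>. D \<omega> * \<xi> g \<omega>) = 0"
      using int g h hL by (simp add: D_def left_diff_distrib noise_covariance)
    show "integrable M (\<lambda>\<omega>. D \<omega> * \<xi> g \<omega>)"
      using int g h hL by (simp add: D_def left_diff_distrib)
  qed
  have sq: "D \<omega> * D \<omega> = D \<omega> * \<xi> h \<omega> - D \<omega> * \<xi> h1 \<omega> - D \<omega> * \<xi> h2 \<omega>" for \<omega>
    by (simp add: D_def algebra_simps)
  have "expectation (\<lambda>\<omega>. D \<omega> * D \<omega>) = 0" "integrable M (\<lambda>\<omega>. D \<omega> * D \<omega>)"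
    unfolding sq using D0 Di h hL by simp_all
  then have "AE \<omega> in M. D \<omega> * D \<omega> = 0"
    by (subst (asm) integral_nonneg_eq_0_iff_AE) auto
  then show ?thesis unfolding D_def h_def by eventually_elim simp
qed

lemma noise_filtration_mono:
  assumes "s \<le> t" shows "sets (noise_filtration M \<xi> s) \<subseteq> sets (noise_filtration M \<xi> t)"
proof -
  have "early s \<subseteq> early t" using assms by (force simp: early_def)
  then have "filtration_generator s \<subseteq> filtration_generator t"
    unfolding filtration_generator_def by blast
  then show ?thesis unfolding sets_noise_filtration by (rule sigma_sets_mono')
qed

lemma noise_filtration_measurable_mono:
  "s \<le> t \<Longrightarrow> X \<in> borel_measurable (noise_filtration M \<xi> s) \<Longrightarrow> X \<in> borel_measurable (noise_filtration M \<xi> t)"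
  using noise_filtration_mono[of s t] by (auto simp: measurable_def)

lemma early_noise_measurable:
  assumes "h \<in> early t" shows "\<xi> h \<in> borel_measurable (noise_filtration M \<xi> t)"
  using assms
  by (intro measurableI) (auto simp: sets_noise_filtration filtration_generator_def intro!: sigma_sets.Basic)

lemma expectation_mult_late_noise:
  assumes W: "W \<in> borel_measurable (noise_filtration M \<xi> t)" "integrable M W" and g: "g \<in> late t"
  shows "expectation (\<lambda>\<omega>. W \<omega> * \<xi> g \<omega>) = 0"
proof -
  have g': "\<xi> g \<in> noise_span \<xi> L2_half" using g late_subset by (intro noise_span_base) auto
  have "expectation (\<lambda>\<omega>. W \<omega> * \<xi> g \<omega>) = expectation W * expectation (\<xi> g)"
    using late_noise_indep[OF noise_span_base[OF g] W(1)] W(2) gaussian_rv_integrable(1)[OF noise_span_gaussian[OF g']]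
    by (intro indep_var_lebesgue_integral)
  then show ?thesis using noise_span_expectation[OF g'] by simp
qed

text \<open>Independence has been established for single elements of the late span. Polarization
  therefore writes the product through the squares of \<open>\<xi> g1\<close>,
  \<open>\<xi> g2\<close> and their sum, each of which factors from \<open>W\<close>.\<close>

lemma expectation_mult_late_noise2:
  assumes W: "W \<in> borel_measurable (noise_filtration M \<xi> t)" and bd: "\<And>\<omega>. \<omega> \<in> space M \<Longrightarrow> \<bar>W \<omega>\<bar> \<le> K"
    and g: "g1 \<in> late t" "g2 \<in> late t"
  shows "expectation (\<lambda>\<omega>. W \<omega> * (\<xi> g1 \<omega> * \<xi> g2 \<omega>)) = expectation W * half_inner g1 g2"
proof -
  note [measurable] = measurable_noise_filtration[OF W]
  have Wi: "integrable M W"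
    by (rule integrable_const_bound[of _ K]) (use bd in auto)
  have sq: "expectation (\<lambda>\<omega>. W \<omega> * (G \<omega>)\<^sup>2) = expectation W * expectation (\<lambda>\<omega>. (G \<omega>)\<^sup>2)"
    "integrable M (\<lambda>\<omega>. (G \<omega>)\<^sup>2)" "integrable M (\<lambda>\<omega>. W \<omega> * (G \<omega>)\<^sup>2)"
    if G: "G \<in> noise_span \<xi> (late t)" for G
  proof -
    have G': "G \<in> noise_span \<xi> L2_half" using G noise_span_mono[OF late_subset] by blast
    show i: "integrable M (\<lambda>\<omega>. (G \<omega>)\<^sup>2)"
      using gaussian_rv_integrable(2)[OF noise_span_gaussian[OF G']] .
    have "indep_var borel ((\<lambda>x. x) \<circ> W) borel ((\<lambda>x. x\<^sup>2) \<circ> G)"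
      by (rule indep_var_compose[OF late_noise_indep[OF G W]]) auto
    then have ind: "indep_var borel W borel (\<lambda>\<omega>. (G \<omega>)\<^sup>2)" by (simp add: comp_def)
    show "expectation (\<lambda>\<omega>. W \<omega> * (G \<omega>)\<^sup>2) = expectation W * expectation (\<lambda>\<omega>. (G \<omega>)\<^sup>2)"
      by (rule indep_var_lebesgue_integral[OF ind Wi i])
    show "integrable M (\<lambda>\<omega>. W \<omega> * (G \<omega>)\<^sup>2)"
      by (rule indep_var_integrable[OF ind Wi i])
  qed
  note g1 = noise_span_base[OF g(1), of \<xi>] and g2 = noise_span_base[OF g(2), of \<xi>]
  note s = noise_span_add[OF g1 g2]
  have pol: "\<xi> g1 \<omega> * \<xi> g2 \<omega> = ((\<xi> g1 \<omega> + \<xi> g2 \<omega>)\<^sup>2 - (\<xi> g1 \<omega>)\<^sup>2 - (\<xi> g2 \<omega>)\<^sup>2) / 2" for \<omega>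
    by (simp add: power2_eq_square algebra_simps)
  have "expectation (\<lambda>\<omega>. W \<omega> * (\<xi> g1 \<omega> * \<xi> g2 \<omega>)) = expectation W * expectation (\<lambda>\<omega>. \<xi> g1 \<omega> * \<xi> g2 \<omega>)"
    unfolding pol using sq[OF g1] sq[OF g2] sq[OF s]
    by (simp add: right_diff_distrib)
  then show ?thesis using g late_subset by (subst (asm) noise_covariance) auto
qed

text \<open>The interval that starts earlier may reach beyond \<open>c\<close> and is split there.
  Its part up to \<open>c\<close>, together with \<open>X\<close> and \<open>Y\<close>, is known at
  time \<open>c\<close> and meets centered later noise, so it contributes nothing; the remaining
  part is late and its product with the other increment factors from \<open>X * Y\<close>. The early
  part drops out of the inner product as well, which restores the full rectangle.\<close>

lemma elementary_pair_ordered: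
  assumes p: "(a, b, A, X) \<in> elementary M \<xi>" and q: "(c, d, B, Y) \<in> elementary M \<xi>" and "a \<le> c"
  shows "expectation (\<lambda>\<omega>. (X \<omega> * \<xi> (rect a b A) \<omega>) * (Y \<omega> * \<xi> (rect c d B) \<omega>))
    = expectation (\<lambda>\<omega>. X \<omega> * Y \<omega>) * half_inner (rect a b A) (rect c d B)"
proof -
  have A: "A \<in> sets borel" "emeasure lborel A < \<infinity>" and B: "B \<in> sets borel" "emeasure lborel B < \<infinity>"
    and X: "X \<in> borel_measurable (noise_filtration M \<xi> c)" and Y: "Y \<in> borel_measurable (noise_filtration M \<xi> c)"
    and ab: "0 \<le> a" "a < b" "0 \<le> c" "c < d"
    using p q noise_filtration_measurable_mono[OF \<open>a \<le> c\<close>] by (auto simp: elementary_def)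
  obtain K where K: "\<And>\<omega>. \<omega> \<in> space M \<Longrightarrow> \<bar>X \<omega>\<bar> \<le> K"
    using p unfolding elementary_def bounded_iff by auto
  obtain L where L: "\<And>\<omega>. \<omega> \<in> space M \<Longrightarrow> \<bar>Y \<omega>\<bar> \<le> L"
    using q unfolding elementary_def bounded_iff by auto
  define W where "W = (\<lambda>\<omega>. X \<omega> * Y \<omega>)"
  have W: "W \<in> borel_measurable (noise_filtration M \<xi> c)"
    unfolding W_def using X Y by measurable
  note [measurable] = measurable_noise_filtration[OF X] measurable_noise_filtration[OF Y] measurable_noise_filtration[OF W]
  have Wbd: "\<bar>W \<omega>\<bar> \<le> K * L" if "\<omega> \<in> space M" for \<omega>
    unfolding W_def abs_mult using that K[OF that] L[OF that] by (intro mult_mono) auto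
  \<comment> \<open>If b \<le> c, then \<open>R2\<close> belongs to an empty interval and is the
    zero function, while \<open>R1\<close> is all of \<open>R\<close>.\<close>
  define R R1 R2 Q where "R = rect a b A" and "R1 = rect a (min b c) A" and "R2 = rect c b A" and "Q = rect c d B"
  have R1: "R1 \<in> early c" and R2: "R2 \<in> late c" and Q: "Q \<in> late c" and RL: "R \<in> L2_half"
    unfolding R1_def R2_def Q_def R_def using ab A B by (auto intro!: rect_early rect_late rect_L2_half)
  note L2 = subsetD[OF early_subset R1] subsetD[OF late_subset R2] subsetD[OF late_subset Q] RL
  note [measurable] = L2[THEN noise_measurable]
  have split: "R = (\<lambda>z. R1 z + R2 z)"
    using \<open>a \<le> c\<close> by (auto simp: R_def R1_def R2_def rect_def indicator_def fun_eq_iff)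
  have add: "AE \<omega> in M. \<xi> R \<omega> = \<xi> R1 \<omega> + \<xi> R2 \<omega>"
    using noise_additive[OF L2(1,2)] RL unfolding split by simp
  have int: "integrable M (\<lambda>\<omega>. W \<omega> * (\<xi> f \<omega> * \<xi> g \<omega>))" if "f \<in> L2_half" "g \<in> L2_half" for f g
    using that by (intro integrable_bounded_mult[OF _ Wbd] noise_span_mult_integrable noise_span_base) auto
  have W1: "expectation (\<lambda>\<omega>. W \<omega> * (\<xi> R1 \<omega> * \<xi> Q \<omega>)) = 0"
  proof -
    have "expectation (\<lambda>\<omega>. (W \<omega> * \<xi> R1 \<omega>) * \<xi> Q \<omega>) = 0"
    proof (rule expectation_mult_late_noise[OF _ _ Q])
      show "(\<lambda>\<omega>. W \<omega> * \<xi> R1 \<omega>) \<in> borel_measurable (noise_filtration M \<xi> c)"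
        using W early_noise_measurable[OF R1] by measurable
      show "integrable M (\<lambda>\<omega>. W \<omega> * \<xi> R1 \<omega>)"
        by (intro integrable_bounded_mult[OF _ Wbd] gaussian_rv_integrable(1) noise_gaussian L2) auto
    qed
    then show ?thesis by (simp add: mult.assoc)
  qed
  have "expectation (\<lambda>\<omega>. (X \<omega> * \<xi> R \<omega>) * (Y \<omega> * \<xi> Q \<omega>))
      = expectation (\<lambda>\<omega>. W \<omega> * (\<xi> R1 \<omega> * \<xi> Q \<omega>) + W \<omega> * (\<xi> R2 \<omega> * \<xi> Q \<omega>))"
    using add by (intro integral_cong_AE) (auto simp: W_def algebra_simps)
  also have "\<dots> = expectation W * half_inner R2 Q"
    using W1 int L2 expectation_mult_late_noise2[OF W Wbd R2 Q] by simp
  also have "half_inner R2 Q = half_inner R1 Q + half_inner R2 Q"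
    using half_inner_early_late[OF R1 Q] by simp
  also have "\<dots> = half_inner R Q"
    unfolding split distrib_right using L2
    by (intro set_integral_add(2)[symmetric] L2_half_mult_integrable)
  finally show ?thesis by (simp add: W_def R_def Q_def)
qed

lemma elementary_pair:
  assumes p: "(a, b, A, X) \<in> elementary M \<xi>" and q: "(c, d, B, Y) \<in> elementary M \<xi>"
  shows "expectation (\<lambda>\<omega>. (X \<omega> * \<xi> (rect a b A) \<omega>) * (Y \<omega> * \<xi> (rect c d B) \<omega>))
    = expectation (\<lambda>\<omega>. X \<omega> * Y \<omega>) * half_inner (rect a b A) (rect c d B)"
proof (cases "a \<le> c")
  case True
  then show ?thesis by (rule elementary_pair_ordered[OF p q])
next
  case False
  then have "c \<le> a" by simp
  from elementary_pair_ordered[OF q p this] show ?thesis by (simp add: mult.commute)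
qed

text \<open>Both squares are expanded over pairs of entries. The rectangles of a list may overlap,
  so mixed terms need not vanish; the pair formula shows that they agree on both sides.\<close>

lemma simple_isometry:
  assumes S: "set S \<subseteq> elementary M \<xi>"
  shows "(\<integral>\<^sup>+\<omega>. ennreal ((simple_integral \<xi> S \<omega>)\<^sup>2) \<partial>M) = walsh_norm2 M (simple_field S)"
proof -
  define n where "n = length S"
  define a b A X where "a i = fst (S ! i)" and "b i = fst (snd (S ! i))"
    and "A i = fst (snd (snd (S ! i)))" and "X i = snd (snd (snd (S ! i)))" for i
  have Si: "S ! i = (a i, b i, A i, X i)" for i by (simp add: a_def b_def A_def X_def)
  have el: "(a i, b i, A i, X i) \<in> elementary M \<xi>" if "i < n" for i
    using S that nth_mem[of i S] unfolding Si[symmetric] n_def by auto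
  define R where "R i = rect (a i) (b i) (A i)" for i
  have RL: "R i \<in> L2_half" if "i < n" for i
    using el[OF that] unfolding R_def by (intro rect_L2_half) (auto simp: elementary_def)
  have Xm [measurable]: "X i \<in> borel_measurable M" if "i < n" for i
    using el[OF that] measurable_noise_filtration by (auto simp: elementary_def)
  have Xbd: "\<exists>K. \<forall>\<omega>\<in>space M. \<bar>X i \<omega>\<bar> \<le> K" if "i < n" for i
    using el[OF that] by (auto simp: elementary_def bounded_iff)
  have XX: "\<exists>K. \<forall>\<omega>\<in>space M. \<bar>X i \<omega> * X j \<omega>\<bar> \<le> K" if ij: "i < n" "j < n" for i j
  proof -
    obtain K L where "\<forall>\<omega>\<in>space M. \<bar>X i \<omega>\<bar> \<le> K" "\<forall>\<omega>\<in>space M. \<bar>X j \<omega>\<bar> \<le> L"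
      using Xbd ij by meson
    then have "\<forall>\<omega>\<in>space M. \<bar>X i \<omega> * X j \<omega>\<bar> \<le> K * L"
      by (auto simp: abs_mult intro!: mult_mono order_trans[OF abs_ge_zero])
    then show ?thesis ..
  qed
  have XXi: "integrable M (\<lambda>\<omega>. X i \<omega> * X j \<omega>)" if ij: "i < n" "j < n" for i j
  proof -
    note [measurable] = Xm[OF ij(1)] Xm[OF ij(2)]
    obtain K where "\<forall>\<omega>\<in>space M. \<bar>X i \<omega> * X j \<omega>\<bar> \<le> K" using XX[OF ij] by blast
    then show ?thesis by (intro integrable_const_bound[of _ K]) auto
  qed
  have I: "simple_integral \<xi> S \<omega> = (\<Sum>i<n. X i \<omega> * \<xi> (R i) \<omega>)" for \<omega>
    unfolding simple_integral_def sum_list_sum_nth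
    by (simp add: n_def[symmetric] Si R_def rect_def lessThan_atLeast0)
  have F: "simple_field S t x \<omega> = (\<Sum>i<n. X i \<omega> * R i (t, x))" for t x \<omega>
    unfolding simple_field_def sum_list_sum_nth
    by (auto simp: n_def[symmetric] Si R_def rect_def lessThan_atLeast0 indicator_def intro!: sum.cong)
  \<comment> \<open>For a fixed outcome, \<open>Q\<close> is the space-time integral of the squared
    field; its expectation is the common value of the two sides.\<close>
  define Q where "Q \<omega> = (\<Sum>i<n. \<Sum>j<n. (X i \<omega> * X j \<omega>) * half_inner (R i) (R j))" for \<omega>
  have Qi: "integrable M Q"
    unfolding Q_def using XXi by (intro Bochner_Integration.integrable_sum integrable_mult_left) auto
  have term_int: "integrable M (\<lambda>\<omega>. (X i \<omega> * \<xi> (R i) \<omega>) * (X j \<omega> * \<xi> (R j) \<omega>))" if ij: "i < n" "j < n" for i j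
  proof -
    obtain K where K: "\<forall>\<omega>\<in>space M. \<bar>X i \<omega> * X j \<omega>\<bar> \<le> K" using XX[OF ij] by auto
    have "integrable M (\<lambda>\<omega>. (X i \<omega> * X j \<omega>) * (\<xi> (R i) \<omega> * \<xi> (R j) \<omega>))"
      using K ij Xm by (intro integrable_bounded_mult[where K = K] noise_span_mult_integrable noise_span_base RL) auto
    then show ?thesis by (simp add: mult_ac)
  qed
  have sq: "(simple_integral \<xi> S \<omega>)\<^sup>2 = (\<Sum>i<n. \<Sum>j<n. (X i \<omega> * \<xi> (R i) \<omega>) * (X j \<omega> * \<xi> (R j) \<omega>))" for \<omega>
    unfolding I power2_eq_square sum_product ..
  have "integrable M (\<lambda>\<omega>. (simple_integral \<xi> S \<omega>)\<^sup>2)"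
    unfolding sq using term_int by (intro Bochner_Integration.integrable_sum) auto
  then have "(\<integral>\<^sup>+\<omega>. ennreal ((simple_integral \<xi> S \<omega>)\<^sup>2) \<partial>M) = ennreal (expectation (\<lambda>\<omega>. (simple_integral \<xi> S \<omega>)\<^sup>2))"
    by (intro nn_integral_eq_integral) auto
  also have "expectation (\<lambda>\<omega>. (simple_integral \<xi> S \<omega>)\<^sup>2) = (\<Sum>i<n. \<Sum>j<n. expectation (\<lambda>\<omega>. (X i \<omega> * \<xi> (R i) \<omega>) * (X j \<omega> * \<xi> (R j) \<omega>)))"
    unfolding sq using term_int by (intro integral_double_sum) auto
  also have "\<dots> = (\<Sum>i<n. \<Sum>j<n. expectation (\<lambda>\<omega>. X i \<omega> * X j \<omega>) * half_inner (R i) (R j))"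
    unfolding R_def by (intro sum.cong refl elementary_pair el) auto
  also have "\<dots> = expectation Q"
    unfolding Q_def using XXi by (subst integral_double_sum) auto
  finally have lhs: "(\<integral>\<^sup>+\<omega>. ennreal ((simple_integral \<xi> S \<omega>)\<^sup>2) \<partial>M) = ennreal (expectation Q)" .
  have field: "(\<integral>\<^sup>+t\<in>{0..}. (\<integral>\<^sup>+x. ennreal ((simple_field S t x \<omega>)\<^sup>2) \<partial>lborel) \<partial>lborel) = ennreal (Q \<omega>)"
    and Q_nonneg: "0 \<le> Q \<omega>" for \<omega>
  proof -
    let ?I = "indicator ({0..} \<times> UNIV) :: real \<times> real \<Rightarrow> real"
    define f where "f z = ?I z * (\<Sum>i<n. X i \<omega> * R i z)\<^sup>2" for z
    have eq: "f z = (\<Sum>i<n. \<Sum>j<n. (X i \<omega> * X j \<omega>) * (?I z *\<^sub>R (R i z * R j z)))" for z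
      unfolding f_def power2_eq_square sum_product by (simp add: sum_distrib_left mult_ac)
    have fi: "has_bochner_integral lborel f (Q \<omega>)"
      unfolding eq Q_def set_lebesgue_integral_def using L2_half_mult_integrable[OF RL RL]
      by (intro has_bochner_integral_sum has_bochner_integral_mult_right has_bochner_integral_integrable impI)
         (auto simp: set_integrable_def)
    have fm [measurable]: "f \<in> borel_measurable borel"
      using fi borel_measurable_integrable[of lborel f] by (simp add: has_bochner_integral_iff)
    have "(\<integral>\<^sup>+t\<in>{0..}. (\<integral>\<^sup>+x. ennreal ((simple_field S t x \<omega>)\<^sup>2) \<partial>lborel) \<partial>lborel)
        = (\<integral>\<^sup>+t. (\<integral>\<^sup>+x. ennreal (f (t, x)) \<partial>lborel) \<partial>lborel)"
      by (intro nn_integral_cong) (auto simp: f_def F indicator_def)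
    also have "\<dots> = (\<integral>\<^sup>+z. ennreal (f z) \<partial>lborel)"
      by (subst lborel.nn_integral_fst) (simp_all add: lborel_prod)
    also have "\<dots> = ennreal (Q \<omega>)"
      using fi by (subst nn_integral_eq_integral) (auto simp: has_bochner_integral_iff f_def)
    finally show "(\<integral>\<^sup>+t\<in>{0..}. (\<integral>\<^sup>+x. ennreal ((simple_field S t x \<omega>)\<^sup>2) \<partial>lborel) \<partial>lborel) = ennreal (Q \<omega>)" .
    show "0 \<le> Q \<omega>"
      using fi Bochner_Integration.integral_nonneg[of lborel f] by (simp add: has_bochner_integral_iff f_def)
  qed
  have "walsh_norm2 M (simple_field S) = (\<integral>\<^sup>+\<omega>. ennreal (Q \<omega>) \<partial>M)"
    unfolding walsh_norm2_def field ..
  also have "\<dots> = ennreal (expectation Q)"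
    using Qi Q_nonneg by (intro nn_integral_eq_integral) auto
  finally show ?thesis using lhs by simp
qed

end

section \<open>Joint measurability of predictable fields and passage to the limit\<close>

lemma measurable_compose3:
  assumes "(\<lambda>(t, x, \<omega>). f t x \<omega>) \<in> measurable (A \<Otimes>\<^sub>M (B \<Otimes>\<^sub>M C)) L"
    and "a \<in> measurable N A" "b \<in> measurable N B" "c \<in> measurable N C"
  shows "(\<lambda>z. f (a z) (b z) (c z)) \<in> measurable N L"
  using measurable_compose[OF measurable_Pair[OF assms(2) measurable_Pair[OF assms(3,4)]] assms(1)] by simp

lemma (in sigma_finite_measure) nn_integral_rotate3:
  assumes f: "(\<lambda>(t, x, \<omega>). f t x \<omega>) \<in> borel_measurable (borel \<Otimes>\<^sub>M (borel \<Otimes>\<^sub>M M))"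
  shows "(\<integral>\<^sup>+\<omega>. (\<integral>\<^sup>+t. (\<integral>\<^sup>+x. f t x \<omega> \<partial>lborel) \<partial>lborel) \<partial>M) = (\<integral>\<^sup>+t. (\<integral>\<^sup>+x. (\<integral>\<^sup>+\<omega>. f t x \<omega> \<partial>M) \<partial>lborel) \<partial>lborel)"
    (is "?L = ?R")
proof -
  interpret P: pair_sigma_finite lborel M ..
  note [measurable (raw)] = measurable_compose3[OF f]
  have "?L = (\<integral>\<^sup>+t. (\<integral>\<^sup>+\<omega>. (\<integral>\<^sup>+x. f t x \<omega> \<partial>lborel) \<partial>M) \<partial>lborel)"
    by (rule P.Fubini'[of "\<lambda>t \<omega>. \<integral>\<^sup>+x. f t x \<omega> \<partial>lborel"]) measurable
  also have "\<dots> = ?R"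
    by (intro nn_integral_cong P.Fubini') measurable
  finally show ?thesis .
qed

text \<open>Nothing is known about a field at negative times. Moving the time restriction into the
  integrand replaces the field by its extension by zero, which is jointly measurable for predictable
  fields.\<close>

lemma walsh_norm2_eq:
  "walsh_norm2 M \<Phi> = (\<integral>\<^sup>+\<omega>. (\<integral>\<^sup>+t. (\<integral>\<^sup>+x. ennreal ((indicator {0..} t * \<Phi> t x \<omega>)\<^sup>2) \<partial>lborel) \<partial>lborel) \<partial>M)"
  unfolding walsh_norm2_def by (intro nn_integral_cong) (auto simp: indicator_def)

context noise
begin

text \<open>The generators of the predictable sigma-algebra are rectangles with sides measurable for
  time, space and \<open>M\<close>. It is thus contained in the trace of the product sigma-algebra
  on nonnegative times, and extension by zero leads back to the full product.\<close>

lemma predictable_field_measurable: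
  assumes "predictable_field M \<xi> \<Phi>"
  shows "(\<lambda>(t, x, \<omega>). indicator {0..} t * \<Phi> t x \<omega>) \<in> borel_measurable (borel \<Otimes>\<^sub>M (borel \<Otimes>\<^sub>M M))"
proof -
  let ?N = "borel \<Otimes>\<^sub>M (borel \<Otimes>\<^sub>M M) :: (real \<times> real \<times> 'a) measure"
  let ?\<Omega> = "{0..} \<times> UNIV \<times> space M :: (real \<times> real \<times> 'a) set"
  define G :: "(real \<times> real \<times> 'a) set set" where "G = {{0} \<times> A \<times> F | A F. A \<in> sets borel \<and> F \<in> sets (noise_filtration M \<xi> 0)} \<union>
      {{a<..b} \<times> A \<times> F | a b A F.
         0 \<le> a \<and> a < b \<and> A \<in> sets borel \<and> F \<in> sets (noise_filtration M \<xi> a)}"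
  have F: "F \<in> sets M" if "F \<in> sets (noise_filtration M \<xi> t)" for F t
    using that sets_noise_filtration_subset by blast
  have FM: "F \<subseteq> space M" if "F \<in> sets (noise_filtration M \<xi> t)" for F t
    using F[OF that] sets.sets_into_space by blast
  have \<Omega>: "?\<Omega> \<in> sets ?N" by measurable
  have sub: "G \<subseteq> Pow ?\<Omega>" unfolding G_def using FM by fastforce
  have GN: "G \<subseteq> sets ?N" unfolding G_def using F by auto
  have \<Omega>N: "?\<Omega> \<inter> space ?N = ?\<Omega>" by (auto simp: space_pair_measure)
  have "G \<subseteq> sets (restrict_space ?N ?\<Omega>)"
  proof
    fix B assume "B \<in> G"
    with sub GN have "B \<subseteq> ?\<Omega>" "B \<in> sets ?N" by blast+
    then show "B \<in> sets (restrict_space ?N ?\<Omega>)"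
      using \<Omega> \<Omega>N sets_restrict_space_iff[of ?\<Omega> ?N B] by simp
  qed
  moreover have sp: "space (restrict_space ?N ?\<Omega>) = ?\<Omega>"
    by (auto simp: space_restrict_space space_pair_measure)
  ultimately have "sigma_sets ?\<Omega> G \<subseteq> sets (restrict_space ?N ?\<Omega>)"
    using sets.sigma_sets_subset[of G "restrict_space ?N ?\<Omega>"] by simp
  then have "sets (predictable_sigma M \<xi>) \<subseteq> sets (restrict_space ?N ?\<Omega>)"
    unfolding predictable_sigma_def G_def[symmetric] using sub by (simp add: sets_measure_of)
  moreover have "space (predictable_sigma M \<xi>) = ?\<Omega>"
    unfolding predictable_sigma_def by (simp add: space_measure_of_conv)
  ultimately have "(\<lambda>(t, x, \<omega>). \<Phi> t x \<omega>) \<in> borel_measurable (restrict_space ?N ?\<Omega>)"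
    using assms sp unfolding predictable_field_def measurable_def by auto
  then have "(\<lambda>z. indicator ?\<Omega> z *\<^sub>R (case z of (t, x, \<omega>) \<Rightarrow> \<Phi> t x \<omega>)) \<in> borel_measurable ?N"
    using \<Omega> by (subst (asm) borel_measurable_restrict_space_iff) auto
  then show ?thesis
    by (rule measurable_cong[THEN iffD1, rotated]) (auto simp: space_pair_measure indicator_def)
qed

lemma simple_integral_measurable:
  "set S \<subseteq> elementary M \<xi> \<Longrightarrow> simple_integral \<xi> S \<in> borel_measurable M"
proof (induction S)
  case Nil
  then show ?case by (simp add: simple_integral_def)
next
  case (Cons p S)
  obtain a b A X where p: "p = (a, b, A, X)" by (cases p)
  have [measurable]: "X \<in> borel_measurable M" "\<xi> (rect a b A) \<in> borel_measurable M"
    using Cons.prems measurable_noise_filtration noise_measurable[OF rect_L2_half]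
    by (auto simp: p elementary_def)
  have [measurable]: "simple_integral \<xi> S \<in> borel_measurable M" using Cons by simp
  have "simple_integral \<xi> (p # S) = (\<lambda>\<omega>. X \<omega> * \<xi> (rect a b A) \<omega> + simple_integral \<xi> S \<omega>)"
    by (simp add: simple_integral_def p rect_def fun_eq_iff)
  then show ?case by simp
qed

lemma simple_field_measurable:
  "set S \<subseteq> elementary M \<xi> \<Longrightarrow>
    (\<lambda>(t, x, \<omega>). simple_field S t x \<omega>) \<in> borel_measurable (borel \<Otimes>\<^sub>M (borel \<Otimes>\<^sub>M M))"
proof (induction S)
  case Nil
  then show ?case by (simp add: simple_field_def)
next
  case (Cons p S)
  obtain a b A X where p: "p = (a, b, A, X)" by (cases p)
  have [measurable]: "X \<in> borel_measurable M" "A \<in> sets borel"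
    using Cons.prems measurable_noise_filtration by (auto simp: p elementary_def)
  have "(\<lambda>(t, x, \<omega>). simple_field S t x \<omega>) \<in> borel_measurable (borel \<Otimes>\<^sub>M (borel \<Otimes>\<^sub>M M))"
    using Cons by simp
  note [measurable (raw)] = measurable_compose3[OF this]
  have eq: "(\<lambda>(t, x, \<omega>). simple_field (p # S) t x \<omega>)
      = (\<lambda>(t, x, \<omega>). X \<omega> * indicator {a<..b} t * indicator A x + simple_field S t x \<omega>)"
    by (simp add: simple_field_def p fun_eq_iff)
  show ?case unfolding eq by measurable
qed

lemma walsh_integral_bound:
  assumes "is_walsh_integral M \<xi> \<Phi> I"
  shows "(\<integral>\<^sup>+\<omega>. ennreal ((I \<omega>)\<^sup>2) \<partial>M) \<le> 4 * walsh_norm2 M \<Phi>"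
proof -
  have P: "predictable_field M \<xi> \<Phi>" and [measurable]: "I \<in> borel_measurable M"
    using assms by (auto simp: is_walsh_integral_def)
  obtain S where S: "\<And>n. set (S n) \<subseteq> elementary M \<xi>"
    and S1: "(\<lambda>n. walsh_norm2 M (\<lambda>t x \<omega>. \<Phi> t x \<omega> - simple_field (S n) t x \<omega>)) \<longlonglongrightarrow> 0"
    and S2: "(\<lambda>n. \<integral>\<^sup>+\<omega>. ennreal ((I \<omega> - simple_integral \<xi> (S n) \<omega>)\<^sup>2) \<partial>M) \<longlonglongrightarrow> 0"
    using assms unfolding is_walsh_integral_def by blast
  note [measurable] = simple_integral_measurable[OF S]
  note [measurable (raw)] = measurable_compose3[OF simple_field_measurable[OF S]]
  define \<Psi> where "\<Psi> = (\<lambda>t x \<omega>. indicator {0..} t * \<Phi> t x \<omega>)"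
  have "(\<lambda>(t, x, \<omega>). \<Psi> t x \<omega>) \<in> borel_measurable (borel \<Otimes>\<^sub>M (borel \<Otimes>\<^sub>M M))"
    using predictable_field_measurable[OF P] by (simp add: \<Psi>_def)
  note [measurable (raw)] = measurable_compose3[OF this]
  have sq: "ennreal (x\<^sup>2) \<le> 2 * ennreal ((y - x)\<^sup>2) + 2 * ennreal (y\<^sup>2)" for x y :: real
  proof -
    have "x\<^sup>2 \<le> 2 * (y - x)\<^sup>2 + 2 * y\<^sup>2"
      using zero_le_power2[of "2 * y - x"] by (simp add: power2_eq_square algebra_simps)
    then have "ennreal (x\<^sup>2) \<le> ennreal (2 * (y - x)\<^sup>2 + 2 * y\<^sup>2)" by (rule ennreal_leI)
    then show ?thesis by (simp add: ennreal_plus ennreal_mult)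
  qed
  have bound: "(\<integral>\<^sup>+\<omega>. ennreal ((I \<omega>)\<^sup>2) \<partial>M)
      \<le> 2 * (\<integral>\<^sup>+\<omega>. ennreal ((I \<omega> - simple_integral \<xi> (S n) \<omega>)\<^sup>2) \<partial>M)
       + 2 * (2 * walsh_norm2 M (\<lambda>t x \<omega>. \<Phi> t x \<omega> - simple_field (S n) t x \<omega>) + 2 * walsh_norm2 M \<Phi>)" for n
  proof -
    have "ennreal ((I \<omega>)\<^sup>2) \<le> 2 * ennreal ((I \<omega> - simple_integral \<xi> (S n) \<omega>)\<^sup>2) + 2 * ennreal ((simple_integral \<xi> (S n) \<omega>)\<^sup>2)" for \<omega>
      using sq[of "I \<omega>" "simple_integral \<xi> (S n) \<omega>"] by (simp add: power2_commute)
    then have "(\<integral>\<^sup>+\<omega>. ennreal ((I \<omega>)\<^sup>2) \<partial>M)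
        \<le> (\<integral>\<^sup>+\<omega>. 2 * ennreal ((I \<omega> - simple_integral \<xi> (S n) \<omega>)\<^sup>2) + 2 * ennreal ((simple_integral \<xi> (S n) \<omega>)\<^sup>2) \<partial>M)"
      by (intro nn_integral_mono)
    also have "\<dots> = 2 * (\<integral>\<^sup>+\<omega>. ennreal ((I \<omega> - simple_integral \<xi> (S n) \<omega>)\<^sup>2) \<partial>M)
        + 2 * (\<integral>\<^sup>+\<omega>. ennreal ((simple_integral \<xi> (S n) \<omega>)\<^sup>2) \<partial>M)"
      by (simp add: nn_integral_add nn_integral_cmult)
    also have "(\<integral>\<^sup>+\<omega>. ennreal ((simple_integral \<xi> (S n) \<omega>)\<^sup>2) \<partial>M) = walsh_norm2 M (simple_field (S n))"
      by (rule simple_isometry[OF S])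
    also have "walsh_norm2 M (simple_field (S n))
        \<le> (\<integral>\<^sup>+\<omega>. (\<integral>\<^sup>+t. (\<integral>\<^sup>+x. 2 * ennreal ((\<Psi> t x \<omega> - indicator {0..} t * simple_field (S n) t x \<omega>)\<^sup>2)
            + 2 * ennreal ((\<Psi> t x \<omega>)\<^sup>2) \<partial>lborel) \<partial>lborel) \<partial>M)"
      unfolding walsh_norm2_eq by (intro nn_integral_mono sq)
    also have "\<dots> = 2 * (\<integral>\<^sup>+\<omega>. (\<integral>\<^sup>+t. (\<integral>\<^sup>+x. ennreal ((\<Psi> t x \<omega> - indicator {0..} t * simple_field (S n) t x \<omega>)\<^sup>2) \<partial>lborel) \<partial>lborel) \<partial>M)
        + 2 * (\<integral>\<^sup>+\<omega>. (\<integral>\<^sup>+t. (\<integral>\<^sup>+x. ennreal ((\<Psi> t x \<omega>)\<^sup>2) \<partial>lborel) \<partial>lborel) \<partial>M)"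
      by (simp add: nn_integral_add nn_integral_cmult cong: nn_integral_cong)
    also have "\<dots> = 2 * walsh_norm2 M (\<lambda>t x \<omega>. \<Phi> t x \<omega> - simple_field (S n) t x \<omega>) + 2 * walsh_norm2 M \<Phi>"
      unfolding walsh_norm2_eq \<Psi>_def by (simp add: right_diff_distrib)
    finally show ?thesis by (simp add: add_left_mono mult_left_mono)
  qed
  have "(\<lambda>n. 2 * (\<integral>\<^sup>+\<omega>. ennreal ((I \<omega> - simple_integral \<xi> (S n) \<omega>)\<^sup>2) \<partial>M)
       + 2 * (2 * walsh_norm2 M (\<lambda>t x \<omega>. \<Phi> t x \<omega> - simple_field (S n) t x \<omega>) + 2 * walsh_norm2 M \<Phi>))
      \<longlonglongrightarrow> 2 * 0 + 2 * (2 * 0 + 2 * walsh_norm2 M \<Phi>)"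
    by (intro tendsto_add ennreal_tendsto_cmult tendsto_const S1 S2) auto
  then have "(\<integral>\<^sup>+\<omega>. ennreal ((I \<omega>)\<^sup>2) \<partial>M) \<le> 2 * 0 + 2 * (2 * 0 + 2 * walsh_norm2 M \<Phi>)"
    using bound by (intro LIMSEQ_le_const) auto
  then show ?thesis by (simp add: mult.assoc[symmetric])
qed

end

section \<open>A Gronwall inequality with an Abel kernel\<close>

definition abel_kernel :: "real \<Rightarrow> real \<Rightarrow> ennreal" where
  "abel_kernel t s = indicator {0<..<t} s * ennreal (1 / sqrt (t - s))"

lemma abel_kernel_measurable [measurable]:
  assumes [measurable]: "f \<in> borel_measurable M" "g \<in> borel_measurable M"
  shows "(\<lambda>x. abel_kernel (f x) (g x)) \<in> borel_measurable M"
  unfolding abel_kernel_def by (simp add: indicator_def)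

text \<open>The substitution r + (t - r) s maps (0, 1) onto (r, t), and the powers of t - r cancel,
  leaving the Beta integral B(1/2, 1/2) = \<pi>. Composing two half-order fractional integrals thus
  gives a multiple of the ordinary integral; only its independence of \<open>r\<close> and
  \<open>t\<close> matters.\<close>

lemma abel_kernel_convolution:
  assumes "r < t"
  shows "(\<integral>\<^sup>+s. indicator {r<..<t} s * ennreal (1 / sqrt (t - s)) * ennreal (1 / sqrt (s - r)) \<partial>lborel)
    = ennreal (Beta (1/2) (1/2))"
proof -
  have "((\<lambda>s. s powr (1/2 - 1) * (1 - s) powr (1/2 - 1)) has_integral Beta (1/2) (1/2)) {0<..<1::real}"
    using has_integral_Beta_real[of "1/2" "1/2"] by (simp add: has_integral_Icc_iff_Ioo)
  then have "integral\<^sup>N lborel (\<lambda>s. ennreal (indicator {0<..<1} s * (s powr (1/2 - 1) * (1 - s) powr (1/2 - 1)))) = ennreal (Beta (1/2) (1/2))"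
    by (intro nn_integral_has_integral_lebesgue) auto
  also have "integral\<^sup>N lborel (\<lambda>s. ennreal (indicator {0<..<1} s * (s powr (1/2 - 1) * (1 - s) powr (1/2 - 1))))
      = (\<integral>\<^sup>+s. ennreal (t - r) * (indicator {r<..<t} (r + (t - r) * s) *
          ennreal (1 / sqrt (t - (r + (t - r) * s))) * ennreal (1 / sqrt (r + (t - r) * s - r))) \<partial>lborel)"
  proof (intro nn_integral_cong)
    fix s :: real
    have ind: "r + (t - r) * s \<in> {r<..<t} \<longleftrightarrow> s \<in> {0<..<1}"
    proof -
      define p where "p = (t - r) * s"
      have "p < t - r \<longleftrightarrow> s < 1"
        using assms mult_less_cancel_left_pos[of "t - r" s 1] by (simp add: p_def)
      moreover have "0 < p \<longleftrightarrow> 0 < s" using assms by (simp add: p_def zero_less_mult_iff)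
      ultimately show ?thesis unfolding p_def[symmetric] by auto
    qed
    show "ennreal (indicator {0<..<1} s * (s powr (1/2 - 1) * (1 - s) powr (1/2 - 1)))
      = ennreal (t - r) * (indicator {r<..<t} (r + (t - r) * s) *
          ennreal (1 / sqrt (t - (r + (t - r) * s))) * ennreal (1 / sqrt (r + (t - r) * s - r)))"
    proof (cases "s \<in> {0<..<1}")
      case True
      have e: "t - (r + (t - r) * s) = (t - r) * (1 - s)" by (simp add: algebra_simps)
      have p: "x powr (1/2 - 1) = 1 / sqrt x" if "x > 0" for x :: real
        using that by (simp add: powr_minus powr_half_sqrt field_simps)
      have "s powr (1/2 - 1) * (1 - s) powr (1/2 - 1) = 1 / (sqrt s * sqrt (1 - s))"
        using p[of s] p[of "1 - s"] True by (simp only: greaterThanLessThan_iff diff_gt_0_iff_gt) simp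
      also have "\<dots> = (t - r) * (1 / sqrt ((t - r) * (1 - s)) * (1 / sqrt ((t - r) * s)))"
      proof -
        have "1 / (y * x) = p * p * (1 / (p * x) * (1 / (p * y)))" if "p > 0" "x > 0" "y > 0" for p x y :: real
          using that by (simp add: field_simps)
        from this[of "sqrt (t - r)" "sqrt (1 - s)" "sqrt s"] show ?thesis
          using True assms by (simp add: real_sqrt_mult)
      qed
      finally show ?thesis
        using True assms ind by (simp add: e ennreal_mult[symmetric] del: real_sqrt_mult)
    qed (use ind in simp)
  qed
  also have "\<dots> = ennreal (t - r) * (\<integral>\<^sup>+s. (indicator {r<..<t} (r + (t - r) * s) *
          ennreal (1 / sqrt (t - (r + (t - r) * s))) * ennreal (1 / sqrt (r + (t - r) * s - r))) \<partial>lborel)"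
    by (intro nn_integral_cmult) measurable
  also have "\<dots> = (\<integral>\<^sup>+s. indicator {r<..<t} s * ennreal (1 / sqrt (t - s)) * ennreal (1 / sqrt (s - r)) \<partial>lborel)"
    using assms by (subst (2) nn_integral_real_affine[where c = "t - r" and t = r]) auto
  finally show ?thesis by simp
qed

lemma nn_integral_exp_Ici:
  assumes "c > (0::real)"
  shows "(\<integral>\<^sup>+t. ennreal (exp (- c * t)) * indicator {r..} t \<partial>lborel) = ennreal (exp (- c * r) / c)"
proof -
  have "((\<lambda>t. exp (- c * t)) \<longlongrightarrow> 0) at_top"
    using assms by (intro filterlim_compose[OF exp_at_bot] filterlim_tendsto_neg_mult_at_bot[OF tendsto_const]) (auto intro: filterlim_ident)
  then have lim: "((\<lambda>t. - exp (- c * t) / c) \<longlongrightarrow> 0) at_top"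
    using tendsto_divide[of "\<lambda>t. - exp (- c * t)" 0 at_top "\<lambda>_. c" c] tendsto_minus[of "\<lambda>t. exp (- c * t)" 0 at_top] assms by simp
  have "(\<integral>\<^sup>+t. ennreal (exp (- c * t)) * indicator {r..} t \<partial>lborel) = ennreal (0 - (- exp (- c * r) / c))"
    using assms by (intro nn_integral_FTC_atLeast[OF _ _ _ lim]) (auto intro!: derivative_eq_intros)
  then show ?thesis by simp
qed

text \<open>One insertion of the inequality into itself convolves the kernel with itself, and the
  singular kernel becomes the constant \<open>b\<close>. What remains is an ordinary Gronwall
  inequality with integrable forcing, solved by integrating against an exponential weight.
  \<open>R\<close> is fixed before \<open>F\<close> and \<open>N\<close>, so it depends only on
  \<open>A\<close>, \<open>B\<close> and \<open>T\<close>; the a priori bound \<open>N\<close> only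
  ensures finiteness.\<close>

lemma abel_gronwall:
  assumes A: "A \<ge> 0" and B: "B \<ge> 0" and T: "T > (0::real)"
  obtains R :: ennreal where "R < \<infinity>"
    and "\<And>F N. F \<in> borel_measurable borel \<Longrightarrow> N < \<infinity> \<Longrightarrow> (\<And>t. t \<in> {0<..T} \<Longrightarrow> F t \<le> N) \<Longrightarrow>
      (\<And>t. t \<in> {0<..T} \<Longrightarrow> F t \<le> ennreal (A / sqrt t) + ennreal B * (\<integral>\<^sup>+s. abel_kernel t s * F s \<partial>lborel)) \<Longrightarrow>
      F T \<le> R"
proof -
  define b where "b = Beta (1/2) (1/2 :: real)"
  have b: "b \<ge> 0" unfolding b_def by (simp add: Beta_def Gamma_real_nonneg)
  \<comment> \<open>The iterated inequality has the constant \<open>B\<^sup>2 * b\<close>; the added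
    1 makes \<open>c\<close> positive, so that it can be divided by.\<close>
  define c where "c = B\<^sup>2 * b + 1"
  have c: "c > 0" using b by (simp add: c_def add_nonneg_pos)
  \<comment> \<open>The forcing A / sqrt s, convolved with the kernel and multiplied by
    \<open>B\<close>.\<close>
  define D where "D = B * A * b"
  have D: "D \<ge> 0" using A B b by (simp add: D_def)
  \<comment> \<open>Total forcing over (0, T]. It is finite because on (0, T) the singularity 1 /
    sqrt t is at most sqrt T times the convolution integrand
    \<open>abel_kernel T t / sqrt t\<close>, whose integral is \<open>b\<close>.\<close>
  define a where "a = (\<integral>\<^sup>+t. indicator {0<..T} t * (ennreal (A / sqrt t) + ennreal D) \<partial>lborel)"
  have conv: "(\<integral>\<^sup>+s. abel_kernel t s * ennreal (1 / sqrt s) \<partial>lborel) = ennreal b" if "t > 0" for t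
    using abel_kernel_convolution[OF that] by (simp add: abel_kernel_def b_def)
  have "(\<integral>\<^sup>+t. indicator {0<..T} t * ennreal (1 / sqrt t) \<partial>lborel)
      = (\<integral>\<^sup>+t. indicator {0<..<T} t * ennreal (1 / sqrt t) \<partial>lborel)"
  proof (intro nn_integral_cong_AE)
    show "AE t in lborel. indicator {0<..T} t * ennreal (1 / sqrt t) = indicator {0<..<T} t * ennreal (1 / sqrt t)"
      using AE_lborel_singleton[of T] by eventually_elim (auto simp: indicator_def)
  qed
  also have "\<dots> \<le> (\<integral>\<^sup>+t. ennreal (sqrt T) * (abel_kernel T t * ennreal (1 / sqrt t)) \<partial>lborel)"
  proof (intro nn_integral_mono)
    fix t :: real
    have "1 / sqrt t \<le> sqrt T * (1 / sqrt (T - t) * (1 / sqrt t))" if "t \<in> {0<..<T}"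
    proof -
      have "1 \<le> sqrt T * (1 / sqrt (T - t))" using that by (simp add: field_simps)
      from mult_right_mono[OF this, of "1 / sqrt t"] that show ?thesis by simp
    qed
    then show "indicator {0<..<T} t * ennreal (1 / sqrt t) \<le> ennreal (sqrt T) * (abel_kernel T t * ennreal (1 / sqrt t))"
      using T by (auto simp: abel_kernel_def indicator_def ennreal_mult[symmetric] simp del: ennreal_le_iff intro!: ennreal_leI)
  qed
  also have "\<dots> = ennreal (sqrt T) * ennreal b"
    using conv[OF T] by (simp add: nn_integral_cmult)
  finally have inv_sqrt: "(\<integral>\<^sup>+t. indicator {0<..T} t * ennreal (1 / sqrt t) \<partial>lborel) < \<infinity>"
    by (rule le_less_trans) (simp add: ennreal_mult_less_top)
  have "a = (\<integral>\<^sup>+t. ennreal A * (indicator {0<..T} t * ennreal (1 / sqrt t)) + ennreal D * indicator {0<..T} t \<partial>lborel)"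
    unfolding a_def using A by (intro nn_integral_cong) (auto simp: indicator_def ennreal_mult[symmetric])
  also have "\<dots> = ennreal A * (\<integral>\<^sup>+t. indicator {0<..T} t * ennreal (1 / sqrt t) \<partial>lborel) + ennreal D * ennreal T"
    using T by (simp add: nn_integral_add nn_integral_cmult)
  also have "\<dots> < \<infinity>" using inv_sqrt by (simp add: ennreal_mult_less_top)
  finally have a: "a < \<infinity>" .
  \<comment> \<open>The iterated inequality at time \<open>T\<close>, where the integral of
    \<open>F\<close> is bounded by twice \<open>a\<close>, times the exponential that compensates
    the decaying weight.\<close>
  define R where "R = ennreal (A / sqrt T) + ennreal D + ennreal c * (ennreal (exp (2 * c * T)) * (2 * a))"
  show ?thesis
  proof
    show "R < \<infinity>" using a by (simp add: R_def ennreal_mult_less_top)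
    fix F :: "real \<Rightarrow> ennreal" and N
    assume [measurable]: "F \<in> borel_measurable borel" and N: "N < \<infinity>" "\<And>t. t \<in> {0<..T} \<Longrightarrow> F t \<le> N"
      and F: "\<And>t. t \<in> {0<..T} \<Longrightarrow> F t \<le> ennreal (A / sqrt t) + ennreal B * (\<integral>\<^sup>+s. abel_kernel t s * F s \<partial>lborel)"
    have J: "(\<integral>\<^sup>+s. abel_kernel t s * F s \<partial>lborel)
        \<le> ennreal (A * b) + ennreal (B * b) * (\<integral>\<^sup>+r. indicator {0<..<t} r * F r \<partial>lborel)" if t: "t \<in> {0<..T}" for t
    proof -
      have "(\<integral>\<^sup>+s. abel_kernel t s * F s \<partial>lborel)
          \<le> (\<integral>\<^sup>+s. abel_kernel t s * (ennreal (A / sqrt s) + ennreal B * (\<integral>\<^sup>+r. abel_kernel s r * F r \<partial>lborel)) \<partial>lborel)"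
      proof (intro nn_integral_mono)
        fix s
        show "abel_kernel t s * F s \<le> abel_kernel t s * (ennreal (A / sqrt s) + ennreal B * (\<integral>\<^sup>+r. abel_kernel s r * F r \<partial>lborel))"
          using F[of s] t by (cases "s \<in> {0<..<t}") (auto simp: abel_kernel_def intro!: mult_left_mono)
      qed
      also have "\<dots> = (\<integral>\<^sup>+s. ennreal A * (abel_kernel t s * ennreal (1 / sqrt s)) + ennreal B * (\<integral>\<^sup>+r. abel_kernel t s * (abel_kernel s r * F r) \<partial>lborel) \<partial>lborel)"
      proof (intro nn_integral_cong)
        fix s :: real
        have "abel_kernel t s * ennreal (A / sqrt s) = ennreal A * (abel_kernel t s * ennreal (1 / sqrt s))"
          using A by (cases "s > 0") (auto simp: abel_kernel_def ennreal_mult'[symmetric] mult.left_commute[of "ennreal A"])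
        moreover have "(\<integral>\<^sup>+r. abel_kernel t s * (abel_kernel s r * F r) \<partial>lborel) = abel_kernel t s * (\<integral>\<^sup>+r. abel_kernel s r * F r \<partial>lborel)"
          by (intro nn_integral_cmult) measurable
        ultimately show "abel_kernel t s * (ennreal (A / sqrt s) + ennreal B * (\<integral>\<^sup>+r. abel_kernel s r * F r \<partial>lborel))
          = ennreal A * (abel_kernel t s * ennreal (1 / sqrt s)) + ennreal B * (\<integral>\<^sup>+r. abel_kernel t s * (abel_kernel s r * F r) \<partial>lborel)"
          by (simp only: distrib_left mult.left_commute)
      qed
      also have "\<dots> = ennreal A * (\<integral>\<^sup>+s. abel_kernel t s * ennreal (1 / sqrt s) \<partial>lborel)
          + ennreal B * (\<integral>\<^sup>+s. (\<integral>\<^sup>+r. abel_kernel t s * (abel_kernel s r * F r) \<partial>lborel) \<partial>lborel)"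
        by (simp add: nn_integral_add nn_integral_cmult)
      also have "(\<integral>\<^sup>+s. (\<integral>\<^sup>+r. abel_kernel t s * (abel_kernel s r * F r) \<partial>lborel) \<partial>lborel)
          = (\<integral>\<^sup>+r. (\<integral>\<^sup>+s. abel_kernel t s * (abel_kernel s r * F r) \<partial>lborel) \<partial>lborel)"
        by (rule lborel_pair.Fubini') measurable
      also have "\<dots> = (\<integral>\<^sup>+r. ennreal b * (indicator {0<..<t} r * F r) \<partial>lborel)"
      proof (intro nn_integral_cong)
        fix r :: real
        have "(\<integral>\<^sup>+s. abel_kernel t s * (abel_kernel s r * F r) \<partial>lborel)
            = (\<integral>\<^sup>+s. (indicator {0<..<t} r * F r) * (indicator {r<..<t} s * ennreal (1 / sqrt (t - s)) * ennreal (1 / sqrt (s - r))) \<partial>lborel)"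
          by (intro nn_integral_cong) (auto simp: abel_kernel_def indicator_def mult_ac)
        also have "\<dots> = (indicator {0<..<t} r * F r) * (\<integral>\<^sup>+s. (indicator {r<..<t} s * ennreal (1 / sqrt (t - s)) * ennreal (1 / sqrt (s - r))) \<partial>lborel)"
          by (intro nn_integral_cmult) measurable
        also have "\<dots> = ennreal b * (indicator {0<..<t} r * F r)"
          using abel_kernel_convolution[of r t] by (cases "r < t") (auto simp: b_def mult_ac)
        finally show "(\<integral>\<^sup>+s. abel_kernel t s * (abel_kernel s r * F r) \<partial>lborel) = ennreal b * (indicator {0<..<t} r * F r)" .
      qed
      also have "\<dots> = ennreal b * (\<integral>\<^sup>+r. indicator {0<..<t} r * F r \<partial>lborel)"
        by (intro nn_integral_cmult) measurable
      finally show ?thesis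
        using conv[of t] t A B b by (simp add: ennreal_mult mult.assoc)
    qed
    have F2: "F t \<le> ennreal (A / sqrt t) + ennreal D + ennreal c * (\<integral>\<^sup>+r. indicator {0<..<t} r * F r \<partial>lborel)"
      if t: "t \<in> {0<..T}" for t
    proof -
      let ?I = "\<integral>\<^sup>+r. indicator {0<..<t} r * F r \<partial>lborel"
      have "F t \<le> ennreal (A / sqrt t) + ennreal B * (ennreal (A * b) + ennreal (B * b) * ?I)"
        by (intro order_trans[OF F[OF t]] add_left_mono mult_left_mono J t) auto
      also have "ennreal B * (ennreal (A * b) + ennreal (B * b) * ?I) = ennreal D + ennreal (B\<^sup>2 * b) * ?I"
        using A B b by (simp add: distrib_left D_def ennreal_mult[symmetric] mult.assoc[symmetric] power2_eq_square)
      also have "\<dots> \<le> ennreal D + ennreal c * ?I"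
        by (intro add_left_mono mult_right_mono ennreal_leI) (auto simp: c_def)
      finally show ?thesis by (simp add: add.assoc)
    qed
    define K where "K t r = indicator {0<..T} t * ennreal (exp (- (2 * c) * t)) * (indicator {0<..<t} r * F r)" for t r
    have [measurable]: "(\<lambda>(t, r). K t r) \<in> borel_measurable (borel \<Otimes>\<^sub>M borel)"
    proof -
      have "(\<lambda>(t, r). K t r) = (\<lambda>(t, r). (if 0 < t \<and> t \<le> T \<and> 0 < r \<and> r < t then ennreal (exp (- (2 * c) * t)) * F r else 0))"
        by (auto simp: K_def indicator_def fun_eq_iff)
      then show ?thesis by simp
    qed
    \<comment> \<open>The rate 2c is chosen so that integrating the weight over t \<ge> r produces 1
      / (2c): after Fubini the double integral contributes at most half of \<open>\<Phi>\<close>.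
      Absorbing that half into the left-hand side requires \<open>\<Phi>\<close> to be finite, and
      this is where \<open>N\<close> enters.\<close>
    define \<Phi> where "\<Phi> = (\<integral>\<^sup>+t. indicator {0<..T} t * (ennreal (exp (- (2 * c) * t)) * F t) \<partial>lborel)"
    have "\<Phi> \<le> (\<integral>\<^sup>+t. N * indicator {0<..T} t \<partial>lborel)"
      unfolding \<Phi>_def
    proof (intro nn_integral_mono)
      fix t
      have "ennreal (exp (- (2 * c) * t)) * F t \<le> 1 * N" if "t \<in> {0<..T}"
        using that c N(2)[OF that] by (intro mult_mono) (auto intro!: ennreal_le_1[THEN iffD2])
      then show "indicator {0<..T} t * (ennreal (exp (- (2 * c) * t)) * F t) \<le> N * indicator {0<..T} t"
        by (auto simp: indicator_def)
    qed
    also have "\<dots> < \<infinity>" using N(1) T by (simp add: nn_integral_cmult ennreal_mult_less_top)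
    finally have fin: "\<Phi> < \<infinity>" .
    have "\<Phi> \<le> (\<integral>\<^sup>+t. indicator {0<..T} t * (ennreal (A / sqrt t) + ennreal D)
        + ennreal c * (\<integral>\<^sup>+r. K t r \<partial>lborel) \<partial>lborel)"
      unfolding \<Phi>_def
    proof (intro nn_integral_mono)
      fix t :: real
      let ?I = "\<integral>\<^sup>+r. indicator {0<..<t} r * F r \<partial>lborel"
      have I: "(\<integral>\<^sup>+r. K t r \<partial>lborel)
          = indicator {0<..T} t * ennreal (exp (- (2 * c) * t)) * ?I"
        unfolding K_def by (intro nn_integral_cmult) measurable
      have "ennreal (exp (- (2 * c) * t)) * F t
          \<le> (ennreal (A / sqrt t) + ennreal D) + ennreal c * (ennreal (exp (- (2 * c) * t)) * ?I)" if t: "t \<in> {0<..T}"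
      proof -
        have "ennreal (exp (- (2 * c) * t)) * F t
            \<le> ennreal (exp (- (2 * c) * t)) * ((ennreal (A / sqrt t) + ennreal D) + ennreal c * ?I)"
          by (intro mult_left_mono F2 t) auto
        also have "\<dots> = ennreal (exp (- (2 * c) * t)) * (ennreal (A / sqrt t) + ennreal D) + ennreal c * (ennreal (exp (- (2 * c) * t)) * ?I)"
          by (simp add: distrib_left mult_ac)
        also have "ennreal (exp (- (2 * c) * t)) * (ennreal (A / sqrt t) + ennreal D) \<le> 1 * (ennreal (A / sqrt t) + ennreal D)"
          using t c by (intro mult_right_mono) (auto intro!: ennreal_le_1[THEN iffD2])
        finally show ?thesis by (simp add: add_right_mono)
      qed
      then show "indicator {0<..T} t * (ennreal (exp (- (2 * c) * t)) * F t) \<le> indicator {0<..T} t * (ennreal (A / sqrt t) + ennreal D)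
        + ennreal c * (\<integral>\<^sup>+r. K t r \<partial>lborel)"
        unfolding I by (cases "t \<in> {0<..T}") simp_all
    qed
    also have "\<dots> = a + (\<integral>\<^sup>+t. ennreal c * (\<integral>\<^sup>+r. K t r \<partial>lborel) \<partial>lborel)"
      unfolding a_def by (rule nn_integral_add) measurable
    also have "(\<integral>\<^sup>+t. ennreal c * (\<integral>\<^sup>+r. K t r \<partial>lborel) \<partial>lborel) = ennreal c * (\<integral>\<^sup>+t. (\<integral>\<^sup>+r. K t r \<partial>lborel) \<partial>lborel)"
      by (rule nn_integral_cmult) measurable
    also have "(\<integral>\<^sup>+t. (\<integral>\<^sup>+r. K t r \<partial>lborel) \<partial>lborel)
        = (\<integral>\<^sup>+r. (\<integral>\<^sup>+t. K t r \<partial>lborel) \<partial>lborel)"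
      by (rule lborel_pair.Fubini') measurable
    also have "\<dots> \<le> (\<integral>\<^sup>+r. ennreal (1 / (2 * c)) * (indicator {0<..T} r * (ennreal (exp (- (2 * c) * r)) * F r)) \<partial>lborel)"
    proof (intro nn_integral_mono)
      fix r :: real
      have "(\<integral>\<^sup>+t. K t r \<partial>lborel)
          \<le> (\<integral>\<^sup>+t. indicator {0<..T} r * F r * (ennreal (exp (- (2 * c) * t)) * indicator {r..} t) \<partial>lborel)"
        by (intro nn_integral_mono) (auto simp: K_def indicator_def mult_ac)
      also have "\<dots> = indicator {0<..T} r * F r * (\<integral>\<^sup>+t. (ennreal (exp (- (2 * c) * t)) * indicator {r..} t) \<partial>lborel)"
        by (intro nn_integral_cmult) measurable
      also have "(\<integral>\<^sup>+t. (ennreal (exp (- (2 * c) * t)) * indicator {r..} t) \<partial>lborel) = ennreal (1 / (2 * c)) * ennreal (exp (- (2 * c) * r))"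
        using c by (subst nn_integral_exp_Ici) (auto simp: ennreal_mult[symmetric])
      finally show "(\<integral>\<^sup>+t. K t r \<partial>lborel)
          \<le> ennreal (1 / (2 * c)) * (indicator {0<..T} r * (ennreal (exp (- (2 * c) * r)) * F r))"
        by (simp add: mult_ac)
    qed
    also have "\<dots> = ennreal (1 / (2 * c)) * \<Phi>"
      unfolding \<Phi>_def by (intro nn_integral_cmult) measurable
    finally have "\<Phi> \<le> a + ennreal c * (ennreal (1 / (2 * c)) * \<Phi>)"
      by (simp add: add_left_mono mult_left_mono)
    also have "ennreal c * (ennreal (1 / (2 * c)) * \<Phi>) = ennreal (1/2) * \<Phi>"
      using c by (simp add: mult.assoc[symmetric] ennreal_mult[symmetric])
    finally have "\<Phi> \<le> a + ennreal (1/2) * \<Phi>" .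
    moreover obtain p where p: "\<Phi> = ennreal p" "p \<ge> 0" using fin by (cases \<Phi>) auto
    moreover obtain q where q: "a = ennreal q" "q \<ge> 0" using a by (cases a) auto
    moreover have "ennreal q + ennreal (1/2) * ennreal p = ennreal (q + 1/2 * p)"
      using p(2) q(2) by (simp only: ennreal_mult' ennreal_plus)
    ultimately have "p \<le> q + 1/2 * p"
      by (metis add_nonneg_nonneg ennreal_le_iff mult_nonneg_nonneg zero_le_divide_1_iff zero_le_numeral)
    then have "ennreal p \<le> ennreal (2 * q)" by (intro ennreal_leI) simp
    then have \<Phi>: "\<Phi> \<le> 2 * a"
      using p q by (simp add: ennreal_mult')
    have "(\<integral>\<^sup>+r. indicator {0<..<T} r * F r \<partial>lborel) \<le> (\<integral>\<^sup>+r. ennreal (exp (2 * c * T)) * (indicator {0<..T} r * (ennreal (exp (- (2 * c) * r)) * F r)) \<partial>lborel)"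
    proof (intro nn_integral_mono)
      fix r :: real
      have "1 * F r \<le> ennreal (exp (2 * c * T)) * ennreal (exp (- (2 * c) * r)) * F r" if "r \<in> {0<..<T}"
        using that c by (intro mult_right_mono) (auto simp: ennreal_mult[symmetric] exp_add[symmetric])
      then show "indicator {0<..<T} r * F r \<le> ennreal (exp (2 * c * T)) * (indicator {0<..T} r * (ennreal (exp (- (2 * c) * r)) * F r))"
        by (auto simp: indicator_def mult_ac)
    qed
    also have "\<dots> = ennreal (exp (2 * c * T)) * \<Phi>"
      unfolding \<Phi>_def by (intro nn_integral_cmult) measurable
    also have "\<dots> \<le> ennreal (exp (2 * c * T)) * (2 * a)"
      by (intro mult_left_mono \<Phi>) auto
    finally have I: "(\<integral>\<^sup>+r. indicator {0<..<T} r * F r \<partial>lborel) \<le> ennreal (exp (2 * c * T)) * (2 * a)" .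
    have "F T \<le> ennreal (A / sqrt T) + ennreal D + ennreal c * (\<integral>\<^sup>+r. indicator {0<..<T} r * F r \<partial>lborel)"
      using T by (intro F2) auto
    also have "\<dots> \<le> R"
      unfolding R_def by (intro add_left_mono mult_left_mono I) auto
    finally show "F T \<le> R" .
  qed
qed

section \<open>Kernel and weight estimates\<close>

lemma heat_kernel_measurable [measurable]: "heat_kernel \<theta> r \<in> borel_measurable borel"
  unfolding heat_kernel_def by measurable

lemma heat_kernel_nonneg: "0 \<le> heat_kernel \<theta> r a"
  by (simp add: heat_kernel_def)

lemma heat_kernel_normal_density:
  assumes "\<theta> > 0" "r > 0"
  shows "heat_kernel \<theta> r a = normal_density 0 (sqrt (\<theta> * r)) a"
proof -
  have "(2 * pi * \<theta> * r) powr (-1/2) = 1 / sqrt (2 * pi * \<theta> * r)"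
    using assms by (simp add: powr_minus powr_half_sqrt field_simps)
  then show ?thesis
    using assms by (simp add: heat_kernel_def normal_density_def mult.assoc)
qed

lemma nn_integral_shift:
  assumes [measurable]: "f \<in> borel_measurable borel"
  shows "(\<integral>\<^sup>+x. f (x - y) \<partial>lborel) = (\<integral>\<^sup>+x. f x \<partial>(lborel :: real measure))"
  using nn_integral_real_affine[of f 1 "-y"] by simp

text \<open>Completing the square with variance s = \<theta> r gives |z| - z^2 / (2s) \<le> s / 2,
  so one factor of the kernel, times exp |z|, is bounded by the constant on the right. The other
  factor is a probability density. The order 1 / sqrt r is the source of the Abel kernel.\<close>

lemma heat_kernel_square_exp_bound:
  assumes \<theta>: "\<theta> > 0" and r: "0 < r" "r \<le> T"
  shows "(\<integral>\<^sup>+z. ennreal (exp \<bar>z\<bar> * (heat_kernel \<theta> r z)\<^sup>2) \<partial>lborel)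
    \<le> ennreal (exp (\<theta> * T / 2) / sqrt (2 * pi * \<theta>) / sqrt r)"
proof -
  define C where "C = exp (\<theta> * T / 2) / sqrt (2 * pi * \<theta>) / sqrt r"
  define s where "s = \<theta> * r"
  have s: "s > 0" using \<theta> r by (simp add: s_def)
  define g where "g = normal_density 0 (sqrt s)"
  have g: "heat_kernel \<theta> r z = g z" for z
    using heat_kernel_normal_density[OF \<theta> r(1)] by (simp add: g_def s_def)
  have "exp \<bar>z\<bar> * (g z)\<^sup>2 \<le> C * g z" for z
  proof -
    have "\<bar>z\<bar> \<le> s / 2 + z\<^sup>2 / (2 * s)"
    proof -
      have "0 \<le> (\<bar>z\<bar> - s)\<^sup>2" by simp
      then have "2 * s * \<bar>z\<bar> \<le> s\<^sup>2 + z\<^sup>2" by (simp add: power2_diff mult_ac add_ac)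
      then show ?thesis using s by (simp add: field_simps power2_eq_square)
    qed
    moreover have "s \<le> \<theta> * T" unfolding s_def using \<theta> r by simp
    ultimately have "\<bar>z\<bar> + - z\<^sup>2 / (2 * s) \<le> \<theta> * T / 2" by simp
    then have "exp (\<bar>z\<bar> + - z\<^sup>2 / (2 * s)) \<le> exp (\<theta> * T / 2)" by simp
    then have "exp \<bar>z\<bar> * exp (- z\<^sup>2 / (2 * s)) / sqrt (2 * pi * s) \<le> exp (\<theta> * T / 2) / sqrt (2 * pi * s)"
      using s unfolding exp_add by (intro divide_right_mono) auto
    also have "\<dots> = C"
      using \<theta> r by (simp add: C_def s_def real_sqrt_mult)
    finally have "exp \<bar>z\<bar> * g z \<le> C"
      using s by (simp add: g_def normal_density_def)
    from mult_right_mono[OF this, of "g z"] show ?thesis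
      by (simp add: g_def power2_eq_square mult_ac)
  qed
  moreover have C: "C \<ge> 0" using \<theta> r by (simp add: C_def)
  ultimately have "(\<integral>\<^sup>+z. ennreal (exp \<bar>z\<bar> * (heat_kernel \<theta> r z)\<^sup>2) \<partial>lborel) \<le> (\<integral>\<^sup>+z. ennreal C * ennreal (g z) \<partial>lborel)"
    by (intro nn_integral_mono) (auto simp: g ennreal_mult'[symmetric] intro!: ennreal_leI)
  also have "\<dots> = ennreal C * (\<integral>\<^sup>+z. ennreal (g z) \<partial>lborel)"
    by (intro nn_integral_cmult) (simp add: g_def)
  also have "(\<integral>\<^sup>+z. ennreal (g z) \<partial>lborel) = 1"
    using s by (subst nn_integral_eq_integral) (auto simp: g_def)
  finally show ?thesis by (simp add: C_def)
qed

lemma nn_integral_exp_abs: "(\<integral>\<^sup>+x. ennreal (exp (- \<bar>x\<bar>)) \<partial>(lborel :: real measure)) \<le> 2"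
proof -
  have 1: "(\<integral>\<^sup>+x. ennreal (exp (- x)) * indicator {0..} x \<partial>(lborel :: real measure)) = 1"
    using nn_intergal_power_times_exp_Ici[of 0] by simp
  have 2: "(\<integral>\<^sup>+x. ennreal (exp x) * indicator {0..} (- x) \<partial>(lborel :: real measure)) = 1"
    using 1 nn_integral_real_affine[of "\<lambda>x. ennreal (exp (- x)) * indicator {0..} x" "-1" 0] by simp
  have "(\<integral>\<^sup>+x. ennreal (exp (- \<bar>x\<bar>)) \<partial>(lborel :: real measure))
      \<le> (\<integral>\<^sup>+x. ennreal (exp (- x)) * indicator {0..} x + ennreal (exp x) * indicator {0..} (- x) \<partial>lborel)"
    by (intro nn_integral_mono) (auto simp: indicator_def)
  also have "\<dots> = (\<integral>\<^sup>+x. ennreal (exp (- x)) * indicator {0..} x \<partial>(lborel :: real measure))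
      + (\<integral>\<^sup>+x. ennreal (exp x) * indicator {0..} (- x) \<partial>lborel)"
    by (intro nn_integral_add) measurable
  finally show ?thesis using 1 2 by simp
qed

section \<open>The envelope of the initial function and the cutoff weights\<close>

locale decay_profile =
  fixes u0 :: "real \<Rightarrow> real"
  assumes u0_int: "integrable lborel u0" and u0_nonneg: "\<And>x. 0 \<le> u0 x"
begin

lemma u0_measurable [measurable]: "u0 \<in> borel_measurable borel"
  using u0_int by auto

text \<open>The \<open>v\<close> of the overview.\<close>

definition envelope :: "real \<Rightarrow> real" where
  "envelope x = (LINT y|lborel. exp (- \<bar>x - y\<bar>) * u0 y) + exp (- \<bar>x\<bar>)"

lemma exp_u0_integrable: "integrable lborel (\<lambda>y. exp (- \<bar>x - y\<bar>) * u0 y)"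
  by (rule Bochner_Integration.integrable_bound[OF u0_int]) (auto simp: abs_mult mult_right_le_one_le mult_left_le_one_le)

lemma envelope_pos: "0 < envelope x"
  unfolding envelope_def by (intro add_nonneg_pos Bochner_Integration.integral_nonneg) (auto simp: u0_nonneg)

lemma envelope_measurable [measurable]: "envelope \<in> borel_measurable borel"
  unfolding envelope_def by measurable

lemma nn_integral_exp_u0:
  "(\<integral>\<^sup>+y. ennreal (exp (- \<bar>x - y\<bar>) * u0 y) \<partial>lborel) = ennreal (LINT y|lborel. exp (- \<bar>x - y\<bar>) * u0 y)"
  by (intro nn_integral_eq_integral exp_u0_integrable) (auto simp: u0_nonneg)

lemma nn_integral_exp_u0_le: "(\<integral>\<^sup>+y. ennreal (exp (- \<bar>x - y\<bar>) * u0 y) \<partial>lborel) \<le> ennreal (envelope x)"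
  unfolding nn_integral_exp_u0 envelope_def by (intro ennreal_leI) simp

text \<open>By the triangle inequality, exp (- |y - z|) is at most exp |x - y| times exp (- |x -
  z|). Integration against the nonnegative \<open>u0\<close> preserves the factor, and z = 0 treats
  the added exponential.\<close>

lemma envelope_harnack: "envelope y \<le> exp \<bar>x - y\<bar> * envelope x"
proof -
  have e: "exp (- \<bar>y - z\<bar>) \<le> exp \<bar>x - y\<bar> * exp (- \<bar>x - z\<bar>)" for z
    unfolding exp_add[symmetric] by simp
  have "(LINT z|lborel. exp (- \<bar>y - z\<bar>) * u0 z) \<le> (LINT z|lborel. exp \<bar>x - y\<bar> * (exp (- \<bar>x - z\<bar>) * u0 z))"
    using mult_right_mono[OF e u0_nonneg]
    by (intro integral_mono exp_u0_integrable integrable_mult_right) (auto simp: mult.assoc)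
  then show ?thesis
    using e[of 0] by (simp add: envelope_def distrib_left)
qed

text \<open>The exponential has mass at most 2, so by Tonelli the integral is at most twice the mass
  of \<open>u0\<close>, plus 2.\<close>

lemma envelope_integrable: "(\<integral>\<^sup>+x. ennreal (envelope x) \<partial>lborel) < \<infinity>"
proof -
  have "(\<integral>\<^sup>+x. ennreal (envelope x) \<partial>lborel) = (\<integral>\<^sup>+x. (\<integral>\<^sup>+y. ennreal (exp (- \<bar>x - y\<bar>) * u0 y) \<partial>lborel) + ennreal (exp (- \<bar>x\<bar>)) \<partial>lborel)"
    unfolding envelope_def nn_integral_exp_u0
    by (intro nn_integral_cong ennreal_plus Bochner_Integration.integral_nonneg) (auto simp: u0_nonneg)
  also have "\<dots> = (\<integral>\<^sup>+x. (\<integral>\<^sup>+y. ennreal (exp (- \<bar>x - y\<bar>) * u0 y) \<partial>lborel) \<partial>lborel) + (\<integral>\<^sup>+x. ennreal (exp (- \<bar>x\<bar>)) \<partial>lborel)"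
    by (intro nn_integral_add) measurable
  also have "(\<integral>\<^sup>+x. (\<integral>\<^sup>+y. ennreal (exp (- \<bar>x - y\<bar>) * u0 y) \<partial>lborel) \<partial>lborel)
      = (\<integral>\<^sup>+y. (\<integral>\<^sup>+x. ennreal (exp (- \<bar>x - y\<bar>) * u0 y) \<partial>lborel) \<partial>lborel)"
    by (rule lborel_pair.Fubini') measurable
  also have "\<dots> = (\<integral>\<^sup>+y. ennreal (u0 y) * (\<integral>\<^sup>+x. ennreal (exp (- \<bar>x\<bar>)) \<partial>(lborel :: real measure)) \<partial>lborel)"
  proof (intro nn_integral_cong)
    fix y
    have "(\<integral>\<^sup>+x. ennreal (exp (- \<bar>x - y\<bar>) * u0 y) \<partial>lborel) = (\<integral>\<^sup>+x. ennreal (u0 y) * ennreal (exp (- \<bar>x - y\<bar>)) \<partial>lborel)"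
      using u0_nonneg by (intro nn_integral_cong) (simp add: ennreal_mult mult.commute)
    also have "\<dots> = ennreal (u0 y) * (\<integral>\<^sup>+x. ennreal (exp (- \<bar>x - y\<bar>)) \<partial>lborel)"
      by (intro nn_integral_cmult) measurable
    also have "(\<integral>\<^sup>+x. ennreal (exp (- \<bar>x - y\<bar>)) \<partial>lborel) = (\<integral>\<^sup>+x. ennreal (exp (- \<bar>x\<bar>)) \<partial>(lborel :: real measure))"
      by (rule nn_integral_shift) measurable
    finally show "(\<integral>\<^sup>+x. ennreal (exp (- \<bar>x - y\<bar>) * u0 y) \<partial>lborel) = ennreal (u0 y) * (\<integral>\<^sup>+x. ennreal (exp (- \<bar>x\<bar>)) \<partial>(lborel :: real measure))" .
  qed
  also have "\<dots> \<le> (\<integral>\<^sup>+y. ennreal (u0 y) * 2 \<partial>lborel)"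
    by (intro nn_integral_mono mult_left_mono nn_integral_exp_abs) auto
  also have "\<dots> = ennreal (LINT y|lborel. u0 y) * 2"
    by (simp add: nn_integral_multc nn_integral_eq_integral u0_int u0_nonneg)
  finally have "(\<integral>\<^sup>+x. ennreal (envelope x) \<partial>lborel) \<le> ennreal (LINT y|lborel. u0 y) * 2 + (\<integral>\<^sup>+x. ennreal (exp (- \<bar>x\<bar>)) \<partial>(lborel :: real measure))"
    by (simp add: add_right_mono)
  also have "\<dots> \<le> ennreal (LINT y|lborel. u0 y) * 2 + 2"
    by (intro add_left_mono nn_integral_exp_abs)
  also have "\<dots> < \<infinity>" by (simp add: ennreal_mult_less_top)
  finally show ?thesis .
qed

text \<open>Cutting \<open>1 / envelope\<close> off by an integrable weight makes the weighted moments finite a priori, without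
  spoiling the comparison of neighbouring values.\<close>

definition cutoff :: "nat \<Rightarrow> real \<Rightarrow> real" where
  "cutoff n x = min (1 / envelope x) (real n * exp (- \<bar>x\<bar>))"

lemma cutoff_measurable [measurable]: "cutoff n \<in> borel_measurable borel"
  unfolding cutoff_def by measurable

lemma cutoff_nonneg: "0 \<le> cutoff n x"
  using envelope_pos[of x] by (simp add: cutoff_def)

text \<open>Both functions under the minimum vary by at most the factor exp |x - y|, and this
  property is inherited by minima.\<close>

lemma cutoff_harnack: "cutoff n x \<le> exp \<bar>x - y\<bar> * cutoff n y"
proof -
  have "1 / envelope x \<le> exp \<bar>x - y\<bar> * (1 / envelope y)"
    using envelope_harnack[of y x] envelope_pos[of x] envelope_pos[of y] by (simp add: field_simps)
  moreover have "exp (- \<bar>x\<bar>) \<le> exp \<bar>x - y\<bar> * exp (- \<bar>y\<bar>)"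
    unfolding exp_add[symmetric] by simp
  then have "real n * exp (- \<bar>x\<bar>) \<le> exp \<bar>x - y\<bar> * (real n * exp (- \<bar>y\<bar>))"
    using mult_left_mono[of "exp (- \<bar>x\<bar>)" "exp \<bar>x - y\<bar> * exp (- \<bar>y\<bar>)" "real n"] by (simp add: mult_ac)
  ultimately show ?thesis
    by (auto simp: cutoff_def min_mult_distrib_left min_def)
qed

lemma cutoff_integrable: "(\<integral>\<^sup>+x. ennreal (cutoff n x) \<partial>lborel) < \<infinity>"
proof -
  have "(\<integral>\<^sup>+x. ennreal (cutoff n x) \<partial>lborel) \<le> (\<integral>\<^sup>+x. ennreal (real n) * ennreal (exp (- \<bar>x\<bar>)) \<partial>lborel)"
    by (intro nn_integral_mono) (auto simp: cutoff_def ennreal_mult[symmetric] intro!: ennreal_leI)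
  also have "\<dots> = ennreal (real n) * (\<integral>\<^sup>+x. ennreal (exp (- \<bar>x\<bar>)) \<partial>(lborel :: real measure))"
    by (intro nn_integral_cmult) measurable
  also have "\<dots> \<le> ennreal (real n) * 2"
    by (intro mult_left_mono nn_integral_exp_abs) auto
  also have "\<dots> < \<infinity>" by (simp add: ennreal_mult_less_top)
  finally show ?thesis .
qed

lemma cutoff_mono: "incseq (\<lambda>n. ennreal (cutoff n x))"
proof (intro incseq_SucI ennreal_leI)
  fix n
  have "real n * exp (- \<bar>x\<bar>) \<le> real (Suc n) * exp (- \<bar>x\<bar>)" by (intro mult_right_mono) auto
  then show "cutoff n x \<le> cutoff (Suc n) x" unfolding cutoff_def by linarith
qed

lemma cutoff_SUP: "(SUP n. ennreal (cutoff n x)) = ennreal (1 / envelope x)"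
proof (rule antisym)
  show "(SUP n. ennreal (cutoff n x)) \<le> ennreal (1 / envelope x)"
    by (intro SUP_least ennreal_leI) (simp add: cutoff_def)
  \<comment> \<open>The supremum is attained: for this \<open>n\<close> the minimum is already
    \<open>1 / envelope x\<close>.\<close>
  obtain n :: nat where n: "1 / envelope x * exp \<bar>x\<bar> \<le> real n" using real_arch_simple by blast
  have "1 / envelope x = 1 / envelope x * exp \<bar>x\<bar> * exp (- \<bar>x\<bar>)" by (simp add: exp_minus)
  also have "\<dots> \<le> real n * exp (- \<bar>x\<bar>)" using n by (intro mult_right_mono) auto
  finally have "cutoff n x = 1 / envelope x" by (simp add: cutoff_def)
  then show "ennreal (1 / envelope x) \<le> (SUP n. ennreal (cutoff n x))"
    by (intro SUP_upper2[of n]) auto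
qed

text \<open>Moving the weight from \<open>x\<close> to \<open>y\<close> costs exp |x - y|, which the
  Gaussian decay of the squared kernel absorbs. The weight is thus reproduced at \<open>y\<close>,
  with a factor free of \<open>n\<close>.\<close>

lemma cutoff_kernel_bound:
  assumes \<theta>: "\<theta> > 0" and r: "0 < r" "r \<le> T"
  shows "(\<integral>\<^sup>+x. ennreal (cutoff n x) * ennreal ((heat_kernel \<theta> r (x - y))\<^sup>2) \<partial>lborel)
    \<le> ennreal (exp (\<theta> * T / 2) / sqrt (2 * pi * \<theta>) / sqrt r) * ennreal (cutoff n y)"
proof -
  have "(\<integral>\<^sup>+x. ennreal (cutoff n x) * ennreal ((heat_kernel \<theta> r (x - y))\<^sup>2) \<partial>lborel)
      \<le> (\<integral>\<^sup>+x. ennreal (cutoff n y) * ennreal (exp \<bar>x - y\<bar> * (heat_kernel \<theta> r (x - y))\<^sup>2) \<partial>lborel)"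
  proof (intro nn_integral_mono)
    fix x
    show "ennreal (cutoff n x) * ennreal ((heat_kernel \<theta> r (x - y))\<^sup>2)
        \<le> ennreal (cutoff n y) * ennreal (exp \<bar>x - y\<bar> * (heat_kernel \<theta> r (x - y))\<^sup>2)"
      using mult_right_mono[OF cutoff_harnack[of n x y], of "(heat_kernel \<theta> r (x - y))\<^sup>2"] cutoff_nonneg
      by (simp add: ennreal_mult[symmetric] mult_ac)
  qed
  also have "\<dots> = ennreal (cutoff n y) * (\<integral>\<^sup>+x. ennreal (exp \<bar>x - y\<bar> * (heat_kernel \<theta> r (x - y))\<^sup>2) \<partial>lborel)"
    by (intro nn_integral_cmult) measurable
  also have "(\<integral>\<^sup>+x. ennreal (exp \<bar>x - y\<bar> * (heat_kernel \<theta> r (x - y))\<^sup>2) \<partial>lborel)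
      = (\<integral>\<^sup>+x. ennreal (exp \<bar>x\<bar> * (heat_kernel \<theta> r x)\<^sup>2) \<partial>lborel)"
    by (rule nn_integral_shift) measurable
  also have "ennreal (cutoff n y) * \<dots> \<le> ennreal (cutoff n y) * ennreal (exp (\<theta> * T / 2) / sqrt (2 * pi * \<theta>) / sqrt r)"
    by (intro mult_left_mono heat_kernel_square_exp_bound assms) auto
  finally show ?thesis by (simp add: mult.commute)
qed

text \<open>By Cauchy--Schwarz, the square of \<open>p\<^sub>t * u\<^sub>0\<close> is at most \<open>envelope\<close> times the convolution of \<open>u\<^sub>0\<close> with
  \<open>p\<^sub>t\<^sup>2 exp \<bar>\<cdot>\<bar>\<close>, whose total mass is only of order \<open>1 / sqrt t\<close>.\<close>

lemma cutoff_initial_bound: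
  assumes \<theta>: "\<theta> > 0" and t: "0 < t" "t \<le> T"
  shows "(\<integral>\<^sup>+x. ennreal (cutoff n x) * ennreal ((LINT y|lborel. heat_kernel \<theta> t (x - y) * u0 y)\<^sup>2) \<partial>lborel)
    \<le> ennreal (exp (\<theta> * T / 2) / sqrt (2 * pi * \<theta>) * (LINT y|lborel. u0 y) / sqrt t)"
proof -
  let ?p = "heat_kernel \<theta> t"
  let ?q = "\<lambda>x y. ennreal (exp \<bar>x - y\<bar> * (?p (x - y))\<^sup>2 * u0 y)"
  define C where "C = exp (\<theta> * T / 2) / sqrt (2 * pi * \<theta>) / sqrt t"
  have C: "C \<ge> 0" using \<theta> t by (simp add: C_def)
  have pt: "ennreal (cutoff n x) * ennreal ((LINT y|lborel. ?p (x - y) * u0 y)\<^sup>2) \<le> (\<integral>\<^sup>+y. ?q x y \<partial>lborel)" for x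
  proof -
    \<comment> \<open>The factors exp (|x - y| / 2) and exp (- |x - y| / 2) cancel in the product.
      The square of \<open>?g\<close> integrates to at most \<open>envelope x\<close>, which the
      weight cancels, and the square of \<open>?f\<close> is the squared kernel that is integrated
      over \<open>x\<close> below.\<close>
    let ?f = "\<lambda>y. ennreal (exp (\<bar>x - y\<bar> / 2) * ?p (x - y) * sqrt (u0 y))"
    let ?g = "\<lambda>y. ennreal (exp (- \<bar>x - y\<bar> / 2) * sqrt (u0 y))"
    have sq: "(ennreal a)\<^sup>2 = ennreal (a\<^sup>2)" if "a \<ge> 0" for a
      using that by (simp add: power2_eq_square ennreal_mult)
    have half: "(exp (a / 2))\<^sup>2 = exp a" for a :: real
      by (simp add: power2_eq_square exp_add[symmetric])
    have f2: "(?f y)\<^sup>2 = ?q x y" for y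
      using u0_nonneg[of y] heat_kernel_nonneg[of \<theta> t "x - y"] half[of "\<bar>x - y\<bar>"]
      by (subst sq) (simp_all add: power_mult_distrib)
    have g2: "(?g y)\<^sup>2 = ennreal (exp (- \<bar>x - y\<bar>) * u0 y)" for y
      using u0_nonneg[of y] half[of "- \<bar>x - y\<bar>"]
      by (subst sq) (simp_all add: power_mult_distrib)
    have fg: "ennreal (?p (x - y) * u0 y) = ?f y * ?g y" for y
    proof -
      have e: "exp (\<bar>x - y\<bar> / 2) * exp (- \<bar>x - y\<bar> / 2) = 1" unfolding exp_add[symmetric] by simp
      have s: "sqrt (u0 y) * sqrt (u0 y) = u0 y" using u0_nonneg by simp
      have "(exp (\<bar>x - y\<bar> / 2) * ?p (x - y) * sqrt (u0 y)) * (exp (- \<bar>x - y\<bar> / 2) * sqrt (u0 y))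
          = (exp (\<bar>x - y\<bar> / 2) * exp (- \<bar>x - y\<bar> / 2)) * (?p (x - y) * (sqrt (u0 y) * sqrt (u0 y)))"
        by (simp only: mult_ac)
      also have "\<dots> = ?p (x - y) * u0 y" unfolding e s by simp
      finally have "ennreal (?p (x - y) * u0 y)
          = ennreal ((exp (\<bar>x - y\<bar> / 2) * ?p (x - y) * sqrt (u0 y)) * (exp (- \<bar>x - y\<bar> / 2) * sqrt (u0 y)))"
        by (simp only:)
      then show ?thesis
        using u0_nonneg[of y] heat_kernel_nonneg[of \<theta> t "x - y"] by (simp only: ennreal_mult'' mult_nonneg_nonneg exp_ge_zero real_sqrt_ge_zero)
    qed
    \<comment> \<open>If the product fails to be integrable, the Bochner integral is 0 by convention
      and the bound is trivial.\<close>
    have "ennreal (\<bar>LINT y|lborel. ?p (x - y) * u0 y\<bar>) \<le> (\<integral>\<^sup>+y. ennreal (?p (x - y) * u0 y) \<partial>lborel)"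
    proof (cases "integrable lborel (\<lambda>y. ?p (x - y) * u0 y)")
      case True
      then show ?thesis
        using heat_kernel_nonneg u0_nonneg by (subst nn_integral_eq_integral) auto
    qed (simp add: not_integrable_integral_eq)
    then have "(ennreal (\<bar>LINT y|lborel. ?p (x - y) * u0 y\<bar>))\<^sup>2 \<le> (\<integral>\<^sup>+y. ?f y * ?g y \<partial>lborel)\<^sup>2"
      unfolding fg by (rule power_mono) simp
    also have "\<dots> \<le> (\<integral>\<^sup>+y. (?f y)\<^sup>2 \<partial>lborel) * (\<integral>\<^sup>+y. (?g y)\<^sup>2 \<partial>lborel)"
      by (rule Cauchy_Schwarz_nn_integral) measurable
    also have "\<dots> \<le> (\<integral>\<^sup>+y. ?q x y \<partial>lborel) * ennreal (envelope x)"
      unfolding f2 g2 by (intro mult_left_mono nn_integral_exp_u0_le) auto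
    finally have "ennreal (cutoff n x) * ennreal ((LINT y|lborel. ?p (x - y) * u0 y)\<^sup>2)
        \<le> ennreal (1 / envelope x) * ((\<integral>\<^sup>+y. ?q x y \<partial>lborel) * ennreal (envelope x))"
      by (intro mult_mono ennreal_leI) (auto simp: cutoff_def sq)
    also have "\<dots> = (ennreal (1 / envelope x) * ennreal (envelope x)) * (\<integral>\<^sup>+y. ?q x y \<partial>lborel)"
      by (simp only: mult_ac)
    also have "ennreal (1 / envelope x) * ennreal (envelope x) = 1"
      using envelope_pos[of x] by (simp add: ennreal_mult[symmetric])
    finally show ?thesis by simp
  qed
  have "(\<integral>\<^sup>+x. ennreal (cutoff n x) * ennreal ((LINT y|lborel. ?p (x - y) * u0 y)\<^sup>2) \<partial>lborel)
      \<le> (\<integral>\<^sup>+x. (\<integral>\<^sup>+y. ?q x y \<partial>lborel) \<partial>lborel)"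
    by (intro nn_integral_mono pt)
  also have "\<dots> = (\<integral>\<^sup>+y. (\<integral>\<^sup>+x. ?q x y \<partial>lborel) \<partial>lborel)"
    by (rule lborel_pair.Fubini') measurable
  also have "\<dots> \<le> (\<integral>\<^sup>+y. ennreal C * ennreal (u0 y) \<partial>lborel)"
  proof (intro nn_integral_mono)
    fix y
    have "(\<integral>\<^sup>+x. ?q x y \<partial>lborel) = (\<integral>\<^sup>+x. ennreal (exp \<bar>x - y\<bar> * (?p (x - y))\<^sup>2) * ennreal (u0 y) \<partial>lborel)"
      using u0_nonneg by (intro nn_integral_cong) (simp add: ennreal_mult)
    also have "\<dots> = (\<integral>\<^sup>+x. ennreal (exp \<bar>x - y\<bar> * (?p (x - y))\<^sup>2) \<partial>lborel) * ennreal (u0 y)"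
      by (intro nn_integral_multc) measurable
    also have "(\<integral>\<^sup>+x. ennreal (exp \<bar>x - y\<bar> * (?p (x - y))\<^sup>2) \<partial>lborel) = (\<integral>\<^sup>+x. ennreal (exp \<bar>x\<bar> * (?p x)\<^sup>2) \<partial>lborel)"
      by (rule nn_integral_shift) measurable
    also have "\<dots> * ennreal (u0 y) \<le> ennreal C * ennreal (u0 y)"
      unfolding C_def by (intro mult_right_mono heat_kernel_square_exp_bound assms) auto
    finally show "(\<integral>\<^sup>+x. ?q x y \<partial>lborel) \<le> ennreal C * ennreal (u0 y)" .
  qed
  also have "\<dots> = ennreal C * (\<integral>\<^sup>+y. ennreal (u0 y) \<partial>lborel)"
    by (intro nn_integral_cmult) measurable
  also have "\<dots> = ennreal (C * (LINT y|lborel. u0 y))"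
    using C u0_int u0_nonneg by (simp add: nn_integral_eq_integral ennreal_mult)
  finally show ?thesis by (simp add: C_def)
qed

end

section \<open>Weighted second moments of the solution\<close>

text \<open>The indicator extends the field by zero to negative times, so that the moments of a
  predictable field form a measurable function on the whole plane.\<close>

definition second_moment :: "'a measure \<Rightarrow> (real \<Rightarrow> real \<Rightarrow> 'a \<Rightarrow> real) \<Rightarrow> real \<Rightarrow> real \<Rightarrow> ennreal" where
  "second_moment M u t x = (\<integral>\<^sup>+\<omega>. ennreal ((indicator {0..} t * u t x \<omega>)\<^sup>2) \<partial>M)"

context noise
begin

lemma second_moment_measurable [measurable (raw)]:
  assumes u: "predictable_field M \<xi> u"
    and f: "f \<in> borel_measurable N" and g: "g \<in> borel_measurable N"
  shows "(\<lambda>z. second_moment M u (f z) (g z)) \<in> borel_measurable N"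
proof -
  define U where "U = (\<lambda>t x \<omega>. indicator {0..} t * u t x \<omega>)"
  have "(\<lambda>(t, x, \<omega>). U t x \<omega>) \<in> borel_measurable (borel \<Otimes>\<^sub>M (borel \<Otimes>\<^sub>M M))"
    using predictable_field_measurable[OF u] by (simp add: U_def)
  note [measurable (raw)] = measurable_compose3[OF this] and [measurable] = f g
  have "(\<lambda>z. \<integral>\<^sup>+\<omega>. ennreal ((U (f z) (g z) \<omega>)\<^sup>2) \<partial>M) \<in> borel_measurable N"
    by measurable
  then show ?thesis by (simp add: second_moment_def U_def)
qed

text \<open>Since \<sigma> vanishes at 0, the Lipschitz condition gives |\<sigma> z| \<le> L |z|
  without an additive constant; a constant would not be integrable against
  \<open>1 / envelope\<close>. Tonelli then brings the expectation inside.\<close>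

lemma walsh_convolution_bound:
  assumes u: "predictable_field M \<xi> u" and lip: "L-lipschitz_on UNIV \<sigma>" and \<sigma>0: "\<sigma> 0 = 0"
  shows "walsh_norm2 M (\<lambda>s y \<omega>. if 0 < s \<and> s < t then heat_kernel \<theta> (t - s) (x - y) * \<sigma> (u s y \<omega>) else 0)
    \<le> ennreal (L\<^sup>2) * (\<integral>\<^sup>+s. (\<integral>\<^sup>+y. indicator {0<..<t} s * (ennreal ((heat_kernel \<theta> (t - s) (x - y))\<^sup>2) * second_moment M u s y) \<partial>lborel) \<partial>lborel)"
proof -
  define U where "U = (\<lambda>t x \<omega>. indicator {0..} t * u t x \<omega>)"
  have "(\<lambda>(t, x, \<omega>). U t x \<omega>) \<in> borel_measurable (borel \<Otimes>\<^sub>M (borel \<Otimes>\<^sub>M M))"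
    using predictable_field_measurable[OF u] by (simp add: U_def)
  note [measurable (raw)] = measurable_compose3[OF this]
  have sm: "second_moment M u s y = (\<integral>\<^sup>+\<omega>. ennreal ((U s y \<omega>)\<^sup>2) \<partial>M)" for s y
    by (simp add: second_moment_def U_def)
  have hk [measurable]: "(\<lambda>(s, y). heat_kernel \<theta> (t - s) (x - y)) \<in> borel_measurable (borel \<Otimes>\<^sub>M borel)"
    unfolding heat_kernel_def by measurable
  have L: "L \<ge> 0" using lip by (rule lipschitz_on_nonneg)
  have \<sigma>: "(\<sigma> z)\<^sup>2 \<le> L\<^sup>2 * z\<^sup>2" for z
    using lipschitz_onD[OF lip, of z 0] \<sigma>0 power_mono[of "\<bar>\<sigma> z\<bar>" "L * \<bar>z\<bar>" 2]
    by (simp add: dist_real_def power_mult_distrib)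
  let ?k = "\<lambda>s y. indicator {0<..<t} s * ennreal ((heat_kernel \<theta> (t - s) (x - y))\<^sup>2)"
  have "walsh_norm2 M (\<lambda>s y \<omega>. if 0 < s \<and> s < t then heat_kernel \<theta> (t - s) (x - y) * \<sigma> (u s y \<omega>) else 0)
      \<le> (\<integral>\<^sup>+\<omega>. (\<integral>\<^sup>+s. (\<integral>\<^sup>+y. ennreal (L\<^sup>2) * (?k s y * ennreal ((U s y \<omega>)\<^sup>2)) \<partial>lborel) \<partial>lborel) \<partial>M)"
    unfolding walsh_norm2_eq
  proof (intro nn_integral_mono)
    fix \<omega> s y
    have "(heat_kernel \<theta> (t - s) (x - y) * \<sigma> (u s y \<omega>))\<^sup>2 \<le> L\<^sup>2 * ((heat_kernel \<theta> (t - s) (x - y))\<^sup>2 * (u s y \<omega>)\<^sup>2)"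
      using mult_left_mono[OF \<sigma>[of "u s y \<omega>"], of "(heat_kernel \<theta> (t - s) (x - y))\<^sup>2"]
      by (simp add: power_mult_distrib mult_ac)
    then show "ennreal ((indicator {0..} s * (if 0 < s \<and> s < t then heat_kernel \<theta> (t - s) (x - y) * \<sigma> (u s y \<omega>) else 0))\<^sup>2)
        \<le> ennreal (L\<^sup>2) * (?k s y * ennreal ((U s y \<omega>)\<^sup>2))"
      by (auto simp: U_def ennreal_mult[symmetric] intro!: ennreal_leI)
  qed
  also have "\<dots> = (\<integral>\<^sup>+s. (\<integral>\<^sup>+y. (\<integral>\<^sup>+\<omega>. ennreal (L\<^sup>2) * (?k s y * ennreal ((U s y \<omega>)\<^sup>2)) \<partial>M) \<partial>lborel) \<partial>lborel)"
    by (rule nn_integral_rotate3) measurable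
  also have "\<dots> = (\<integral>\<^sup>+s. (\<integral>\<^sup>+y. ennreal (L\<^sup>2) * (?k s y * second_moment M u s y) \<partial>lborel) \<partial>lborel)"
    unfolding sm by (simp add: nn_integral_cmult)
  also have "\<dots> = (\<integral>\<^sup>+s. ennreal (L\<^sup>2) * (\<integral>\<^sup>+y. ?k s y * second_moment M u s y \<partial>lborel) \<partial>lborel)"
    using u by (intro nn_integral_cong nn_integral_cmult) measurable
  also have "\<dots> = ennreal (L\<^sup>2) * (\<integral>\<^sup>+s. (\<integral>\<^sup>+y. ?k s y * second_moment M u s y \<partial>lborel) \<partial>lborel)"
    using u by (intro nn_integral_cmult) measurable
  finally show ?thesis by (simp add: mult.assoc)
qed

text \<open>The 8 is 2 * 4: a factor 2 from the square of the sum of heat flow and stochastic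
  integral, and a factor 4 from the bound on the Walsh integral.\<close>

lemma mild_second_moment:
  assumes mild: "mild_solution M \<xi> \<theta> \<sigma> u0 u" and lip: "L-lipschitz_on UNIV \<sigma>" and \<sigma>0: "\<sigma> 0 = 0"
    and t: "t > 0"
  shows "second_moment M u t x \<le> 2 * ennreal ((LINT y|lborel. heat_kernel \<theta> t (x - y) * u0 y)\<^sup>2)
    + ennreal (8 * L\<^sup>2) * (\<integral>\<^sup>+s. (\<integral>\<^sup>+y. indicator {0<..<t} s * (ennreal ((heat_kernel \<theta> (t - s) (x - y))\<^sup>2) * second_moment M u s y) \<partial>lborel) \<partial>lborel)"
    (is "_ \<le> _ + _ * ?I")
proof -
  have u: "predictable_field M \<xi> u" using mild by (simp add: mild_solution_def)
  obtain Z where Z: "\<forall>t>0. \<forall>x. is_walsh_integral M \<xi>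
        (\<lambda>s y \<omega>. if 0 < s \<and> s < t then heat_kernel \<theta> (t - s) (x - y) * \<sigma> (u s y \<omega>) else 0) (Z t x)"
    and eq: "AE \<omega> in M. \<forall>t>0. \<forall>x. u t x \<omega> = (LINT y|lborel. heat_kernel \<theta> t (x - y) * u0 y) + Z t x \<omega>"
    using mild unfolding mild_solution_def by blast
  define P where "P = (LINT y|lborel. heat_kernel \<theta> t (x - y) * u0 y)"
  have W: "is_walsh_integral M \<xi>
        (\<lambda>s y \<omega>. if 0 < s \<and> s < t then heat_kernel \<theta> (t - s) (x - y) * \<sigma> (u s y \<omega>) else 0) (Z t x)"
    using Z t by blast
  then have [measurable]: "Z t x \<in> borel_measurable M" by (simp add: is_walsh_integral_def)
  have "AE \<omega> in M. u t x \<omega> = P + Z t x \<omega>"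
    using eq by eventually_elim (use t in \<open>simp add: P_def\<close>)
  then have "second_moment M u t x \<le> (\<integral>\<^sup>+\<omega>. 2 * ennreal (P\<^sup>2) + 2 * ennreal ((Z t x \<omega>)\<^sup>2) \<partial>M)"
    unfolding second_moment_def
  proof (intro nn_integral_mono_AE, eventually_elim)
    case (elim \<omega>)
    have "(P + Z t x \<omega>)\<^sup>2 \<le> 2 * P\<^sup>2 + 2 * (Z t x \<omega>)\<^sup>2"
      using zero_le_power2[of "P - Z t x \<omega>"] by (simp add: power2_eq_square algebra_simps)
    then have "ennreal ((P + Z t x \<omega>)\<^sup>2) \<le> ennreal (2 * P\<^sup>2 + 2 * (Z t x \<omega>)\<^sup>2)" by (rule ennreal_leI)
    then show ?case using t elim by (simp add: ennreal_plus ennreal_mult)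
  qed
  also have "\<dots> = 2 * ennreal (P\<^sup>2) + 2 * (\<integral>\<^sup>+\<omega>. ennreal ((Z t x \<omega>)\<^sup>2) \<partial>M)"
    by (simp add: nn_integral_add nn_integral_cmult emeasure_space_1)
  also have "(\<integral>\<^sup>+\<omega>. ennreal ((Z t x \<omega>)\<^sup>2) \<partial>M) \<le> 4 * (ennreal (L\<^sup>2) * ?I)"
    by (intro order_trans[OF walsh_integral_bound[OF W]] mult_left_mono walsh_convolution_bound u lip \<sigma>0) auto
  also have "2 * (4 * (ennreal (L\<^sup>2) * ?I)) = ennreal (8 * L\<^sup>2) * ?I"
    by (simp add: ennreal_mult mult.assoc[symmetric])
  finally show ?thesis by (simp add: P_def add_left_mono mult_left_mono)
qed

end

text \<open>Source of the a priori bound with which the Gronwall argument starts.\<close>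

lemma mild_second_moment_bounded:
  assumes "mild_solution M \<xi> \<theta> \<sigma> u0 u"
  obtains N where "N < \<infinity>" "\<And>t x. t \<in> {0..T} \<Longrightarrow> second_moment M u t x \<le> N"
proof
  show "(SUP t\<in>{0..T}. SUP x. \<integral>\<^sup>+\<omega>. ennreal (\<bar>u t x \<omega>\<bar>\<^sup>2) \<partial>M) < \<infinity>"
    using assms by (simp add: mild_solution_def)
  show "second_moment M u t x \<le> (SUP t\<in>{0..T}. SUP x. \<integral>\<^sup>+\<omega>. ennreal (\<bar>u t x \<omega>\<bar>\<^sup>2) \<partial>M)"
    if "t \<in> {0..T}" for t x
    using that unfolding second_moment_def
    by (intro SUP_upper2[of t] SUP_upper2[of x] nn_integral_mono) auto
qed

section \<open>The Gronwall argument for the weighted moments\<close>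

locale mild_decay = noise M \<xi> + decay_profile u0
  for M :: "'a measure" and \<xi> :: "(real \<times> real \<Rightarrow> real) \<Rightarrow> 'a \<Rightarrow> real" and u0 :: "real \<Rightarrow> real" +
  fixes \<theta> L :: real and \<sigma> :: "real \<Rightarrow> real" and u :: "real \<Rightarrow> real \<Rightarrow> 'a \<Rightarrow> real"
  assumes \<theta>: "\<theta> > 0" and lip: "L-lipschitz_on UNIV \<sigma>" and \<sigma>0: "\<sigma> 0 = 0"
    and mild: "mild_solution M \<xi> \<theta> \<sigma> u0 u"
begin

lemma predictable: "predictable_field M \<xi> u"
  using mild by (simp add: mild_solution_def)

lemmas [measurable (raw)] = second_moment_measurable[OF predictable]

text \<open>The \<open>F t\<close> of the overview, with \<open>1 / envelope\<close> replaced by its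
  cutoff.\<close>

definition weighted_moment :: "nat \<Rightarrow> real \<Rightarrow> ennreal" where
  "weighted_moment n t = (\<integral>\<^sup>+x. ennreal (cutoff n x) * second_moment M u t x \<partial>lborel)"

lemma weighted_moment_measurable [measurable]: "weighted_moment n \<in> borel_measurable borel"
  unfolding weighted_moment_def by measurable

text \<open>After the pointwise moment bound is integrated against the weight, the
  \<open>x\<close>-integral is moved innermost. There the kernel estimate returns the weight at
  \<open>y\<close> times \<open>C / sqrt (t - s)\<close>, so the same weighted moment reappears at
  time \<open>s\<close>. \<open>C\<close> depends on \<open>T\<close>, but neither on
  \<open>t\<close> nor on \<open>n\<close>.\<close>

lemma weighted_moment_abel:
  assumes t: "t \<in> {0<..T}"
  defines "C \<equiv> exp (\<theta> * T / 2) / sqrt (2 * pi * \<theta>)"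
  shows "weighted_moment n t \<le> ennreal (2 * C * (LINT y|lborel. u0 y) / sqrt t)
    + ennreal (8 * L\<^sup>2 * C) * (\<integral>\<^sup>+s. abel_kernel t s * weighted_moment n s \<partial>lborel)"
proof -
  have C: "C \<ge> 0" using \<theta> by (simp add: C_def)
  have t0: "0 < t" "t \<le> T" using t by auto
  let ?P = "\<lambda>x. ennreal ((LINT y|lborel. heat_kernel \<theta> t (x - y) * u0 y)\<^sup>2)"
  define k where "k s y x = indicator {0<..<t} s * (ennreal ((heat_kernel \<theta> (t - s) (x - y))\<^sup>2) * second_moment M u s y)" for s y x
  have [measurable]: "(\<lambda>(s, y, x). k s y x) \<in> borel_measurable (borel \<Otimes>\<^sub>M (borel \<Otimes>\<^sub>M borel))"
    unfolding k_def heat_kernel_def by measurable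
  \<comment> \<open>The rotation of the three integrals is applied with \<open>lborel\<close> in the
    role of the probability space, hence this form of the last factor.\<close>
  then have k3: "(\<lambda>(s, y, x). k s y x) \<in> borel_measurable (borel \<Otimes>\<^sub>M (borel \<Otimes>\<^sub>M lborel))"
    by simp
  note [measurable (raw)] = measurable_compose3[OF k3, simplified]
  have hk [measurable]: "(\<lambda>(x, y). heat_kernel \<theta> t (x - y)) \<in> borel_measurable (borel \<Otimes>\<^sub>M borel)"
    unfolding heat_kernel_def by measurable
  have "weighted_moment n t \<le> (\<integral>\<^sup>+x. ennreal (cutoff n x) * (2 * ?P x + ennreal (8 * L\<^sup>2) * (\<integral>\<^sup>+s. (\<integral>\<^sup>+y. k s y x \<partial>lborel) \<partial>lborel)) \<partial>lborel)"
    unfolding weighted_moment_def k_def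
    by (intro nn_integral_mono mult_left_mono mild_second_moment[OF mild lip \<sigma>0 t0(1)]) auto
  also have "\<dots> = (\<integral>\<^sup>+x. 2 * (ennreal (cutoff n x) * ?P x) + ennreal (8 * L\<^sup>2) * (\<integral>\<^sup>+s. (\<integral>\<^sup>+y. ennreal (cutoff n x) * k s y x \<partial>lborel) \<partial>lborel) \<partial>lborel)"
    by (simp add: nn_integral_cmult distrib_left mult.left_commute)
  also have "\<dots> = 2 * (\<integral>\<^sup>+x. ennreal (cutoff n x) * ?P x \<partial>lborel)
      + ennreal (8 * L\<^sup>2) * (\<integral>\<^sup>+x. (\<integral>\<^sup>+s. (\<integral>\<^sup>+y. ennreal (cutoff n x) * k s y x \<partial>lborel) \<partial>lborel) \<partial>lborel)"
    by (simp add: nn_integral_add nn_integral_cmult)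
  also have "(\<integral>\<^sup>+x. (\<integral>\<^sup>+s. (\<integral>\<^sup>+y. ennreal (cutoff n x) * k s y x \<partial>lborel) \<partial>lborel) \<partial>lborel)
      = (\<integral>\<^sup>+s. (\<integral>\<^sup>+y. (\<integral>\<^sup>+x. ennreal (cutoff n x) * k s y x \<partial>lborel) \<partial>lborel) \<partial>lborel)"
    by (rule lborel.nn_integral_rotate3) simp
  also have "\<dots> \<le> (\<integral>\<^sup>+s. ennreal C * (abel_kernel t s * weighted_moment n s) \<partial>lborel)"
  proof (intro nn_integral_mono)
    fix s
    have "(\<integral>\<^sup>+y. (\<integral>\<^sup>+x. ennreal (cutoff n x) * k s y x \<partial>lborel) \<partial>lborel)
        \<le> (\<integral>\<^sup>+y. (ennreal C * abel_kernel t s) * (ennreal (cutoff n y) * second_moment M u s y) \<partial>lborel)"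
    proof (intro nn_integral_mono)
      fix y
      show "(\<integral>\<^sup>+x. ennreal (cutoff n x) * k s y x \<partial>lborel) \<le> (ennreal C * abel_kernel t s) * (ennreal (cutoff n y) * second_moment M u s y)"
      proof (cases "s \<in> {0<..<t}")
        case True
        have "(\<integral>\<^sup>+x. ennreal (cutoff n x) * k s y x \<partial>lborel)
            = (\<integral>\<^sup>+x. (ennreal (cutoff n x) * ennreal ((heat_kernel \<theta> (t - s) (x - y))\<^sup>2)) * second_moment M u s y \<partial>lborel)"
          using True by (simp add: k_def mult.assoc)
        also have "\<dots> = (\<integral>\<^sup>+x. ennreal (cutoff n x) * ennreal ((heat_kernel \<theta> (t - s) (x - y))\<^sup>2) \<partial>lborel) * second_moment M u s y"
          by (intro nn_integral_multc) measurable
        also have "\<dots> \<le> (ennreal (C / sqrt (t - s)) * ennreal (cutoff n y)) * second_moment M u s y"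
          unfolding C_def using True t0 by (intro mult_right_mono cutoff_kernel_bound \<theta>) auto
        also have "ennreal (C / sqrt (t - s)) = ennreal C * abel_kernel t s"
          using True C by (simp add: abel_kernel_def ennreal_mult[symmetric])
        finally show ?thesis by (simp add: mult.assoc)
      qed (simp add: k_def)
    qed
    also have "\<dots> = (ennreal C * abel_kernel t s) * weighted_moment n s"
      unfolding weighted_moment_def by (intro nn_integral_cmult) measurable
    finally show "(\<integral>\<^sup>+y. (\<integral>\<^sup>+x. ennreal (cutoff n x) * k s y x \<partial>lborel) \<partial>lborel) \<le> ennreal C * (abel_kernel t s * weighted_moment n s)"
      by (simp add: mult.assoc)
  qed
  also have "\<dots> = ennreal C * (\<integral>\<^sup>+s. abel_kernel t s * weighted_moment n s \<partial>lborel)"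
    by (intro nn_integral_cmult) measurable
  also have "2 * (\<integral>\<^sup>+x. ennreal (cutoff n x) * ?P x \<partial>lborel) \<le> 2 * ennreal (C * (LINT y|lborel. u0 y) / sqrt t)"
    unfolding C_def by (intro mult_left_mono cutoff_initial_bound \<theta> t0) auto
  finally have "weighted_moment n t \<le> 2 * ennreal (C * (LINT y|lborel. u0 y) / sqrt t)
      + ennreal (8 * L\<^sup>2) * (ennreal C * (\<integral>\<^sup>+s. abel_kernel t s * weighted_moment n s \<partial>lborel))"
    by (simp add: add_mono mult_left_mono)
  also have "2 * ennreal (C * (LINT y|lborel. u0 y) / sqrt t) = ennreal (2 * C * (LINT y|lborel. u0 y) / sqrt t)"
    using ennreal_mult'[of 2 "C * (LINT y|lborel. u0 y) / sqrt t"] by (simp add: mult.assoc)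
  also have "ennreal (8 * L\<^sup>2) * (ennreal C * (\<integral>\<^sup>+s. abel_kernel t s * weighted_moment n s \<partial>lborel))
      = ennreal (8 * L\<^sup>2 * C) * (\<integral>\<^sup>+s. abel_kernel t s * weighted_moment n s \<partial>lborel)"
    using C by (simp add: ennreal_mult mult.assoc)
  finally show ?thesis .
qed

text \<open>The bound from the Gronwall inequality is chosen before \<open>n\<close>, so it holds
  for all cutoffs at once and survives their monotone limit.\<close>

lemma second_moment_weight_finite:
  assumes T: "T > 0"
  shows "(\<integral>\<^sup>+x. ennreal (1 / envelope x) * second_moment M u T x \<partial>lborel) < \<infinity>"
proof -
  define C where "C = exp (\<theta> * T / 2) / sqrt (2 * pi * \<theta>)"
  have C: "C \<ge> 0" using \<theta> by (simp add: C_def)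
  have m: "0 \<le> (LINT y|lborel. u0 y)" by (simp add: u0_nonneg Bochner_Integration.integral_nonneg)
  have A: "0 \<le> 2 * C * (LINT y|lborel. u0 y)" and B: "0 \<le> 8 * L\<^sup>2 * C" using C m by auto
  obtain N where N: "N < \<infinity>" "\<And>t x. t \<in> {0..T} \<Longrightarrow> second_moment M u t x \<le> N"
    using mild_second_moment_bounded[OF mild] by blast
  show ?thesis
  proof (rule abel_gronwall[OF A B T], goal_cases)
    case (1 R)
    \<comment> \<open>The a priori bound supplied here is the mass of \<open>cutoff n\<close> times
      \<open>N\<close>. It may grow with \<open>n\<close>, but it does not enter
      \<open>R\<close>.\<close>
    have bound: "weighted_moment n T \<le> R" for n
    proof (rule 1(2))
      show "(\<integral>\<^sup>+x. ennreal (cutoff n x) \<partial>lborel) * N < \<infinity>"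
        using cutoff_integrable N(1) by (simp add: ennreal_mult_less_top)
      show "weighted_moment n t \<le> (\<integral>\<^sup>+x. ennreal (cutoff n x) \<partial>lborel) * N" if "t \<in> {0<..T}" for t
      proof -
        have "weighted_moment n t \<le> (\<integral>\<^sup>+x. ennreal (cutoff n x) * N \<partial>lborel)"
          unfolding weighted_moment_def using that by (intro nn_integral_mono mult_left_mono N) auto
        then show ?thesis by (simp add: nn_integral_multc)
      qed
      show "weighted_moment n t \<le> ennreal (2 * C * (LINT y|lborel. u0 y) / sqrt t)
          + ennreal (8 * L\<^sup>2 * C) * (\<integral>\<^sup>+s. abel_kernel t s * weighted_moment n s \<partial>lborel)" if "t \<in> {0<..T}" for t
        using weighted_moment_abel[OF that] by (simp add: C_def)
    qed simp
    have "(\<integral>\<^sup>+x. ennreal (1 / envelope x) * second_moment M u T x \<partial>lborel)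
        = (\<integral>\<^sup>+x. (SUP n. ennreal (cutoff n x) * second_moment M u T x) \<partial>lborel)"
      by (simp add: cutoff_SUP[symmetric] SUP_mult_right_ennreal)
    also have "\<dots> = (SUP n. weighted_moment n T)"
      unfolding weighted_moment_def using cutoff_mono
      by (intro nn_integral_monotone_convergence_SUP) (auto simp: incseq_def le_fun_def intro!: mult_right_mono)
    also have "\<dots> \<le> R" by (intro SUP_least bound)
    finally show ?thesis using 1(1) by (rule le_less_trans)
  qed
qed

text \<open>By Tonelli, the finite weighted moment is the expectation of a weighted integral of the
  squared path, which is therefore almost surely finite. The integrable envelope accounts for the
  rest of the L1 norm.\<close>

lemma L1_norm_finite:
  assumes t: "t > 0"
  shows "AE \<omega> in M. L1_norm (\<lambda>x. u t x \<omega>) < \<infinity>"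
proof -
  define U where "U = (\<lambda>t x \<omega>. indicator {0..} t * u t x \<omega>)"
  have "(\<lambda>(t, x, \<omega>). U t x \<omega>) \<in> borel_measurable (borel \<Otimes>\<^sub>M (borel \<Otimes>\<^sub>M M))"
    using predictable_field_measurable[OF predictable] by (simp add: U_def)
  note [measurable (raw)] = measurable_compose3[OF this]
  have U: "U t x \<omega> = u t x \<omega>" for x \<omega> using t by (simp add: U_def)
  have sm: "second_moment M u t x = (\<integral>\<^sup>+\<omega>. ennreal ((U t x \<omega>)\<^sup>2) \<partial>M)" for x
    by (simp add: second_moment_def U_def)
  interpret P: pair_sigma_finite M lborel ..
  let ?J = "\<lambda>\<omega>. \<integral>\<^sup>+x. ennreal (1 / envelope x) * ennreal ((U t x \<omega>)\<^sup>2) \<partial>lborel"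
  have "(\<integral>\<^sup>+\<omega>. ?J \<omega> \<partial>M) = (\<integral>\<^sup>+x. (\<integral>\<^sup>+\<omega>. ennreal (1 / envelope x) * ennreal ((U t x \<omega>)\<^sup>2) \<partial>M) \<partial>lborel)"
    by (rule P.Fubini'[symmetric]) measurable
  also have "\<dots> = (\<integral>\<^sup>+x. ennreal (1 / envelope x) * second_moment M u t x \<partial>lborel)"
    unfolding sm by (simp add: nn_integral_cmult)
  also have "\<dots> < \<infinity>" by (rule second_moment_weight_finite[OF t])
  finally have "AE \<omega> in M. ?J \<omega> \<noteq> \<infinity>"
    by (intro nn_integral_PInf_AE) auto
  then show ?thesis
    using AE_space
  proof eventually_elim
    case (elim \<omega>)
    then have [measurable]: "\<omega> \<in> space M" by simp
    have "L1_norm (\<lambda>x. u t x \<omega>) \<le> (\<integral>\<^sup>+x. ennreal (1 / envelope x) * ennreal ((U t x \<omega>)\<^sup>2) + ennreal (envelope x) \<partial>lborel)"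
      unfolding L1_norm_def
    proof (intro nn_integral_mono)
      fix x
      define z where "z = U t x \<omega>"
      have "0 \<le> (\<bar>z\<bar> - envelope x)\<^sup>2 + \<bar>z\<bar> * envelope x" using envelope_pos[of x] by simp
      then have "\<bar>z\<bar> * envelope x \<le> z\<^sup>2 + envelope x * envelope x" by (simp add: power2_diff power2_eq_square[of "envelope x"])
      then have "\<bar>z\<bar> \<le> 1 / envelope x * z\<^sup>2 + envelope x" using envelope_pos[of x] by (simp add: field_simps)
      then have "ennreal \<bar>z\<bar> \<le> ennreal (1 / envelope x * z\<^sup>2 + envelope x)" by (rule ennreal_leI)
      also have "\<dots> = ennreal (1 / envelope x) * ennreal (z\<^sup>2) + ennreal (envelope x)"
        using envelope_pos[of x] by (simp only: ennreal_mult ennreal_plus less_imp_le zero_le_divide_1_iff zero_le_power2 mult_nonneg_nonneg)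
      finally show "ennreal \<bar>u t x \<omega>\<bar> \<le> ennreal (1 / envelope x) * ennreal ((U t x \<omega>)\<^sup>2) + ennreal (envelope x)"
        by (simp add: z_def U)
    qed
    also have "\<dots> = ?J \<omega> + (\<integral>\<^sup>+x. ennreal (envelope x) \<partial>lborel)"
      by (intro nn_integral_add) measurable
    also have "\<dots> < \<infinity>" using elim envelope_integrable by (simp add: less_top)
    finally show ?case .
  qed
qed

end

section \<open>Integrability of the initial function and finiteness of the system\<close>

theorem corollary1p1:
  fixes M :: "'a measure"
    and \<xi> :: "(real \<times> real \<Rightarrow> real) \<Rightarrow> 'a \<Rightarrow> real"
    and \<theta> :: real
    and \<sigma> u0 :: "real \<Rightarrow> real"
    and u :: "real \<Rightarrow> real \<Rightarrow> 'a \<Rightarrow> real"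
  assumes "prob_space M"
    and "white_noise M \<xi>"
    and "\<theta> > 0"
    and "\<exists>L. L-lipschitz_on UNIV \<sigma>"
    and "\<And>z. \<sigma> z \<ge> 0"
    and "\<sigma> 0 = 0"
    and "u0 \<in> borel_measurable borel"
    and "bounded (range u0)"
    and "\<And>x. u0 x \<ge> 0"
    and "mild_solution M \<xi> \<theta> \<sigma> u0 u"
    and "continuous_version M u"
  shows "integrable lborel u0 \<longleftrightarrow> finite_system M u"
proof
  interpret prob_space M by fact
  have "AE \<omega> in M. \<forall>x. u 0 x \<omega> = u0 x"
    using assms(10) by (simp add: mild_solution_def)
  then have initial: "AE \<omega> in M. L1_norm (\<lambda>x. u 0 x \<omega>) = L1_norm u0"
    by eventually_elim (simp add: L1_norm_def)
  have u0_iff: "L1_norm u0 < \<infinity> \<longleftrightarrow> integrable lborel u0"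
    using assms(7) by (simp add: L1_norm_def integrable_iff_bounded)
  {
    assume u0: "integrable lborel u0"
    obtain L where L: "L-lipschitz_on UNIV \<sigma>" using assms(4) by blast
    interpret mild_decay M \<xi> u0 \<theta> L \<sigma> u
      using assms L u0 by unfold_locales auto
    show "finite_system M u"
      unfolding finite_system_def
    proof (intro allI impI)
      fix t :: real assume "t \<ge> 0"
      show "AE \<omega> in M. L1_norm (\<lambda>x. u t x \<omega>) < \<infinity>"
      \<comment> \<open>The mild equation speaks of positive times only; at time 0 the initial
        condition decides.\<close>
      proof (cases "t = 0")
        case True
        from initial show ?thesis
          unfolding True by eventually_elim (use u0 u0_iff in simp)
      next
        case False
        with \<open>t \<ge> 0\<close> show ?thesis by (intro L1_norm_finite) simp
      qed
    qed
  next
    assume "finite_system M u"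
    then have "AE \<omega> in M. L1_norm (\<lambda>x. u 0 x \<omega>) < \<infinity>"
      by (simp add: finite_system_def)
    with initial have "AE \<omega> in M. L1_norm u0 < \<infinity>"
      by eventually_elim simp
    \<comment> \<open>The assertion no longer depends on the outcome, and an almost sure constant
      assertion is true in a probability space.\<close>
    then show "integrable lborel u0" using u0_iff by simp
  }
qed

end
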